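(* Let $\mathbf{A}$ be a commutative ring and let $\mathbf{B}$ be a commutative $\mathbf{A}$-algebra which is free of finite rank as an $\mathbf{A}$-module. Let $\Omega_{\mathbf{B}/\mathbf{A}}$ be the $\mathbf{B}$-module of (Kähler) differentials of $\mathbf{B}/\mathbf{A}$, let $\mathrm{N}_{\mathbf{B}/\mathbf{A}}:\mathbf{B}\to\mathbf{A}$ be the norm, and let $\mathrm{Disc}(\mathbf{B}/\mathbf{A})$ be the discriminant of a basis of $\mathbf{B}/\mathbf{A}$ (defined up to multiplication by the square of a unit of $\mathbf{A}$). 1. The $\mathbf{B}$-module $\Omega_{\mathbf{B}/\mathbf{A}}$ is finitely presented, and its Fitting ideal $\mathcal{F}_0(\Omega_{\mathbf{B}/\mathbf{A}})$ (an ideal of $\mathbf{B}$) has the following property: for every $b\in\mathbf{B}$, $$b\in\mathcal{F}_0(\Omega_{\mathbf{B}/\mathbf{A}})\ \Longrightarrow\ \mathrm{Disc}(\mathbf{B}/\mathbf{A})\ \text{ divides }\ \mathrm{N}_{\mathbf{B}/\mathbf{A}}(b)\ \text{ in } \mathbf{A}.$$ 2. If $\Omega_{\mathbf{B}/\mathbf{A}}=0$, then $\mathrm{Disc}(\mathbf{B}/\mathbf{A})$ is invertible in $\mathbf{A}$.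
   Context: For $b\in\mathbf{B}$, $\mathrm{Tr}_{\mathbf{B}/\mathbf{A}}(b)$ and $\mathrm{N}_{\mathbf{B}/\mathbf{A}}(b)$ are the trace and the determinant of the $\mathbf{A}$-linear endomorphism "multiplication by $b$" of $\mathbf{B}$. The discriminant of a basis $(\varepsilon_1,\dots,\varepsilon_n)$ of $\mathbf{B}$ over $\mathbf{A}$ is $\det\big((\mathrm{Tr}_{\mathbf{B}/\mathbf{A}}(\varepsilon_i\varepsilon_j))_{1\le i,j\le n}\big)\in\mathbf{A}$. For a finitely presented module $M$ over a commutative ring, given by $m$ generators and finitely many relations, $\mathcal{F}_0(M)$ is the ideal generated by the $m\times m$ minors of a presentation matrix (the $0$-th Fitting ideal; it is independent of the presentation). *)

theory Defs
  imports "HOL-Algebra.Algebra" "HOL-Combinatorics.Permutations"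
begin

text \<open>
  Rings and modules are the carrier-based structures of \<open>HOL-Algebra\<close>, so zero rings are allowed.
  A commutative \<open>A\<close>-algebra \<open>B\<close> is an instance of the library locale \<^locale>\<open>algebra\<close>.
  An \<open>m \<times> n\<close> matrix is a function \<open>nat \<Rightarrow> nat \<Rightarrow> 'a\<close> of which only the entries with indices below
  \<open>m\<close> and \<open>n\<close> matter.
\<close>

subsection \<open>Determinant and trace of a square matrix over a commutative ring\<close>

definition mat_det :: "('a, 'c) ring_scheme \<Rightarrow> nat \<Rightarrow> (nat \<Rightarrow> nat \<Rightarrow> 'a) \<Rightarrow> 'a" where
  "mat_det R n M =
     (\<Oplus>\<^bsub>R\<^esub> p \<in> {p. p permutes {..<n}}.
        (if evenperm p then \<Otimes>\<^bsub>R\<^esub> i \<in> {..<n}. M i (p i)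
         else \<ominus>\<^bsub>R\<^esub> (\<Otimes>\<^bsub>R\<^esub> i \<in> {..<n}. M i (p i))))"

definition mat_trace :: "('a, 'c) ring_scheme \<Rightarrow> nat \<Rightarrow> (nat \<Rightarrow> nat \<Rightarrow> 'a) \<Rightarrow> 'a" where
  "mat_trace R n M = (\<Oplus>\<^bsub>R\<^esub> i \<in> {..<n}. M i i)"

subsection \<open>Bases, trace, norm and discriminant\<close>

definition lin_comb ::
  "('r, 'x, 'd) module_scheme \<Rightarrow> nat \<Rightarrow> (nat \<Rightarrow> 'r) \<Rightarrow> (nat \<Rightarrow> 'x) \<Rightarrow> 'x" where
  "lin_comb M n c g = (\<Oplus>\<^bsub>M\<^esub> i \<in> {..<n}. c i \<odot>\<^bsub>M\<^esub> g i)"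

definition free_basis ::
  "('r, 'c) ring_scheme \<Rightarrow> ('r, 'x, 'd) module_scheme \<Rightarrow> nat \<Rightarrow> (nat \<Rightarrow> 'x) \<Rightarrow> bool" where
  "free_basis R M n e \<longleftrightarrow>
     e \<in> {..<n} \<rightarrow> carrier M \<and>
     (\<forall>x \<in> carrier M. \<exists>!c. c \<in> {..<n} \<rightarrow>\<^sub>E carrier R \<and> x = lin_comb M n c e)"

definition coords ::
  "('r, 'c) ring_scheme \<Rightarrow> ('r, 'x, 'd) module_scheme \<Rightarrow> nat \<Rightarrow> (nat \<Rightarrow> 'x) \<Rightarrow> 'x \<Rightarrow> nat \<Rightarrow> 'r" where
  "coords R M n e x = (THE c. c \<in> {..<n} \<rightarrow>\<^sub>E carrier R \<and> x = lin_comb M n c e)"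

text \<open>
  Trace and determinant of the \<open>A\<close>-linear endomorphism ``multiplication by \<open>b\<close>'' are computed on its
  matrix with respect to a given basis \<open>e\<close> (column \<open>j\<close> holds the coordinates of \<open>b e\<^sub>j\<close>); their
  values do not depend on \<open>e\<close>.
\<close>

definition mult_matrix ::
  "('a, 'c) ring_scheme \<Rightarrow> ('a, 'b, 'd) module_scheme \<Rightarrow> nat \<Rightarrow> (nat \<Rightarrow> 'b) \<Rightarrow> 'b
     \<Rightarrow> nat \<Rightarrow> nat \<Rightarrow> 'a" where
  "mult_matrix A B n e b = (\<lambda>i j. coords A B n e (b \<otimes>\<^bsub>B\<^esub> e j) i)"

definition alg_trace ::
  "('a, 'c) ring_scheme \<Rightarrow> ('a, 'b, 'd) module_scheme \<Rightarrow> nat \<Rightarrow> (nat \<Rightarrow> 'b) \<Rightarrow> 'b \<Rightarrow> 'a" where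
  "alg_trace A B n e b = mat_trace A n (mult_matrix A B n e b)"

definition alg_norm ::
  "('a, 'c) ring_scheme \<Rightarrow> ('a, 'b, 'd) module_scheme \<Rightarrow> nat \<Rightarrow> (nat \<Rightarrow> 'b) \<Rightarrow> 'b \<Rightarrow> 'a" where
  "alg_norm A B n e b = mat_det A n (mult_matrix A B n e b)"

definition disc ::
  "('a, 'c) ring_scheme \<Rightarrow> ('a, 'b, 'd) module_scheme \<Rightarrow> nat \<Rightarrow> (nat \<Rightarrow> 'b) \<Rightarrow> 'a" where
  "disc A B n e = mat_det A n (\<lambda>i j. alg_trace A B n e (e i \<otimes>\<^bsub>B\<^esub> e j))"

subsection \<open>Free modules and quotient modules\<close>

definition free_module :: "('r, 'c) ring_scheme \<Rightarrow> 's set \<Rightarrow> ('r, 's \<Rightarrow> 'r) module" where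
  "free_module R S =
     \<lparr>carrier = {f. (\<forall>s \<in> S. f s \<in> carrier R) \<and> (\<forall>s. s \<notin> S \<longrightarrow> f s = \<zero>\<^bsub>R\<^esub>) \<and>
                    finite {s. f s \<noteq> \<zero>\<^bsub>R\<^esub>}},
      monoid.mult = undefined, one = undefined,
      ring.zero = (\<lambda>s. \<zero>\<^bsub>R\<^esub>),
      add = (\<lambda>f g s. f s \<oplus>\<^bsub>R\<^esub> g s),
      smult = (\<lambda>r f s. r \<otimes>\<^bsub>R\<^esub> f s)\<rparr>"

definition free_gen :: "('r, 'c) ring_scheme \<Rightarrow> 's \<Rightarrow> 's \<Rightarrow> 'r" where
  "free_gen R s = (\<lambda>t. if t = s then \<one>\<^bsub>R\<^esub> else \<zero>\<^bsub>R\<^esub>)"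

definition submodule_gen ::
  "('r, 'c) ring_scheme \<Rightarrow> ('r, 'x, 'd) module_scheme \<Rightarrow> 'x set \<Rightarrow> 'x set" where
  "submodule_gen R M S = \<Inter>{N. submodule N R M \<and> S \<subseteq> N}"

definition quot_module :: "('r, 'x, 'd) module_scheme \<Rightarrow> 'x set \<Rightarrow> ('r, 'x set) module" where
  "quot_module M N =
     \<lparr>carrier = a_rcosets\<^bsub>M\<^esub> N,
      monoid.mult = undefined, one = undefined,
      ring.zero = N,
      add = set_add M,
      smult = (\<lambda>r C. \<Union>x \<in> C. N +>\<^bsub>M\<^esub> (r \<odot>\<^bsub>M\<^esub> x))\<rparr>"

subsection \<open>The module of Kaehler differentials\<close>

text \<open>
  The quotient of the free \<open>B\<close>-module on symbols \<open>d x\<close> (\<open>x \<in> B\<close>) by additivity, \<open>A\<close>-linearity and the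
  Leibniz rule; the symbol \<open>d x\<close> is \<open>free_gen B x\<close>.
\<close>

definition kaehler_relations ::
  "('a, 'c) ring_scheme \<Rightarrow> ('a, 'b, 'd) module_scheme \<Rightarrow> ('b \<Rightarrow> 'b) set" where
  "kaehler_relations A B =
     (let F = free_module B (carrier B); d = free_gen B in
       {d (x \<oplus>\<^bsub>B\<^esub> y) \<ominus>\<^bsub>F\<^esub> (d x \<oplus>\<^bsub>F\<^esub> d y) | x y. x \<in> carrier B \<and> y \<in> carrier B}
     \<union> {d (a \<odot>\<^bsub>B\<^esub> x) \<ominus>\<^bsub>F\<^esub> ((a \<odot>\<^bsub>B\<^esub> \<one>\<^bsub>B\<^esub>) \<odot>\<^bsub>F\<^esub> d x) | a x. a \<in> carrier A \<and> x \<in> carrier B}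
     \<union> {d (x \<otimes>\<^bsub>B\<^esub> y) \<ominus>\<^bsub>F\<^esub> (x \<odot>\<^bsub>F\<^esub> d y \<oplus>\<^bsub>F\<^esub> y \<odot>\<^bsub>F\<^esub> d x) | x y. x \<in> carrier B \<and> y \<in> carrier B})"

definition kaehler ::
  "('a, 'c) ring_scheme \<Rightarrow> ('a, 'b, 'd) module_scheme \<Rightarrow> ('b, ('b \<Rightarrow> 'b) set) module" where
  "kaehler A B =
     (let F = free_module B (carrier B)
      in quot_module F (submodule_gen B F (kaehler_relations A B)))"

subsection \<open>Finite presentations and the zeroth Fitting ideal\<close>

text \<open>
  \<open>presentation R M m g k P\<close>: the \<open>R\<close>-module \<open>M\<close> is generated by \<open>g\<^sub>0, \<dots>, g\<^bsub>m-1\<^esub>\<close>, and the rows of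
  the \<open>k \<times> m\<close> matrix \<open>P\<close> generate the module of relations between these generators.
\<close>

definition presentation ::
  "('r, 'c) ring_scheme \<Rightarrow> ('r, 'x, 'd) module_scheme \<Rightarrow> nat \<Rightarrow> (nat \<Rightarrow> 'x) \<Rightarrow>
     nat \<Rightarrow> (nat \<Rightarrow> nat \<Rightarrow> 'r) \<Rightarrow> bool" where
  "presentation R M m g k P \<longleftrightarrow>
     module R M \<and>
     g \<in> {..<m} \<rightarrow> carrier M \<and>
     (\<forall>i<k. \<forall>j<m. P i j \<in> carrier R) \<and>
     (\<forall>x \<in> carrier M. \<exists>c \<in> {..<m} \<rightarrow> carrier R. x = lin_comb M m c g) \<and>
     (\<forall>c \<in> {..<m} \<rightarrow> carrier R.
        lin_comb M m c g = \<zero>\<^bsub>M\<^esub> \<longleftrightarrow>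
        (\<exists>u \<in> {..<k} \<rightarrow> carrier R. \<forall>j<m. c j = (\<Oplus>\<^bsub>R\<^esub> i \<in> {..<k}. u i \<otimes>\<^bsub>R\<^esub> P i j)))"

definition finitely_presented ::
  "('r, 'c) ring_scheme \<Rightarrow> ('r, 'x, 'd) module_scheme \<Rightarrow> bool" where
  "finitely_presented R M \<longleftrightarrow> (\<exists>m g k P. presentation R M m g k P)"

definition minors_ideal ::
  "('r, 'c) ring_scheme \<Rightarrow> nat \<Rightarrow> nat \<Rightarrow> (nat \<Rightarrow> nat \<Rightarrow> 'r) \<Rightarrow> 'r set" where
  "minors_ideal R m k P =
     Idl\<^bsub>R\<^esub> {mat_det R m (\<lambda>i j. P (r i) j) | r. r \<in> {..<m} \<rightarrow> {..<k} \<and> strict_mono_on {..<m} r}"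

text \<open>
  A relation rather than a function of \<open>M\<close>: \<open>I\<close> is the ideal of maximal minors of some finite
  presentation of \<open>M\<close>.  As the ideal does not depend on the presentation, at most one \<open>I\<close> qualifies,
  and one does exactly when \<open>M\<close> is finitely presented.
\<close>

definition is_fitting_ideal0 ::
  "('r, 'c) ring_scheme \<Rightarrow> ('r, 'x, 'd) module_scheme \<Rightarrow> 'r set \<Rightarrow> bool" where
  "is_fitting_ideal0 R M I \<longleftrightarrow>
     (\<exists>m g k P. presentation R M m g k P \<and> I = minors_ideal R m k P)"

end

theory Submission
  imports Defs
begin

text \<open>
  Let \<open>J\<close> be the kernel of the multiplication \<open>B \<otimes>\<^sub>A B \<rightarrow> B\<close>.  A matrix of relations between generators
  of \<open>\<Omega> = J / J\<^sup>2\<close> lifts, after multiplication by an element \<open>d \<equiv> 1\<close> modulo \<open>J\<close> (Nakayama), to a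
  matrix over \<open>B \<otimes>\<^sub>A B\<close> annihilating a family that generates \<open>d J\<close>.  By Cramer's rule the maximal
  minors of the lift, multiplied by \<open>d\<close>, annihilate \<open>J\<close>; so \<open>\<F>\<^sub>0(\<Omega>)\<close> is contained in the Noether
  different, the image of \<open>Ann(J)\<close> in \<open>B\<close>.

  If \<open>w = \<Sum>\<^sub>i w\<^sub>i \<otimes> e\<^sub>i\<close> annihilates \<open>J\<close> and has image \<open>b\<close> in \<open>B\<close>, then \<open>b x = \<Sum>\<^sub>i Tr(e\<^sub>i x) w\<^sub>i\<close> for
  all \<open>x\<close>.  Hence the matrix of multiplication by \<open>b\<close> is the product of the matrix of coordinates
  of the \<open>w\<^sub>i\<close> with the trace matrix, and the discriminant divides the norm of \<open>b\<close>.

  If \<open>\<Omega> = 0\<close>, then \<open>1 \<in> \<F>\<^sub>0(\<Omega>)\<close>, by the presentation with no generators.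
\<close>

section \<open>Determinants over a commutative ring\<close>

text \<open>The obstacle is that a relation between generators of \<Omega> lifts to J only as a
  congruence modulo J^2. The error is a sum of terms \<open>q l\<close> times
  \<open>delta (e l)\<close> with \<open>q l\<close> in J. Multiplication by d moves every
  \<open>delta (e l)\<close> into the ideal spanned by the lifted generators, so the error turns
  into further coefficients lying in J. Subtracting these gives an exact relation with the same
  image in B, because d maps to 1. The argument takes an arbitrary presentation, so every candidate
  for the Fitting ideal is covered at once. The comparison with the Noether different has to be one
  of ideals: the norm is not additive, so divisibility by the discriminant cannot be passed from the
  minors to the ideal that they generate.\<close>

definition mat_over :: "('a, 'c) ring_scheme \<Rightarrow> nat \<Rightarrow> nat \<Rightarrow> (nat \<Rightarrow> nat \<Rightarrow> 'a) \<Rightarrow> bool" where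
  "mat_over R m n M \<longleftrightarrow> (\<forall>i<m. \<forall>j<n. M i j \<in> carrier R)"

lemma mat_overI: "(\<And>i j. i < m \<Longrightarrow> j < n \<Longrightarrow> M i j \<in> carrier R) \<Longrightarrow> mat_over R m n M"
  by (simp add: mat_over_def)

lemma mat_over_row_update:
  "mat_over R n n M \<Longrightarrow> v \<in> {..<n} \<rightarrow> carrier R \<Longrightarrow> mat_over R n n (M(i := v))"
  by (auto simp: mat_over_def)

lemma permutes_less: "p permutes {..<n} \<Longrightarrow> i < n \<Longrightarrow> p i < (n::nat)"
  using permutes_in_image[of p "{..<n}" i] by simp

text \<open>As a ring element the sign factors out of finite sums and is multiplicative under
  composition; the case distinction in \<open>mat_det\<close> offers neither directly.\<close>

definition perm_sgn :: "('a, 'c) ring_scheme \<Rightarrow> (nat \<Rightarrow> nat) \<Rightarrow> 'a" where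
  "perm_sgn R p = (if evenperm p then \<one>\<^bsub>R\<^esub> else \<ominus>\<^bsub>R\<^esub> \<one>\<^bsub>R\<^esub>)"

lemma permutation_lessThan: "p permutes {..<n} \<Longrightarrow> permutation (p :: nat \<Rightarrow> nat)"
  by (auto simp: permutation_permutes)

text \<open>Licenses the substitution of \<open>p \<circ> q\<close> for \<open>p\<close> in a sum
  over all permutations.\<close>

lemma perm_comp_bij:
  fixes q :: "'z \<Rightarrow> 'z"
  assumes "q permutes S"
  shows "inj_on (\<lambda>p. p \<circ> q) {p. p permutes S}" "(\<lambda>p. p \<circ> q) ` {p. p permutes S} = {p. p permutes S}"
proof -
  have *: "(p \<circ> inv_into UNIV q) \<circ> q = p" "(p \<circ> q) \<circ> inv_into UNIV q = p" for p
    using permutes_inv_o[OF assms] by (simp_all add: comp_assoc)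
  show "inj_on (\<lambda>p. p \<circ> q) {p. p permutes S}"
    by (metis (lifting) "*"(2) inj_onI)
  show "(\<lambda>p. p \<circ> q) ` {p. p permutes S} = {p. p permutes S}"
  proof (intro equalityI subsetI)
    fix p assume "p \<in> {p. p permutes S}"
    then show "p \<in> (\<lambda>p. p \<circ> q) ` {p. p permutes S}"
      using permutes_compose[OF permutes_inv[OF assms]]
      by (intro image_eqI[where x = "p \<circ> inv_into UNIV q"], intro *(1)[symmetric]) auto
  qed (use permutes_compose[OF assms] in auto)
qed

lemma perm_inv_bij:
  fixes S :: "'z set"
  shows "inj_on (inv_into UNIV) {p. p permutes S}" "inv_into UNIV ` {p. p permutes S} = {p. p permutes S}"
proof -
  show "inj_on (inv_into UNIV) {p. p permutes S}" by (rule inj_onI) (metis mem_Collect_eq permutes_inv_inv)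
  show "inv_into UNIV ` {p. p permutes S} = {p. p permutes S}"
  proof (intro equalityI subsetI)
    fix p assume "p \<in> {p. p permutes S}"
    then show "p \<in> inv_into UNIV ` {p. p permutes S}"
      by (intro image_eqI[where x = "inv_into UNIV p"]) (auto simp: permutes_inv permutes_inv_inv)
  qed (auto simp: permutes_inv)
qed

section \<open>Leibniz expansion and linearity of the determinant in a row\<close>

context cring
begin

lemma perm_sgn_closed [simp]: "perm_sgn R p \<in> carrier R"
  by (simp add: perm_sgn_def)

lemma perm_sgn_comp:
  assumes "p permutes {..<n}" "q permutes {..<n}"
  shows "perm_sgn R (p \<circ> q) = perm_sgn R p \<otimes> perm_sgn R q"
  using evenperm_comp[OF assms[THEN permutation_lessThan]]
  by (auto simp: perm_sgn_def l_minus r_minus)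

lemma perm_prod_closed [simp]:
  assumes "mat_over R n n M" "p permutes {..<n}" "A \<subseteq> {..<n}"
  shows "(\<lambda>i. M i (p i)) \<in> A \<rightarrow> carrier R"
  using assms by (auto simp: mat_over_def permutes_less)

lemma perm_finprod_closed [simp]:
  assumes "mat_over R n n M" "p permutes {..<n}" "A \<subseteq> {..<n}"
  shows "(\<Otimes>i\<in>A. M i (p i)) \<in> carrier R"
  by (rule finprod_closed) (rule perm_prod_closed[OF assms])

lemma mat_det_sgn:
  assumes "mat_over R n n M"
  shows "mat_det R n M = (\<Oplus>p\<in>{p. p permutes {..<n}}. perm_sgn R p \<otimes> (\<Otimes>i\<in>{..<n}. M i (p i)))"
  unfolding mat_det_def
  by (rule add.finprod_cong') (use assms in \<open>auto simp: perm_sgn_def l_minus\<close>)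

lemma mat_det_closed [simp]:
  assumes "mat_over R n n M" shows "mat_det R n M \<in> carrier R"
  unfolding mat_det_def
  by (rule add.finprod_closed) (use assms in auto)

lemma mat_det_cong:
  assumes "mat_over R n n M" "\<And>i j. i < n \<Longrightarrow> j < n \<Longrightarrow> M' i j = M i j"
  shows "mat_det R n M' = mat_det R n M"
proof -
  have "mat_over R n n M'" using assms by (auto simp: mat_over_def)
  moreover have "(\<Otimes>i\<in>{..<n}. M' i (p i)) = (\<Otimes>i\<in>{..<n}. M i (p i))" if "p permutes {..<n}" for p
    by (rule finprod_cong') (use assms that in \<open>auto simp: permutes_less\<close>)
  ultimately show ?thesis
    using assms by (auto simp: mat_det_sgn intro!: add.finprod_cong')
qed

text \<open>Collecting the factor from row \<open>i\<close> exhibits the determinant as a linear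
  form in \<open>v\<close>: the remaining factors avoid row \<open>i\<close> and are the same for
  every \<open>v\<close>. Additivity and homogeneity in a row are read off from this.\<close>

lemma mat_det_row_expand:
  assumes M: "mat_over R n n M" and v: "v \<in> {..<n} \<rightarrow> carrier R" and i: "i < n"
  shows "mat_det R n (M(i := v)) =
    (\<Oplus>p\<in>{p. p permutes {..<n}}. v (p i) \<otimes> (perm_sgn R p \<otimes> (\<Otimes>k\<in>{..<n}-{i}. M k (p k))))"
proof -
  have *: "(\<Otimes>k\<in>{..<n}. (M(i := v)) k (p k)) = v (p i) \<otimes> (\<Otimes>k\<in>{..<n}-{i}. M k (p k))"
    if p: "p permutes {..<n}" for p
  proof -
    have "(\<Otimes>k\<in>insert i ({..<n}-{i}). (M(i := v)) k (p k)) =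
        (M(i := v)) i (p i) \<otimes> (\<Otimes>k\<in>{..<n}-{i}. (M(i := v)) k (p k))"
      by (rule finprod_insert) (use M v p i in \<open>auto simp: mat_over_def permutes_less\<close>)
    also have "(\<Otimes>k\<in>{..<n}-{i}. (M(i := v)) k (p k)) = (\<Otimes>k\<in>{..<n}-{i}. M k (p k))"
      by (rule finprod_cong') (use M p in \<open>auto simp: mat_over_def permutes_less\<close>)
    finally show ?thesis using i by (simp add: insert_absorb)
  qed
  have "mat_over R n n (M(i := v))" using M v by (rule mat_over_row_update)
  then have "mat_det R n (M(i := v)) =
      (\<Oplus>p\<in>{p. p permutes {..<n}}. perm_sgn R p \<otimes> (v (p i) \<otimes> (\<Otimes>k\<in>{..<n}-{i}. M k (p k))))"
    by (simp only: mat_det_sgn, intro add.finprod_cong') (use M v i * in \<open>auto simp: permutes_less Pi_iff\<close>)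
  also have "\<dots> = (\<Oplus>p\<in>{p. p permutes {..<n}}. v (p i) \<otimes> (perm_sgn R p \<otimes> (\<Otimes>k\<in>{..<n}-{i}. M k (p k))))"
    by (intro add.finprod_cong') (use M v i in \<open>auto simp: permutes_less Pi_iff m_lcomm\<close>)
  finally show ?thesis .
qed

lemma mat_det_row_add:
  assumes M: "mat_over R n n M" and v: "v \<in> {..<n} \<rightarrow> carrier R" "w \<in> {..<n} \<rightarrow> carrier R" and i: "i < n"
  shows "mat_det R n (M(i := \<lambda>j. v j \<oplus> w j)) = mat_det R n (M(i := v)) \<oplus> mat_det R n (M(i := w))"
proof -
  have vw: "(\<lambda>j. v j \<oplus> w j) \<in> {..<n} \<rightarrow> carrier R" using v by auto
  show ?thesis
    unfolding mat_det_row_expand[OF M vw i] mat_det_row_expand[OF M v(1) i] mat_det_row_expand[OF M v(2) i]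
    by (subst add.finprod_multf[symmetric])
       (use M v i in \<open>auto intro!: add.finprod_cong' simp: permutes_less Pi_iff l_distr simp del: add.finprod_multf\<close>)
qed

lemma mat_det_row_smult:
  assumes M: "mat_over R n n M" and v: "v \<in> {..<n} \<rightarrow> carrier R" and a: "a \<in> carrier R" and i: "i < n"
  shows "mat_det R n (M(i := \<lambda>j. a \<otimes> v j)) = a \<otimes> mat_det R n (M(i := v))"
proof -
  have av: "(\<lambda>j. a \<otimes> v j) \<in> {..<n} \<rightarrow> carrier R" using v a by auto
  show ?thesis
    unfolding mat_det_row_expand[OF M av i] mat_det_row_expand[OF M v i]
    by (subst finsum_rdistr)
       (use M v a i in \<open>auto intro!: add.finprod_cong' simp: permutes_less Pi_iff m_assoc finite_permutations\<close>)
qed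

lemma mat_det_row_zero:
  assumes M: "mat_over R n n M" and i: "i < n" and z: "\<And>j. j < n \<Longrightarrow> M i j = \<zero>"
  shows "mat_det R n M = \<zero>"
proof -
  \<comment> \<open>With the zero row written as \<zero> times a row, homogeneity pulls the factor
    \<zero> out.\<close>
  have "mat_det R n M = mat_det R n (M(i := (\<lambda>j. \<zero> \<otimes> \<zero>)))"
    by (rule sym, rule mat_det_cong) (use assms in auto)
  also have "\<dots> = \<zero>"
    by (subst mat_det_row_smult) (use M i in \<open>auto simp: mat_over_row_update\<close>)
  finally show ?thesis .
qed

lemma mat_det_row_sum:
  assumes M: "mat_over R n n M" and i: "i < n" and "finite L"
    and "\<And>l. l \<in> L \<Longrightarrow> a l \<in> carrier R" "\<And>l. l \<in> L \<Longrightarrow> V l \<in> {..<n} \<rightarrow> carrier R"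
  shows "mat_det R n (M(i := \<lambda>j. \<Oplus>l\<in>L. a l \<otimes> V l j)) = (\<Oplus>l\<in>L. a l \<otimes> mat_det R n (M(i := V l)))"
  using assms(3-)
proof (induction L)
  case empty
  show ?case by simp (rule mat_det_row_zero[where i = i], use M i in \<open>auto simp: mat_over_def\<close>)
next
  case (insert x L)
  have eq: "mat_det R n (M(i := \<lambda>j. \<Oplus>l\<in>insert x L. a l \<otimes> V l j)) =
      mat_det R n (M(i := \<lambda>j. a x \<otimes> V x j \<oplus> (\<Oplus>l\<in>L. a l \<otimes> V l j)))"
    by (rule mat_det_cong, rule mat_over_row_update[OF M])
       (use insert in \<open>auto intro!: add.finprod_closed simp: Pi_iff\<close>)
  have V: "a x \<in> carrier R" "V x \<in> {..<n} \<rightarrow> carrier R" using insert.prems by auto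
  have aV: "(\<lambda>j. a x \<otimes> V x j) \<in> {..<n} \<rightarrow> carrier R" using V by auto
  have S: "(\<lambda>j. \<Oplus>l\<in>L. a l \<otimes> V l j) \<in> {..<n} \<rightarrow> carrier R"
    using insert.prems by (auto intro!: add.finprod_closed)
  have IH: "mat_det R n (M(i := \<lambda>j. \<Oplus>l\<in>L. a l \<otimes> V l j)) = (\<Oplus>l\<in>L. a l \<otimes> mat_det R n (M(i := V l)))"
    using insert by blast
  have cl: "a l \<otimes> mat_det R n (M(i := V l)) \<in> carrier R" if "l \<in> insert x L" for l
    using insert.prems that by (intro m_closed mat_det_closed mat_over_row_update M) auto
  show ?case
    unfolding eq mat_det_row_add[OF M aV S i] mat_det_row_smult[OF M V(2,1) i] IH
    by (rule add.finprod_insert[symmetric]) (use insert.hyps cl in auto)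
qed

section \<open>Row permutations, repeated rows and transposes\<close>

lemma perm_prod_reindex:
  assumes "mat_over R n n M" "p permutes {..<n}" "q permutes {..<n}"
  shows "(\<Otimes>i\<in>{..<n}. M (q i) (p (q i))) = (\<Otimes>i\<in>{..<n}. M i (p i))"
proof -
  have "(\<Otimes>i\<in>q ` {..<n}. M i (p i)) = (\<Otimes>i\<in>{..<n}. M (q i) (p (q i)))"
    by (rule finprod_reindex) (use assms in \<open>auto simp: permutes_inj_on permutes_image permutes_less mat_over_def\<close>)
  then show ?thesis by (simp add: permutes_image[OF assms(3)])
qed

text \<open>After substituting \<open>p \<circ> q\<close> for \<open>p\<close> in the Leibniz sum,
  row \<open>q i\<close> meets column \<open>p (q i)\<close>. Each product is then a reordering of
  the one for \<open>p\<close>, and the sign of \<open>q\<close> splits off.\<close>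

lemma mat_det_row_perm:
  assumes M: "mat_over R n n M" and q: "q permutes {..<n}"
  shows "mat_det R n (\<lambda>i. M (q i)) = perm_sgn R q \<otimes> mat_det R n M"
proof -
  let ?S = "{p. p permutes {..<n}}"
  let ?f = "\<lambda>p. perm_sgn R p \<otimes> (\<Otimes>i\<in>{..<n}. M (q i) (p i))"
  have Mq: "mat_over R n n (\<lambda>i. M (q i))" using M q by (auto simp: mat_over_def permutes_less)
  have "mat_det R n (\<lambda>i. M (q i)) = (\<Oplus>p\<in>(\<lambda>p. p \<circ> q) ` ?S. ?f p)"
    unfolding mat_det_sgn[OF Mq] perm_comp_bij[OF q] ..
  also have "\<dots> = (\<Oplus>p\<in>?S. ?f (p \<circ> q))"
    by (rule add.finprod_reindex[OF _ perm_comp_bij(1)[OF q]])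
       (use Mq q in \<open>auto intro!: m_closed finprod_closed simp: permutes_less permutes_compose mat_over_def\<close>)
  also have "\<dots> = (\<Oplus>p\<in>?S. perm_sgn R q \<otimes> (perm_sgn R p \<otimes> (\<Otimes>i\<in>{..<n}. M i (p i))))"
    by (rule add.finprod_cong')
       (use M q in \<open>auto simp: perm_sgn_comp perm_prod_reindex m_ac\<close>)
  also have "\<dots> = perm_sgn R q \<otimes> mat_det R n M"
    unfolding mat_det_sgn[OF M]
    by (rule finsum_rdistr[symmetric]) (use M in \<open>auto simp: finite_permutations\<close>)
  finally show ?thesis .
qed

text \<open>Exchanging the two rows would only show that the determinant equals its negative, which
  is inconclusive when 2 is a zero divisor. Instead, composition with the transposition
  \<open>q\<close> pairs even with odd permutations, and the two summands of each pair
  cancel.\<close>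

lemma mat_det_eq_rows:
  assumes M: "mat_over R n n M" and ij: "i < n" "j < n" "i \<noteq> j" and eq: "\<And>k. k < n \<Longrightarrow> M i k = M j k"
  shows "mat_det R n M = \<zero>"
proof -
  let ?E = "{p. p permutes {..<n} \<and> evenperm p}" and ?O = "{p. p permutes {..<n} \<and> \<not> evenperm p}"
  let ?f = "\<lambda>p. \<Otimes>k\<in>{..<n}. M k (p k)"
  define q where "q = transpose i j"
  have q: "q permutes {..<n}" using ij by (simp add: q_def permutes_swap_id)
  have qo: "\<not> evenperm q" using ij by (simp add: q_def evenperm_swap)
  have qq: "(p \<circ> q) \<circ> q = p" for p :: "nat \<Rightarrow> nat" by (auto simp: q_def)
  have flip: "p \<circ> q permutes {..<n} \<and> evenperm (p \<circ> q) = (\<not> evenperm p)" if "p permutes {..<n}" for p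
    using evenperm_comp[OF permutation_lessThan[OF that] permutation_lessThan[OF q]] qo
      permutes_compose[OF q that] by auto
  have fin: "finite ?E" "finite ?O"
    by (auto intro: finite_subset[OF _ finite_permutations[of "{..<n}"]])
  have im: "?O = (\<lambda>p. p \<circ> q) ` ?E"
  proof (intro equalityI subsetI)
    fix p assume "p \<in> ?O"
    then show "p \<in> (\<lambda>p. p \<circ> q) ` ?E"
      using flip[of p] by (intro image_eqI[where x = "p \<circ> q"]) (auto simp: qq)
  qed (use flip in auto)
  have inj: "inj_on (\<lambda>p. p \<circ> q) ?E" by (rule inj_onI) (metis qq)
  have fq: "?f (p \<circ> q) = ?f p" if p: "p permutes {..<n}" for p
  proof -
    \<comment> \<open>As rows \<open>i\<close> and \<open>j\<close> agree, the row index may be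
      replaced by its image under \<open>q\<close>; the product is then a reordering of the one for
      \<open>p\<close>.\<close>
    have "?f (p \<circ> q) = (\<Otimes>k\<in>{..<n}. M (q k) (p (q k)))"
      by (rule finprod_cong')
        (use M p q eq in \<open>auto simp: mat_over_def permutes_less q_def transpose_def ij\<close>)
    also have "\<dots> = ?f p" by (rule perm_prod_reindex[OF M p q])
    finally show ?thesis .
  qed
  have fc: "?f p \<in> carrier R" if "p permutes {..<n}" for p using M that by simp
  let ?g = "\<lambda>p. if evenperm p then ?f p else \<ominus> ?f p"
  have "mat_det R n M = finsum R ?g (?E \<union> ?O)"
    unfolding mat_det_def by (rule arg_cong[of _ _ "finsum R _"]) auto
  also have "\<dots> = finsum R ?g ?E \<oplus> finsum R ?g ?O"
    by (rule add.finprod_Un_disjoint) (use fin fc in auto)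
  also have "finsum R ?g ?O = (\<Oplus>p\<in>?E. ?g (p \<circ> q))"
    unfolding im by (rule add.finprod_reindex) (use inj fc flip in \<open>auto simp del: o_apply\<close>)
  also have "finsum R ?g ?E \<oplus> \<dots> = (\<Oplus>p\<in>?E. ?g p \<oplus> ?g (p \<circ> q))"
    by (rule add.finprod_multf[symmetric]) (use fc flip in \<open>auto simp del: o_apply\<close>)
  also have "\<dots> = \<zero>"
    by (rule add.finprod_one_eqI) (use fq flip fc in \<open>auto simp: r_neg simp del: o_apply\<close>)
  finally show ?thesis .
qed

text \<open>Substituting the inverse permutation, which has the same sign, exchanges rows and
  columns. This is applied to a presentation matrix whose rows have been turned into columns, to be
  multiplied by a row vector of generators from the left.\<close>

lemma mat_det_transpose:
  assumes M: "mat_over R n n M"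
  shows "mat_det R n (\<lambda>i j. M j i) = mat_det R n M"
proof -
  let ?S = "{p. p permutes {..<n}}"
  let ?f = "\<lambda>p. perm_sgn R p \<otimes> (\<Otimes>i\<in>{..<n}. M (p i) i)"
  have MT: "mat_over R n n (\<lambda>i j. M j i)" using M by (auto simp: mat_over_def)
  note im = perm_inv_bij(2)[of "{..<n}"] and inj = perm_inv_bij(1)[of "{..<n}"]
  have fc: "?f \<in> ?S \<rightarrow> carrier R" using perm_prod_closed[OF MT] by auto
  have "mat_det R n (\<lambda>i j. M j i) = (\<Oplus>p\<in>inv_into UNIV ` ?S. ?f p)"
    unfolding mat_det_sgn[OF MT] im ..
  also have "\<dots> = (\<Oplus>p\<in>?S. ?f (inv_into UNIV p))"
    by (rule add.finprod_reindex[OF _ inj]) (use fc in \<open>simp add: im\<close>)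
  also have "\<dots> = mat_det R n M"
    unfolding mat_det_sgn[OF M]
  proof (rule add.finprod_cong'[OF refl])
    fix p assume "p \<in> ?S"
    then have p: "p permutes {..<n}" "inv_into UNIV p permutes {..<n}" by (auto simp: permutes_inv)
    have "(\<Otimes>i\<in>{..<n}. M (inv_into UNIV p i) i) = (\<Otimes>i\<in>{..<n}. M (inv_into UNIV p i) (p (inv_into UNIV p i)))"
      by (rule finprod_cong') (use p M in \<open>auto simp: permutes_inverses permutes_less mat_over_def\<close>)
    also have "\<dots> = (\<Otimes>i\<in>{..<n}. M i (p i))"
      by (rule perm_prod_reindex[OF M p])
    finally show "?f (inv_into UNIV p) = perm_sgn R p \<otimes> (\<Otimes>i\<in>{..<n}. M i (p i))"
      using permutation_lessThan[OF p(1)] by (simp add: perm_sgn_def evenperm_inv)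
  qed (use M in auto)
  finally show ?thesis .
qed

lemma mat_det_one: "mat_det R n (\<lambda>i j. if i = j then \<one> else \<zero>) = \<one>"
proof -
  let ?M = "\<lambda>i j::nat. if i = j then \<one> else \<zero>"
  have M: "mat_over R n n ?M" by (auto simp: mat_over_def)
  have "(\<Otimes>i\<in>{..<n}. ?M i (p i)) = (if p = id then \<one> else \<zero>)" if p: "p permutes {..<n}" for p
  proof (cases "p = id")
    case True
    then show ?thesis by (auto intro: finprod_one_eqI)
  next
    case False
    then obtain k where k: "p k \<noteq> k" by (auto simp: fun_eq_iff)
    then have "k < n" using p by (metis lessThan_iff permutes_not_in)
    have "(\<Otimes>i\<in>insert k ({..<n}-{k}). ?M i (p i)) = ?M k (p k) \<otimes> (\<Otimes>i\<in>{..<n}-{k}. ?M i (p i))"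
      by (rule finprod_insert) auto
    then show ?thesis using False k \<open>k < n\<close> by (simp add: insert_absorb)
  qed
  then have "mat_det R n ?M = (\<Oplus>p\<in>{p. p permutes {..<n}}. if p = id then \<one> else \<zero>)"
    unfolding mat_det_sgn[OF M]
    by (intro add.finprod_cong') (auto simp: perm_sgn_def)
  also have "\<dots> = \<one>"
    by (rule add.finprod_singleton_swap[where f = "\<lambda>_. \<one>"]) (auto simp: finite_permutations)
  finally show ?thesis .
qed

text \<open>Replacing row \<open>i\<close> by \<open>\<Sum>\<^sub>l t\<^sub>l M\<^sub>l\<close> multiplies the determinant by \<open>t\<^sub>i\<close>, as the summands
  with \<open>l \<noteq> i\<close> produce a repeated row.\<close>

lemma cramer:
  assumes M: "mat_over R n n M" and i: "i < n" and t: "t \<in> {..<n} \<rightarrow> carrier R"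
    and w: "\<And>j. j < n \<Longrightarrow> w j = (\<Oplus>l\<in>{..<n}. t l \<otimes> M l j)"
  shows "mat_det R n (M(i := w)) = t i \<otimes> mat_det R n M"
proof -
  have Mr: "M l \<in> {..<n} \<rightarrow> carrier R" if "l < n" for l using M that by (auto simp: mat_over_def)
  have "mat_det R n (M(i := w)) = mat_det R n (M(i := \<lambda>j. \<Oplus>l\<in>{..<n}. t l \<otimes> M l j))"
    by (rule mat_det_cong, rule mat_over_row_update[OF M])
       (use M t w in \<open>auto simp: mat_over_def intro!: add.finprod_closed\<close>)
  also have "\<dots> = (\<Oplus>l\<in>{..<n}. t l \<otimes> mat_det R n (M(i := M l)))"
    by (rule mat_det_row_sum) (use M i t Mr in auto)
  also have "\<dots> = (\<Oplus>l\<in>{..<n}. if l = i then t l \<otimes> mat_det R n M else \<zero>)"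
  proof (rule add.finprod_cong'[OF refl])
    fix l assume l: "l \<in> {..<n}"
    have "mat_det R n (M(i := M l)) = \<zero>" if "l \<noteq> i"
      by (rule mat_det_eq_rows[where i = i and j = l]) (use M Mr l i that in \<open>auto simp: mat_over_row_update\<close>)
    moreover have "t l \<in> carrier R" using l t by auto
    ultimately show "t l \<otimes> mat_det R n (M(i := M l)) = (if l = i then t l \<otimes> mat_det R n M else \<zero>)"
      using l t M by auto
  qed (use t M i in \<open>auto simp: Pi_iff\<close>)
  also have "\<dots> = t i \<otimes> mat_det R n M"
    by (rule add.finprod_singleton_swap[where f = "\<lambda>l. t l \<otimes> mat_det R n M"]) (use M t i in \<open>auto simp: Pi_iff\<close>)
  finally show ?thesis .
qed

section \<open>Divisibility of the determinant of a product by that of a factor\<close>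

lemma divides_add_closed:
  assumes "a \<in> carrier R" "a divides b" "a divides c"
  shows "a divides (b \<oplus> c)"
proof -
  obtain u v where "u \<in> carrier R" "b = a \<otimes> u" "v \<in> carrier R" "c = a \<otimes> v"
    using assms by (auto elim!: dividesE)
  then show ?thesis using assms(1) by (auto intro!: dividesI[where c = "u \<oplus> v"] simp: r_distr)
qed

lemma divides_finsum:
  assumes "finite L" "a \<in> carrier R" "\<And>l. l \<in> L \<Longrightarrow> f l \<in> carrier R" "\<And>l. l \<in> L \<Longrightarrow> a divides f l"
  shows "a divides finsum R f L"
  using assms(1,3,4)
proof (induction L)
  case empty
  show ?case using assms(2) by (auto intro!: dividesI[where c = \<zero>])
next
  case (insert x L)
  then show ?case using assms(2) by (auto simp: Pi_iff intro!: divides_add_closed)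
qed

text \<open>Either \<open>f\<close> permutes the row indices and the determinant changes by a sign,
  or two rows coincide and it vanishes.\<close>

lemma mat_det_divides_select:
  assumes T: "mat_over R n n T" and f: "f \<in> {..<n} \<rightarrow> {..<n}"
  shows "mat_det R n T divides mat_det R n (\<lambda>i. T (f i))"
proof (cases "inj_on f {..<n}")
  case True
  define q where "q i = (if i < n then f i else i)" for i
  have "bij_betw f {..<n} {..<n}"
    using True endo_inj_surj[of "{..<n}" f] funcset_image[OF f] by (auto simp: bij_betw_def)
  then have q: "q permutes {..<n}"
    by (intro bij_imp_permutes) (auto simp: q_def bij_betw_def inj_on_def)
  have "mat_det R n (\<lambda>i. T (f i)) = mat_det R n (\<lambda>i. T (q i))"
    by (rule mat_det_cong) (use T f in \<open>auto simp: q_def mat_over_def\<close>)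
  also have "\<dots> = perm_sgn R q \<otimes> mat_det R n T" by (rule mat_det_row_perm[OF T q])
  finally show ?thesis using T by (auto intro!: dividesI[where c = "perm_sgn R q"] simp: m_comm)
next
  case False
  then obtain i j where "i < n" "j < n" "i \<noteq> j" "f i = f j" by (auto simp: inj_on_def)
  then have "mat_det R n (\<lambda>i. T (f i)) = \<zero>"
    by (intro mat_det_eq_rows[of n _ i j]) (use T f in \<open>auto simp: mat_over_def\<close>)
  then show ?thesis using T by (auto intro!: dividesI[where c = \<zero>])
qed

text \<open>Each row of the product \<open>V = U T\<close> is a combination of rows of
  \<open>T\<close>. Expanding these rows one after another leaves only determinants of selections of
  rows of \<open>T\<close>, all of them divisible by the determinant of \<open>T\<close>.\<close>

lemma mat_det_divides_mult:
  assumes T: "mat_over R n n T" and U: "mat_over R n n U"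
    and V: "\<And>i j. i < n \<Longrightarrow> j < n \<Longrightarrow> V i j = (\<Oplus>l\<in>{..<n}. U i l \<otimes> T l j)"
  shows "mat_det R n T divides mat_det R n V"
proof -
  define W where "W i = (\<lambda>j. \<Oplus>l\<in>{..<n}. U i l \<otimes> T l j)" for i
  have W: "mat_over R n n W"
    unfolding W_def using T U by (auto simp: mat_over_def intro!: add.finprod_closed)
  \<comment> \<open>Rows with index less than \<open>k\<close> are rows of the product, the others a
    selection of rows of \<open>T\<close>. The selection \<open>f\<close> is arbitrary because
    expanding row \<open>k\<close> puts each row of \<open>T\<close> in its place, which changes
    \<open>f\<close> at \<open>k\<close>.\<close>
  have "mat_det R n T divides mat_det R n (\<lambda>i. if i < k then W i else T (f i))"
    if "k \<le> n" "f \<in> {..<n} \<rightarrow> {..<n}" for k f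
    using that
  proof (induction k arbitrary: f)
    case 0
    then show ?case using mat_det_divides_select[OF T] by simp
  next
    case (Suc k)
    let ?M = "\<lambda>i. if i < k then W i else T (f i)"
    have M: "mat_over R n n ?M" using W T Suc.prems by (auto simp: mat_over_def)
    have eq: "(\<lambda>i. if i < Suc k then W i else T (f i)) = ?M(k := \<lambda>j. \<Oplus>l\<in>{..<n}. U k l \<otimes> T l j)"
      by (auto simp: fun_eq_iff W_def)
    have T': "\<And>l. l < n \<Longrightarrow> T l \<in> {..<n} \<rightarrow> carrier R" using T by (auto simp: mat_over_def)
    have "mat_det R n T divides mat_det R n (?M(k := T l))" if l: "l < n" for l
    proof -
      have "?M(k := T l) = (\<lambda>i. if i < k then W i else T ((f(k := l)) i))" by auto
      then show ?thesis using Suc.IH[of "f(k := l)"] Suc.prems l by (auto simp: Pi_iff)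
    qed
    then have "mat_det R n T divides (\<Oplus>l\<in>{..<n}. U k l \<otimes> mat_det R n (?M(k := T l)))"
      using T U M T' Suc.prems
      by (intro divides_finsum divides_prod_l) (auto simp: mat_over_def mat_over_row_update)
    also have "\<dots> = mat_det R n (?M(k := \<lambda>j. \<Oplus>l\<in>{..<n}. U k l \<otimes> T l j))"
      by (rule mat_det_row_sum[symmetric]) (use T U M T' Suc.prems in \<open>auto simp: mat_over_def\<close>)
    finally show ?case unfolding eq .
  qed
  from this[of n "\<lambda>i. i"] have "mat_det R n T divides mat_det R n (\<lambda>i. if i < n then W i else T i)"
    by simp
  also have "\<dots> = mat_det R n V"
    by (rule mat_det_cong[symmetric]) (use W V in \<open>auto simp: W_def mat_over_def\<close>)
  finally show ?thesis .
qed

end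

text \<open>A determinant is an integer polynomial in its entries, so ring homomorphisms commute
  with it. Through this, \<open>mu\<close> carries determinants over the tensor square to
  determinants over B.\<close>

lemma (in ring_hom_cring) hom_mat_det:
  assumes M: "mat_over R n n M"
  shows "h (mat_det R n M) = mat_det S n (\<lambda>i j. h (M i j))"
proof -
  have hM: "mat_over S n n (\<lambda>i j. h (M i j))" using M by (auto simp: mat_over_def)
  have sg: "h (perm_sgn R p) = perm_sgn S p" for p by (simp add: perm_sgn_def)
  have "h (mat_det R n M) =
      (\<Oplus>\<^bsub>S\<^esub>p\<in>{p. p permutes {..<n}}. (h \<circ> (\<lambda>p. perm_sgn R p \<otimes> (\<Otimes>i\<in>{..<n}. M i (p i)))) p)"
    unfolding R.mat_det_sgn[OF M] by (rule hom_finsum) (use M in auto)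
  also have "\<dots> = mat_det S n (\<lambda>i j. h (M i j))"
    unfolding S.mat_det_sgn[OF hM]
  proof (rule S.add.finprod_cong'[OF refl])
    fix p assume p: "p \<in> {p. p permutes {..<n}}"
    then have "(\<lambda>i. M i (p i)) \<in> {..<n} \<rightarrow> carrier R" using M by auto
    then show "(h \<circ> (\<lambda>p. perm_sgn R p \<otimes> (\<Otimes>i\<in>{..<n}. M i (p i)))) p =
        perm_sgn S p \<otimes>\<^bsub>S\<^esub> (\<Otimes>\<^bsub>S\<^esub>i\<in>{..<n}. h (M i (p i)))"
      by (simp add: sg hom_finprod o_def)
  next
    have "(\<lambda>i. h (M i (p i))) \<in> {..<n} \<rightarrow> carrier S" if "p permutes {..<n}" for p
      using S.perm_prod_closed[OF hM that] by simp
    then show "(\<lambda>p. perm_sgn S p \<otimes>\<^bsub>S\<^esub> (\<Otimes>\<^bsub>S\<^esub>i\<in>{..<n}. h (M i (p i)))) \<in> {p. p permutes {..<n}} \<rightarrow> carrier S"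
      by auto
  qed
  finally show ?thesis .
qed

section \<open>Modules, free modules and quotients\<close>

text \<open>Only additivity of \<open>h\<close> enters, so the same statement serves module
  homomorphisms, evaluation of functions at a point, coordinates and the universal
  derivation.\<close>

lemma finsum_additive:
  assumes G: "abelian_monoid G" and H: "abelian_monoid H"
    and h: "h \<in> carrier G \<rightarrow> carrier H" "h \<zero>\<^bsub>G\<^esub> = \<zero>\<^bsub>H\<^esub>"
      "\<And>x y. x \<in> carrier G \<Longrightarrow> y \<in> carrier G \<Longrightarrow> h (x \<oplus>\<^bsub>G\<^esub> y) = h x \<oplus>\<^bsub>H\<^esub> h y"
    and f: "f \<in> A \<rightarrow> carrier G"
  shows "h (finsum G f A) = finsum H (\<lambda>i. h (f i)) A"
proof -
  interpret G: abelian_monoid G by fact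
  interpret H: abelian_monoid H by fact
  show ?thesis using f
  proof (induction A rule: infinite_finite_induct)
    case (insert x F)
    then show ?case
      using h(1) by (subst G.finsum_insert H.finsum_insert; auto simp: h(3) Pi_iff)+
  qed (auto simp: h)
qed

lemma (in abelian_monoid) finsum_swap:
  assumes "\<And>i j. i \<in> I \<Longrightarrow> j \<in> J \<Longrightarrow> f i j \<in> carrier G" "finite I" "finite J"
  shows "(\<Oplus>i\<in>I. \<Oplus>j\<in>J. f i j) = (\<Oplus>j\<in>J. \<Oplus>i\<in>I. f i j)"
  using assms(2,1)
proof (induction I)
  case (insert x I)
  then have c: "(\<lambda>j. f x j) \<in> J \<rightarrow> carrier G" "(\<lambda>j. \<Oplus>i\<in>I. f i j) \<in> J \<rightarrow> carrier G"
    "(\<lambda>i. \<Oplus>j\<in>J. f i j) \<in> I \<rightarrow> carrier G"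
    by (auto intro!: finsum_closed)
  have "(\<Oplus>i\<in>insert x I. \<Oplus>j\<in>J. f i j) = (\<Oplus>j\<in>J. f x j) \<oplus> (\<Oplus>j\<in>J. \<Oplus>i\<in>I. f i j)"
    by (subst finsum_insert) (use insert c in auto)
  also have "\<dots> = (\<Oplus>j\<in>J. f x j \<oplus> (\<Oplus>i\<in>I. f i j))"
    by (rule finsum_addf[OF c(1,2), symmetric])
  also have "\<dots> = (\<Oplus>j\<in>J. \<Oplus>i\<in>insert x I. f i j)"
    by (rule add.finprod_cong') (use insert in \<open>auto intro!: finsum_closed\<close>)
  finally show ?case .
qed simp

section \<open>Linear maps, linear combinations and generated submodules\<close>

definition linear_map ::
  "('r, 'c) ring_scheme \<Rightarrow> ('r, 'x, 'd) module_scheme \<Rightarrow> ('r, 'y, 'e) module_scheme \<Rightarrow> ('x \<Rightarrow> 'y) \<Rightarrow> bool" where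
  "linear_map R M N h \<longleftrightarrow> h \<in> carrier M \<rightarrow> carrier N \<and>
     (\<forall>x\<in>carrier M. \<forall>y\<in>carrier M. h (x \<oplus>\<^bsub>M\<^esub> y) = h x \<oplus>\<^bsub>N\<^esub> h y) \<and>
     (\<forall>a\<in>carrier R. \<forall>x\<in>carrier M. h (a \<odot>\<^bsub>M\<^esub> x) = a \<odot>\<^bsub>N\<^esub> h x)"

locale linear_hom = M: module R M + N: module R N
  for R and M and N +
  fixes h
  assumes lin: "linear_map R M N h"
begin

lemma closed [simp]: "x \<in> carrier M \<Longrightarrow> h x \<in> carrier N"
  and add [simp]: "x \<in> carrier M \<Longrightarrow> y \<in> carrier M \<Longrightarrow> h (x \<oplus>\<^bsub>M\<^esub> y) = h x \<oplus>\<^bsub>N\<^esub> h y"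
  and smult [simp]: "a \<in> carrier R \<Longrightarrow> x \<in> carrier M \<Longrightarrow> h (a \<odot>\<^bsub>M\<^esub> x) = a \<odot>\<^bsub>N\<^esub> h x"
  using lin by (auto simp: linear_map_def)

lemma zero [simp]: "h \<zero>\<^bsub>M\<^esub> = \<zero>\<^bsub>N\<^esub>"
  using smult[of "\<zero>\<^bsub>R\<^esub>" "\<zero>\<^bsub>M\<^esub>"] by simp

lemma neg [simp]: "x \<in> carrier M \<Longrightarrow> h (\<ominus>\<^bsub>M\<^esub> x) = \<ominus>\<^bsub>N\<^esub> h x"
  using smult[of "\<ominus>\<^bsub>R\<^esub> \<one>\<^bsub>R\<^esub>" x] by (simp add: M.smult_l_minus N.smult_l_minus)

lemma diff [simp]: "x \<in> carrier M \<Longrightarrow> y \<in> carrier M \<Longrightarrow> h (x \<ominus>\<^bsub>M\<^esub> y) = h x \<ominus>\<^bsub>N\<^esub> h y"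
  by (simp add: a_minus_def)

lemma finsum: "f \<in> A \<rightarrow> carrier M \<Longrightarrow> h (finsum M f A) = finsum N (\<lambda>i. h (f i)) A"
  by (rule finsum_additive) (auto simp: M.abelian_monoid_axioms N.abelian_monoid_axioms)

lemma lin_comb:
  assumes "c \<in> {..<n} \<rightarrow> carrier R" "g \<in> {..<n} \<rightarrow> carrier M"
  shows "h (lin_comb M n c g) = lin_comb N n c (\<lambda>i. h (g i))"
  unfolding lin_comb_def
  by (subst finsum) (use assms in \<open>auto intro!: N.add.finprod_cong' simp: Pi_iff\<close>)

lemma submodule_vimage:
  assumes "submodule K R N"
  shows "submodule {x \<in> carrier M. h x \<in> K} R M"
  using N.submoduleE[OF assms] subgroup.one_closed[OF submodule.axioms(1)[OF assms]]
  by (intro M.submoduleI) auto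

end

context module
begin

lemma submodule_finsum:
  assumes "submodule K R M" "\<And>i. i \<in> A \<Longrightarrow> f i \<in> K"
  shows "finsum M f A \<in> K"
proof -
  note K = submoduleE[OF assms(1)]
  have z: "\<zero>\<^bsub>M\<^esub> \<in> K"
    using subgroup.one_closed[OF submodule.axioms(1)[OF assms(1)]] by simp
  show ?thesis using assms(2)
  proof (induction A rule: infinite_finite_induct)
    case (insert x F)
    then show ?case using K(1,5) by (subst M.finsum_insert) auto
  qed (use z in auto)
qed

lemma submodule_zero: "submodule K R M \<Longrightarrow> \<zero>\<^bsub>M\<^esub> \<in> K"
  using subgroup.one_closed[OF submodule.axioms(1)] by force

lemma lin_comb_closed [simp]:
  "c \<in> {..<n} \<rightarrow> carrier R \<Longrightarrow> g \<in> {..<n} \<rightarrow> carrier M \<Longrightarrow> lin_comb M n c g \<in> carrier M"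
  unfolding lin_comb_def by (rule M.finsum_closed) auto

lemma lin_comb_add:
  assumes "c \<in> {..<n} \<rightarrow> carrier R" "d \<in> {..<n} \<rightarrow> carrier R" "g \<in> {..<n} \<rightarrow> carrier M"
  shows "lin_comb M n (\<lambda>i. c i \<oplus> d i) g = lin_comb M n c g \<oplus>\<^bsub>M\<^esub> lin_comb M n d g"
  unfolding lin_comb_def
  by (subst M.finsum_addf[symmetric])
     (use assms in \<open>auto intro!: M.add.finprod_cong' simp: Pi_iff smult_l_distr simp del: M.add.finprod_multf\<close>)

lemma lin_comb_smult:
  assumes "a \<in> carrier R" "c \<in> {..<n} \<rightarrow> carrier R" "g \<in> {..<n} \<rightarrow> carrier M"
  shows "lin_comb M n (\<lambda>i. a \<otimes> c i) g = a \<odot>\<^bsub>M\<^esub> lin_comb M n c g"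
  unfolding lin_comb_def
  by (subst finsum_smult_ldistr)
     (use assms in \<open>auto intro!: M.add.finprod_cong' simp: Pi_iff smult_assoc1\<close>)

lemma lin_comb_cong:
  assumes "c \<in> {..<n} \<rightarrow> carrier R" "g \<in> {..<n} \<rightarrow> carrier M"
    "\<And>i. i < n \<Longrightarrow> c' i = c i" "\<And>i. i < n \<Longrightarrow> g' i = g i"
  shows "lin_comb M n c' g' = lin_comb M n c g"
  unfolding lin_comb_def by (rule M.add.finprod_cong') (use assms in auto)

lemma lin_combs_submodule:
  assumes g: "g \<in> {..<n} \<rightarrow> carrier M"
  shows "submodule {lin_comb M n c g | c. c \<in> {..<n} \<rightarrow> carrier R} R M" (is "submodule ?K R M")
proof (rule submoduleI)
  show "?K \<subseteq> carrier M" using g by auto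
  have z: "lin_comb M n (\<lambda>i. \<zero>) g = \<zero>\<^bsub>M\<^esub>"
    unfolding lin_comb_def by (rule M.add.finprod_one_eqI) (use g in \<open>auto simp: Pi_iff\<close>)
  show "\<zero>\<^bsub>M\<^esub> \<in> ?K" using z by (auto intro!: exI[of _ "\<lambda>i. \<zero>"])
  show sm: "a \<odot>\<^bsub>M\<^esub> x \<in> ?K" if a: "a \<in> carrier R" "x \<in> ?K" for a x
  proof -
    obtain c where "x = lin_comb M n c g" "c \<in> {..<n} \<rightarrow> carrier R" using a by auto
    then show ?thesis using lin_comb_smult[OF a(1) _ g, of c] a(1)
      by (auto intro!: exI[of _ "\<lambda>i. a \<otimes> c i"])
  qed
  show "\<ominus>\<^bsub>M\<^esub> x \<in> ?K" if "x \<in> ?K" for x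
  proof -
    have "x \<in> carrier M" using that g by auto
    then have "\<ominus>\<^bsub>M\<^esub> x = (\<ominus> \<one>) \<odot>\<^bsub>M\<^esub> x" by (simp add: smult_l_minus)
    then show ?thesis using sm[of "\<ominus> \<one>" x] that by auto
  qed
  show "x \<oplus>\<^bsub>M\<^esub> y \<in> ?K" if xy: "x \<in> ?K" "y \<in> ?K" for x y
  proof -
    obtain c d where "x = lin_comb M n c g" "c \<in> {..<n} \<rightarrow> carrier R"
      "y = lin_comb M n d g" "d \<in> {..<n} \<rightarrow> carrier R" using xy by blast
    then show ?thesis using lin_comb_add[OF _ _ g, of c d]
      by (auto intro!: exI[of _ "\<lambda>i. c i \<oplus> d i"])
  qed
qed

lemma lin_comb_generator:
  assumes g: "g \<in> {..<n} \<rightarrow> carrier M" and i: "i < n"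
  shows "lin_comb M n (\<lambda>j. if j = i then \<one> else \<zero>) g = g i"
proof -
  have "lin_comb M n (\<lambda>j. if j = i then \<one> else \<zero>) g = (\<Oplus>\<^bsub>M\<^esub>j\<in>{..<n}. if j = i then g j else \<zero>\<^bsub>M\<^esub>)"
    unfolding lin_comb_def by (rule M.add.finprod_cong') (use g in \<open>auto simp: Pi_iff\<close>)
  also have "\<dots> = g i"
    by (rule M.add.finprod_singleton_swap) (use g i in auto)
  finally show ?thesis .
qed

lemma submodule_gen_submodule:
  assumes "S \<subseteq> carrier M"
  shows "submodule (submodule_gen R M S) R M"
proof (rule submoduleI)
  let ?F = "{N. submodule N R M \<and> S \<subseteq> N}"
  have C: "carrier M \<in> ?F" using carrier_is_submodule assms by simp
  then show "submodule_gen R M S \<subseteq> carrier M" by (auto simp: submodule_gen_def)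
qed (use submoduleE submodule_zero in \<open>auto simp: submodule_gen_def\<close>)

lemma submodule_gen_minimal: "submodule N R M \<Longrightarrow> S \<subseteq> N \<Longrightarrow> submodule_gen R M S \<subseteq> N"
  by (auto simp: submodule_gen_def)

end

lemma submodule_gen_superset: "S \<subseteq> submodule_gen R M S"
  by (auto simp: submodule_gen_def)

section \<open>Free modules and their universal property\<close>

lemma carrier_free_module:
  "carrier (free_module R S) = {f. (\<forall>s \<in> S. f s \<in> carrier R) \<and> (\<forall>s. s \<notin> S \<longrightarrow> f s = \<zero>\<^bsub>R\<^esub>) \<and>
                    finite {s. f s \<noteq> \<zero>\<^bsub>R\<^esub>}}"
  by (simp add: free_module_def)

lemma free_module_simps [simp]:
  "\<zero>\<^bsub>free_module R S\<^esub> = (\<lambda>s. \<zero>\<^bsub>R\<^esub>)"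
  "f \<oplus>\<^bsub>free_module R S\<^esub> g = (\<lambda>s. f s \<oplus>\<^bsub>R\<^esub> g s)"
  "r \<odot>\<^bsub>free_module R S\<^esub> f = (\<lambda>s. r \<otimes>\<^bsub>R\<^esub> f s)"
  by (simp_all add: free_module_def)

context cring
begin

lemma free_module_carrierD: "f \<in> carrier (free_module R S) \<Longrightarrow> f s \<in> carrier R"
  by (cases "s \<in> S") (auto simp: carrier_free_module)

lemma free_module_supports:
  assumes "finite {s. f s \<noteq> \<zero>}" "finite {s. g s \<noteq> \<zero>}"
  shows "finite {s. f s \<oplus> g s \<noteq> \<zero>}"
  by (rule finite_subset[OF _ finite_UnI[OF assms]]) auto

lemma free_module_module: "module R (free_module R S)"
proof (rule moduleI)
  let ?F = "free_module R S"
  have c: "f s \<in> carrier R" if "f \<in> carrier ?F" for f s using that by (rule free_module_carrierD)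
  show "abelian_group ?F"
  proof (rule abelian_groupI)
    fix f g h assume fgh: "f \<in> carrier ?F" "g \<in> carrier ?F" "h \<in> carrier ?F"
    note cc = fgh[THEN c]
    show "f \<oplus>\<^bsub>?F\<^esub> g \<in> carrier ?F" using fgh by (simp add: carrier_free_module free_module_supports)
    show "(f \<oplus>\<^bsub>?F\<^esub> g) \<oplus>\<^bsub>?F\<^esub> h = f \<oplus>\<^bsub>?F\<^esub> (g \<oplus>\<^bsub>?F\<^esub> h)" by (simp add: cc a_assoc)
    show "f \<oplus>\<^bsub>?F\<^esub> g = g \<oplus>\<^bsub>?F\<^esub> f" by (simp add: cc a_comm)
    show "\<zero>\<^bsub>?F\<^esub> \<oplus>\<^bsub>?F\<^esub> f = f" by (simp add: cc)
    have "{s. \<ominus> f s \<noteq> \<zero>} \<subseteq> {s. f s \<noteq> \<zero>}" by auto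
    then have "finite {s. \<ominus> f s \<noteq> \<zero>}" by (rule finite_subset) (use fgh in \<open>auto simp: carrier_free_module\<close>)
    then show "\<exists>g\<in>carrier ?F. g \<oplus>\<^bsub>?F\<^esub> f = \<zero>\<^bsub>?F\<^esub>"
      using fgh by (intro bexI[of _ "\<lambda>s. \<ominus> f s"]) (auto simp: carrier_free_module cc l_neg)
  qed (auto simp: carrier_free_module)
  fix a b f g assume ab: "a \<in> carrier R" "b \<in> carrier R" and fg: "f \<in> carrier ?F" "g \<in> carrier ?F"
  note cc = fg[THEN c]
  have "{s. a \<otimes> f s \<noteq> \<zero>} \<subseteq> {s. f s \<noteq> \<zero>}" using ab by auto
  then have "finite {s. a \<otimes> f s \<noteq> \<zero>}" by (rule finite_subset) (use fg in \<open>auto simp: carrier_free_module\<close>)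
  then show "a \<odot>\<^bsub>?F\<^esub> f \<in> carrier ?F" using ab fg by (auto simp: carrier_free_module)
  show "(a \<oplus> b) \<odot>\<^bsub>?F\<^esub> f = a \<odot>\<^bsub>?F\<^esub> f \<oplus>\<^bsub>?F\<^esub> b \<odot>\<^bsub>?F\<^esub> f"
    by (simp add: ab cc l_distr)
  show "a \<odot>\<^bsub>?F\<^esub> (f \<oplus>\<^bsub>?F\<^esub> g) = a \<odot>\<^bsub>?F\<^esub> f \<oplus>\<^bsub>?F\<^esub> a \<odot>\<^bsub>?F\<^esub> g"
    by (simp add: ab cc r_distr)
  show "(a \<otimes> b) \<odot>\<^bsub>?F\<^esub> f = a \<odot>\<^bsub>?F\<^esub> (b \<odot>\<^bsub>?F\<^esub> f)"
    by (simp add: ab cc m_assoc)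
next
  fix f assume "f \<in> carrier (free_module R S)"
  then show "\<one> \<odot>\<^bsub>free_module R S\<^esub> f = f" by (simp add: free_module_carrierD)
qed (rule cring_axioms)

lemma free_module_finsum_apply:
  assumes "f \<in> A \<rightarrow> carrier (free_module R S)"
  shows "finsum (free_module R S) f A s = (\<Oplus>i\<in>A. f i s)"
proof -
  interpret F: module R "free_module R S" by (rule free_module_module)
  show ?thesis
    by (rule finsum_additive[where h = "\<lambda>f. f s" and G = "free_module R S"])
      (use assms free_module_carrierD in \<open>auto simp: F.M.abelian_monoid_axioms abelian_monoid_axioms\<close>)
qed

lemma free_gen_closed: "s \<in> S \<Longrightarrow> free_gen R s \<in> carrier (free_module R S)"
  by (auto simp: free_gen_def carrier_free_module)

end

definition lin_ext :: "('r, 'c) ring_scheme \<Rightarrow> ('r, 'x, 'd) module_scheme \<Rightarrow> ('s \<Rightarrow> 'x) \<Rightarrow> ('s \<Rightarrow> 'r) \<Rightarrow> 'x" where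
  "lin_ext R M h f = (\<Oplus>\<^bsub>M\<^esub>s\<in>{s. f s \<noteq> \<zero>\<^bsub>R\<^esub>}. f s \<odot>\<^bsub>M\<^esub> h s)"

context module
begin

text \<open>Two elements have different supports; additivity of \<open>lin_ext\<close> requires both
  sums to run over one finite set containing them.\<close>

lemma lin_ext_superset:
  assumes "f \<in> carrier (free_module R S)" "h \<in> S \<rightarrow> carrier M" "finite T" "{s. f s \<noteq> \<zero>} \<subseteq> T" "T \<subseteq> S"
  shows "lin_ext R M h f = (\<Oplus>\<^bsub>M\<^esub>s\<in>T. f s \<odot>\<^bsub>M\<^esub> h s)"
  unfolding lin_ext_def
  by (rule M.add.finprod_mono_neutral_cong_left) (use assms in \<open>auto simp: carrier_free_module Pi_iff subset_iff\<close>)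

lemma lin_ext_linear:
  assumes h: "h \<in> S \<rightarrow> carrier M"
  shows "linear_map R (free_module R S) M (lin_ext R M h)"
  unfolding linear_map_def
proof (intro conjI ballI)
  let ?F = "free_module R S"
  interpret F: module R ?F by (rule free_module_module)
  have supp: "{s. f s \<noteq> \<zero>} \<subseteq> S" "finite {s. f s \<noteq> \<zero>}" if "f \<in> carrier ?F" for f
    using that by (auto simp: carrier_free_module)
  have cl: "(\<lambda>s. f s \<odot>\<^bsub>M\<^esub> h s) \<in> T \<rightarrow> carrier M" if "f \<in> carrier ?F" "T \<subseteq> S" for f T
    using that h by (auto simp: free_module_carrierD Pi_iff subset_iff)
  show "lin_ext R M h \<in> carrier ?F \<rightarrow> carrier M"
    unfolding lin_ext_def using cl supp by (auto intro!: M.finsum_closed)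
  fix f g assume f: "f \<in> carrier ?F" and g: "g \<in> carrier ?F"
  let ?T = "{s. f s \<noteq> \<zero>} \<union> {s. g s \<noteq> \<zero>}"
  have T: "finite ?T" "?T \<subseteq> S" using supp f g by auto
  have sub: "{s. (f \<oplus>\<^bsub>?F\<^esub> g) s \<noteq> \<zero>} \<subseteq> ?T" by auto
  have "lin_ext R M h (f \<oplus>\<^bsub>?F\<^esub> g) = (\<Oplus>\<^bsub>M\<^esub>s\<in>?T. f s \<odot>\<^bsub>M\<^esub> h s \<oplus>\<^bsub>M\<^esub> g s \<odot>\<^bsub>M\<^esub> h s)"
    unfolding lin_ext_superset[OF F.M.a_closed[OF f g] h T(1) sub T(2)]
    by (intro M.add.finprod_cong')
       (use h T f g in \<open>auto simp: smult_l_distr free_module_carrierD Pi_iff subset_iff\<close>)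
  also have "\<dots> = (\<Oplus>\<^bsub>M\<^esub>s\<in>?T. f s \<odot>\<^bsub>M\<^esub> h s) \<oplus>\<^bsub>M\<^esub> (\<Oplus>\<^bsub>M\<^esub>s\<in>?T. g s \<odot>\<^bsub>M\<^esub> h s)"
    by (rule M.finsum_addf) (use cl[OF f T(2)] cl[OF g T(2)] in auto)
  also have "\<dots> = lin_ext R M h f \<oplus>\<^bsub>M\<^esub> lin_ext R M h g"
    using lin_ext_superset[OF f h T(1) _ T(2)] lin_ext_superset[OF g h T(1) _ T(2)] by simp
  finally show "lin_ext R M h (f \<oplus>\<^bsub>?F\<^esub> g) = lin_ext R M h f \<oplus>\<^bsub>M\<^esub> lin_ext R M h g" .
next
  let ?F = "free_module R S"
  interpret F: module R ?F by (rule free_module_module)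
  fix a f assume a: "a \<in> carrier R" and f: "f \<in> carrier ?F"
  let ?T = "{s. f s \<noteq> \<zero>}"
  have T: "finite ?T" "?T \<subseteq> S" using f by (auto simp: carrier_free_module)
  have sub: "{s. (a \<odot>\<^bsub>?F\<^esub> f) s \<noteq> \<zero>} \<subseteq> ?T" using a by auto
  have "lin_ext R M h (a \<odot>\<^bsub>?F\<^esub> f) = (\<Oplus>\<^bsub>M\<^esub>s\<in>?T. a \<odot>\<^bsub>M\<^esub> (f s \<odot>\<^bsub>M\<^esub> h s))"
    unfolding lin_ext_superset[OF F.smult_closed[OF a f] h T(1) sub T(2)]
    by (intro M.add.finprod_cong')
       (use h T f a in \<open>auto simp: smult_assoc1 free_module_carrierD Pi_iff subset_iff\<close>)
  also have "\<dots> = a \<odot>\<^bsub>M\<^esub> lin_ext R M h f"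
    unfolding lin_ext_def
    by (rule finsum_smult_ldistr[symmetric]) (use T f a h in \<open>auto simp: free_module_carrierD Pi_iff subset_iff\<close>)
  finally show "lin_ext R M h (a \<odot>\<^bsub>?F\<^esub> f) = a \<odot>\<^bsub>M\<^esub> lin_ext R M h f" .
qed

lemma lin_ext_gen:
  assumes h: "h \<in> S \<rightarrow> carrier M" and s: "s \<in> S"
  shows "lin_ext R M h (free_gen R s) = h s"
proof -
  have "lin_ext R M h (free_gen R s) = (\<Oplus>\<^bsub>M\<^esub>t\<in>{s}. free_gen R s t \<odot>\<^bsub>M\<^esub> h t)"
    by (rule lin_ext_superset[OF free_gen_closed[OF s] h]) (use s in \<open>auto simp: free_gen_def\<close>)
  also have "\<dots> = h s"
    using h s by (subst M.finsum_insert) (auto simp: free_gen_def Pi_iff)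
  finally show ?thesis .
qed

end

text \<open>Members are functions, so the equality is checked at each point \<open>s\<close>, where
  only the summand with \<open>t = s\<close> survives.\<close>

lemma (in cring) free_module_decompose:
  assumes "f \<in> carrier (free_module R S)"
  shows "f = lin_ext R (free_module R S) (free_gen R) f"
proof
  fix s
  interpret F: module R "free_module R S" by (rule free_module_module)
  let ?T = "{s. f s \<noteq> \<zero>}"
  have T: "finite ?T" "?T \<subseteq> S" and c: "\<And>t. f t \<in> carrier R"
    using assms free_module_carrierD[OF assms] by (auto simp: carrier_free_module)
  have "(\<lambda>t. f t \<odot>\<^bsub>free_module R S\<^esub> free_gen R t) \<in> ?T \<rightarrow> carrier (free_module R S)"
    using T(2) c by (intro funcsetI F.smult_closed free_gen_closed) auto
  then have "lin_ext R (free_module R S) (free_gen R) f s = (\<Oplus>t\<in>?T. f t \<otimes> free_gen R t s)"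
    unfolding lin_ext_def by (subst free_module_finsum_apply) auto
  also have "\<dots> = f s"
  proof (cases "f s = \<zero>")
    case True
    then have "(\<Oplus>t\<in>?T. f t \<otimes> free_gen R t s) = \<zero>"
      using c by (intro add.finprod_one_eqI) (auto simp: free_gen_def)
    with True show ?thesis by simp
  next
    case False
    have "(\<Oplus>t\<in>?T. f t \<otimes> free_gen R t s) = (\<Oplus>t\<in>?T. if s = t then f t else \<zero>)"
      using c by (intro add.finprod_cong') (auto simp: free_gen_def)
    also have "\<dots> = f s"
      by (rule add.finprod_singleton) (use False T c in auto)
    finally show ?thesis .
  qed
  finally show "f s = lin_ext R (free_module R S) (free_gen R) f s" ..
qed

text \<open>\<open>T\<close> below is a free module whose multiplication and unit fields are
  overwritten. The module axioms involve only the additive and the scalar structure, so they survive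
  the update.\<close>

lemma module_ring_update:
  assumes "module R M"
  shows "module R (M\<lparr>monoid.mult := f, one := u\<rparr>)"
  using assms
  by (simp add: module_def module_axioms_def abelian_group_def abelian_group_axioms_def abelian_monoid_def)

lemma finsum_ring_update: "finsum (M\<lparr>monoid.mult := f, one := u\<rparr>) h A = finsum M h A"
  by (simp add: finsum_def)

section \<open>Quotient modules and the canonical projection\<close>

locale quotient_module = module R M for R and M +
  fixes N
  assumes N: "submodule N R M"
begin

lemma N_abelian_subgroup: "abelian_subgroup N M"
  using submodule.axioms(1)[OF N] by (intro abelian_subgroupI3 M.abelian_group_axioms additive_subgroup.intro)

sublocale NS: abelian_subgroup N M by (rule N_abelian_subgroup)

abbreviation (input) "Q \<equiv> quot_module M N"
abbreviation (input) "\<pi> \<equiv> \<lambda>x. N +>\<^bsub>M\<^esub> x"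

lemma quot_simps [simp]:
  "carrier Q = a_rcosets\<^bsub>M\<^esub> N" "\<zero>\<^bsub>Q\<^esub> = N" "C \<oplus>\<^bsub>Q\<^esub> D = set_add M C D"
  by (simp_all add: quot_module_def)

lemma proj_closed: "x \<in> carrier M \<Longrightarrow> \<pi> x \<in> carrier Q"
  by (simp add: M.a_rcosetsI NS.a_subset)

lemma proj_surj: "C \<in> carrier Q \<Longrightarrow> \<exists>x\<in>carrier M. C = \<pi> x"
  by (auto simp: A_RCOSETS_def')

lemma proj_eq_iff:
  assumes "x \<in> carrier M" "y \<in> carrier M"
  shows "\<pi> x = \<pi> y \<longleftrightarrow> x \<ominus>\<^bsub>M\<^esub> y \<in> N"
proof -
  have "x \<ominus>\<^bsub>M\<^esub> y \<in> N \<longleftrightarrow> x \<in> \<pi> y"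
    unfolding a_minus_def by (rule NS.a_rcos_module[symmetric]) (use assms in auto)
  also have "\<dots> \<longleftrightarrow> \<pi> x = \<pi> y"
    using NS.a_rcos_self[of x] NS.a_repr_independence'[of x y] assms by auto
  finally show ?thesis ..
qed

lemma proj_add:
  "x \<in> carrier M \<Longrightarrow> y \<in> carrier M \<Longrightarrow> \<pi> (x \<oplus>\<^bsub>M\<^esub> y) = \<pi> x \<oplus>\<^bsub>Q\<^esub> \<pi> y"
  by (simp add: NS.a_rcos_sum)

text \<open>A scalar multiple of a coset is defined as a union over all representatives.
  Representatives differ by elements of the submodule, which is stable under scalars, so every
  member of that union is the same coset.\<close>

lemma proj_smult:
  assumes a: "a \<in> carrier R" and x: "x \<in> carrier M"
  shows "\<pi> (a \<odot>\<^bsub>M\<^esub> x) = a \<odot>\<^bsub>Q\<^esub> \<pi> x"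
proof -
  have "\<pi> (a \<odot>\<^bsub>M\<^esub> y) = \<pi> (a \<odot>\<^bsub>M\<^esub> x)" if y: "y \<in> \<pi> x" for y
  proof -
    have yM: "y \<in> carrier M" using y x NS.a_elemrcos_carrier by blast
    have "\<pi> y = \<pi> x" using NS.a_repr_independence'[OF y x] ..
    then have "y \<ominus>\<^bsub>M\<^esub> x \<in> N" using proj_eq_iff yM x by blast
    then have "a \<odot>\<^bsub>M\<^esub> (y \<ominus>\<^bsub>M\<^esub> x) \<in> N" using submoduleE(4)[OF N a] by blast
    then have "a \<odot>\<^bsub>M\<^esub> y \<ominus>\<^bsub>M\<^esub> a \<odot>\<^bsub>M\<^esub> x \<in> N"
      using a x yM by (simp add: a_minus_def smult_r_distr smult_r_minus)
    then show ?thesis using proj_eq_iff a x yM by blast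
  qed
  moreover have "x \<in> \<pi> x" using NS.a_rcos_self[OF x] .
  ultimately have "(\<Union>y\<in>\<pi> x. \<pi> (a \<odot>\<^bsub>M\<^esub> y)) = \<pi> (a \<odot>\<^bsub>M\<^esub> x)" by blast
  then show ?thesis by (simp add: quot_module_def)
qed

lemma quot_module_module: "module R Q"
proof (rule moduleI)
  note surj = proj_surj
  have zero: "\<zero>\<^bsub>Q\<^esub> = \<pi> \<zero>\<^bsub>M\<^esub>"
    using NS.a_subset by (simp add: M.a_coset_add_zero)
  show "abelian_group Q"
  proof (rule abelian_groupI)
    fix C D E assume "C \<in> carrier Q" "D \<in> carrier Q" "E \<in> carrier Q"
    then obtain x y z where xyz: "x \<in> carrier M" "y \<in> carrier M" "z \<in> carrier M"
      and [simp]: "C = \<pi> x" "D = \<pi> y" "E = \<pi> z" using surj by metis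
    show "C \<oplus>\<^bsub>Q\<^esub> D \<in> carrier Q"
      using proj_closed[of "x \<oplus>\<^bsub>M\<^esub> y"] xyz by (simp add: proj_add)
    show "C \<oplus>\<^bsub>Q\<^esub> D \<oplus>\<^bsub>Q\<^esub> E = C \<oplus>\<^bsub>Q\<^esub> (D \<oplus>\<^bsub>Q\<^esub> E)"
      using xyz by (simp add: proj_add[symmetric] M.a_assoc del: quot_simps)
    show "C \<oplus>\<^bsub>Q\<^esub> D = D \<oplus>\<^bsub>Q\<^esub> C"
      using xyz by (simp add: proj_add[symmetric] M.a_comm del: quot_simps)
  next
    fix C assume "C \<in> carrier Q"
    then obtain x where x: "x \<in> carrier M" and [simp]: "C = \<pi> x" using surj by metis
    show "\<zero>\<^bsub>Q\<^esub> \<oplus>\<^bsub>Q\<^esub> C = C"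
      unfolding zero using x by (simp add: proj_add[symmetric] del: quot_simps)
    show "\<exists>D\<in>carrier Q. D \<oplus>\<^bsub>Q\<^esub> C = \<zero>\<^bsub>Q\<^esub>"
      unfolding zero using x
      by (intro bexI[of _ "\<pi> (\<ominus>\<^bsub>M\<^esub> x)"]) (simp_all add: proj_add[symmetric] proj_closed M.l_neg del: quot_simps)
  qed (use proj_closed[of "\<zero>\<^bsub>M\<^esub>"] zero in \<open>auto simp del: quot_simps\<close>)
  fix a b C D assume ab: "a \<in> carrier R" "b \<in> carrier R" and "C \<in> carrier Q" "D \<in> carrier Q"
  then obtain x y where xy: "x \<in> carrier M" "y \<in> carrier M"
    and [simp]: "C = \<pi> x" "D = \<pi> y" using surj by metis
  show "a \<odot>\<^bsub>Q\<^esub> C \<in> carrier Q"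
    using proj_closed[of "a \<odot>\<^bsub>M\<^esub> x"] xy ab by (simp add: proj_smult[symmetric] del: quot_simps)
  show "(a \<oplus>\<^bsub>R\<^esub> b) \<odot>\<^bsub>Q\<^esub> C = a \<odot>\<^bsub>Q\<^esub> C \<oplus>\<^bsub>Q\<^esub> b \<odot>\<^bsub>Q\<^esub> C"
    using ab xy by (simp add: proj_smult[symmetric] proj_add[symmetric] smult_l_distr del: quot_simps)
  show "a \<odot>\<^bsub>Q\<^esub> (C \<oplus>\<^bsub>Q\<^esub> D) = a \<odot>\<^bsub>Q\<^esub> C \<oplus>\<^bsub>Q\<^esub> a \<odot>\<^bsub>Q\<^esub> D"
    using ab xy by (simp add: proj_smult[symmetric] proj_add[symmetric] smult_r_distr del: quot_simps)
  show "(a \<otimes>\<^bsub>R\<^esub> b) \<odot>\<^bsub>Q\<^esub> C = a \<odot>\<^bsub>Q\<^esub> (b \<odot>\<^bsub>Q\<^esub> C)"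
    using ab xy by (simp add: proj_smult[symmetric] smult_assoc1 del: quot_simps)
next
  fix C assume "C \<in> carrier Q"
  then obtain x where x: "x \<in> carrier M" and [simp]: "C = \<pi> x" using proj_surj by metis
  show "\<one>\<^bsub>R\<^esub> \<odot>\<^bsub>Q\<^esub> C = C" using x by (simp add: proj_smult[symmetric] del: quot_simps)
qed (rule R.cring_axioms)

sublocale proj: linear_hom R M Q \<pi>
  by (intro linear_hom.intro linear_hom_axioms.intro module_axioms quot_module_module)
     (auto simp: linear_map_def proj_closed proj_add proj_smult simp del: quot_simps)

lemma proj_zero_iff: "x \<in> carrier M \<Longrightarrow> \<pi> x = \<zero>\<^bsub>Q\<^esub> \<longleftrightarrow> x \<in> N"
  using NS.a_rcos_const[of x] NS.a_rcos_self[of x] by auto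

end

section \<open>The tensor square of a free algebra\<close>

locale free_algebra = A: cring A + B: cring B
  for A :: "('a, 'c) ring_scheme" and B :: "('a, 'b, 'd) module_scheme" (structure) +
  fixes n :: nat and e :: "nat \<Rightarrow> 'b"
  assumes algebra: "algebra A B" and basis: "free_basis A B n e"
begin

sublocale AB: module A B
  using algebra by (rule algebra.axioms)

abbreviation co :: "'b \<Rightarrow> nat \<Rightarrow> 'a" where "co \<equiv> coords A B n e"

text \<open>The structure map of the algebra. It turns scalars into elements of B
  (\<open>smult_eq\<close>), so that A-linearity can be expressed by multiplication inside one
  ring.\<close>

definition \<alpha> :: "'a \<Rightarrow> 'b" where "\<alpha> a = a \<odot> \<one>"

lemma smult_eq: "a \<in> carrier A \<Longrightarrow> x \<in> carrier B \<Longrightarrow> a \<odot> x = \<alpha> a \<otimes> x"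
  using algebra.smult_assoc2[OF algebra, of a \<one> x] by (simp add: \<alpha>_def)

lemma alpha_hom: "ring_hom_cring A B \<alpha>"
proof (intro ring_hom_cring.intro ring_hom_cring_axioms.intro ring_hom_memI)
  fix a b assume ab: "a \<in> carrier A" "b \<in> carrier A"
  show "\<alpha> (a \<otimes>\<^bsub>A\<^esub> b) = \<alpha> a \<otimes> \<alpha> b"
    using ab smult_eq[of a "\<alpha> b"] by (simp add: \<alpha>_def AB.smult_assoc1)
qed (auto simp: \<alpha>_def AB.smult_l_distr A.cring_axioms B.cring_axioms)

sublocale \<alpha>: ring_hom_cring A B \<alpha>
  by (rule alpha_hom)

section \<open>Coordinates with respect to the basis\<close>

lemma e_closed [simp]: "i < n \<Longrightarrow> e i \<in> carrier B"
  using basis by (auto simp: free_basis_def)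

lemma e_Pi [simp]: "e \<in> {..<n} \<rightarrow> carrier B"
  by auto

lemma co_props:
  assumes "x \<in> carrier B"
  shows "co x \<in> {..<n} \<rightarrow>\<^sub>E carrier A" "x = lin_comb B n (co x) e"
  using theI'[of "\<lambda>c. c \<in> {..<n} \<rightarrow>\<^sub>E carrier A \<and> x = lin_comb B n c e"] basis assms
  by (auto simp: free_basis_def coords_def)

lemma co_closed [simp]: "x \<in> carrier B \<Longrightarrow> k < n \<Longrightarrow> co x k \<in> carrier A"
  using co_props(1) by (auto simp: PiE_iff)

lemma co_Pi [simp]: "x \<in> carrier B \<Longrightarrow> co x \<in> {..<n} \<rightarrow> carrier A"
  by auto

lemma co_unique:
  assumes c: "c \<in> {..<n} \<rightarrow> carrier A" and x: "x = lin_comb B n c e" and k: "k < n"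
  shows "co x k = c k"
proof -
  \<comment> \<open>The uniqueness clause of \<open>free_basis\<close> concerns functions that are
    \<open>undefined\<close> outside \<open>{..<n}\<close>, hence the restriction.\<close>
  let ?c = "restrict c {..<n}"
  have xB: "x \<in> carrier B" using c x by simp
  have "x = lin_comb B n ?c e"
    unfolding x by (rule AB.lin_comb_cong[symmetric]) (use c in auto)
  moreover have "?c \<in> {..<n} \<rightarrow>\<^sub>E carrier A" using c by auto
  ultimately have "co x = ?c" using co_props[OF xB] basis xB by (auto simp: free_basis_def)
  then show ?thesis using k by simp
qed

lemma co_add:
  assumes "x \<in> carrier B" "y \<in> carrier B" "k < n"
  shows "co (x \<oplus> y) k = co x k \<oplus>\<^bsub>A\<^esub> co y k"
  by (rule co_unique[where c = "\<lambda>k. co x k \<oplus>\<^bsub>A\<^esub> co y k"])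
     (use assms in \<open>auto simp: AB.lin_comb_add simp flip: co_props(2)\<close>)

lemma co_smult:
  assumes "a \<in> carrier A" "x \<in> carrier B" "k < n"
  shows "co (a \<odot> x) k = a \<otimes>\<^bsub>A\<^esub> co x k"
  by (rule co_unique[where c = "\<lambda>k. a \<otimes>\<^bsub>A\<^esub> co x k"])
     (use assms in \<open>auto simp: AB.lin_comb_smult simp flip: co_props(2)\<close>)

lemma co_zero: "k < n \<Longrightarrow> co \<zero> k = \<zero>\<^bsub>A\<^esub>"
  using co_smult[of "\<zero>\<^bsub>A\<^esub>" \<zero> k] by simp

lemma co_finsum:
  assumes "f \<in> I \<rightarrow> carrier B" "k < n"
  shows "co (finsum B f I) k = (\<Oplus>\<^bsub>A\<^esub>i\<in>I. co (f i) k)"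
  by (rule finsum_additive[where h = "\<lambda>x. co x k" and G = B])
     (use assms in \<open>auto simp: co_add co_zero B.abelian_monoid_axioms A.abelian_monoid_axioms\<close>)

lemma co_e:
  assumes "i < n" "k < n"
  shows "co (e i) k = (if k = i then \<one>\<^bsub>A\<^esub> else \<zero>\<^bsub>A\<^esub>)"
  by (rule co_unique[where c = "\<lambda>k. if k = i then \<one>\<^bsub>A\<^esub> else \<zero>\<^bsub>A\<^esub>"])
     (use assms AB.lin_comb_generator[of e n i] in auto)

text \<open>The coordinates of \<open>x\<close>, mapped to \<open>B\<close>; below this is \<open>1 \<otimes> x\<close> in the basis \<open>1 \<otimes> e\<^sub>k\<close> of \<open>B \<otimes>\<^sub>A B\<close>.\<close>

definition rho :: "'b \<Rightarrow> nat \<Rightarrow> 'b" where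
  "rho x k = (if k < n then \<alpha> (co x k) else \<zero>)"

lemma rho_closed [simp]: "x \<in> carrier B \<Longrightarrow> rho x k \<in> carrier B"
  by (simp add: rho_def)

lemma rho_add: "x \<in> carrier B \<Longrightarrow> y \<in> carrier B \<Longrightarrow> rho (x \<oplus> y) k = rho x k \<oplus> rho y k"
  by (simp add: rho_def co_add)

lemma rho_alpha: "a \<in> carrier A \<Longrightarrow> x \<in> carrier B \<Longrightarrow> rho (\<alpha> a \<otimes> x) k = \<alpha> a \<otimes> rho x k"
  by (simp add: rho_def co_smult flip: smult_eq)

lemma rho_e: "i < n \<Longrightarrow> rho (e i) k = (if k = i then \<one> else \<zero>)"
  by (auto simp: rho_def co_e)

lemma rho_expand:
  assumes x: "x \<in> carrier B"
  shows "(\<Oplus>k\<in>{..<n}. rho x k \<otimes> e k) = x"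
proof -
  have "(\<Oplus>k\<in>{..<n}. rho x k \<otimes> e k) = lin_comb B n (co x) e"
    unfolding lin_comb_def
    by (rule B.add.finprod_cong') (use x in \<open>auto simp: rho_def smult_eq\<close>)
  then show ?thesis using co_props(2)[OF x] by simp
qed

section \<open>A-linear maps and their evaluation on tensors\<close>

definition A_linear :: "('b \<Rightarrow> 'b) \<Rightarrow> bool" where
  "A_linear \<phi> \<longleftrightarrow> \<phi> \<in> carrier B \<rightarrow> carrier B \<and>
     (\<forall>x\<in>carrier B. \<forall>y\<in>carrier B. \<phi> (x \<oplus> y) = \<phi> x \<oplus> \<phi> y) \<and>
     (\<forall>a\<in>carrier A. \<forall>x\<in>carrier B. \<phi> (\<alpha> a \<otimes> x) = \<alpha> a \<otimes> \<phi> x)"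

lemma A_linearD:
  assumes "A_linear \<phi>"
  shows "x \<in> carrier B \<Longrightarrow> \<phi> x \<in> carrier B"
    "x \<in> carrier B \<Longrightarrow> y \<in> carrier B \<Longrightarrow> \<phi> (x \<oplus> y) = \<phi> x \<oplus> \<phi> y"
    "a \<in> carrier A \<Longrightarrow> x \<in> carrier B \<Longrightarrow> \<phi> (\<alpha> a \<otimes> x) = \<alpha> a \<otimes> \<phi> x"
  using assms by (auto simp: A_linear_def)

lemma A_linear_zero: "A_linear \<phi> \<Longrightarrow> \<phi> \<zero> = \<zero>"
  using A_linearD(3)[of \<phi> "\<zero>\<^bsub>A\<^esub>" \<zero>] A_linearD(1)[of \<phi> \<zero>] by simp

lemma A_linear_finsum:
  assumes \<phi>: "A_linear \<phi>" and f: "f \<in> I \<rightarrow> carrier B"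
  shows "\<phi> (finsum B f I) = (\<Oplus>i\<in>I. \<phi> (f i))"
  by (rule finsum_additive[where h = \<phi> and G = B])
     (auto simp: f A_linear_zero[OF \<phi>] A_linearD[OF \<phi>] B.abelian_monoid_axioms)

text \<open>The entries of \<open>rho x\<close> are images of scalars, so an A-linear map lets them
  pass out of the expansion of \<open>x\<close>.\<close>

lemma A_linear_expand:
  assumes \<phi>: "A_linear \<phi>" and x: "x \<in> carrier B"
  shows "(\<Oplus>k\<in>{..<n}. rho x k \<otimes> \<phi> (e k)) = \<phi> x"
proof -
  have "\<phi> x = \<phi> (\<Oplus>k\<in>{..<n}. rho x k \<otimes> e k)" by (simp add: rho_expand x)
  also have "\<dots> = (\<Oplus>k\<in>{..<n}. \<phi> (rho x k \<otimes> e k))"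
    by (rule A_linear_finsum[OF \<phi>]) (use x in auto)
  also have "\<dots> = (\<Oplus>k\<in>{..<n}. rho x k \<otimes> \<phi> (e k))"
    by (rule B.add.finprod_cong') (use x in \<open>auto simp: rho_def A_linearD[OF \<phi>]\<close>)
  finally show ?thesis ..
qed

lemma A_linear_id: "A_linear (\<lambda>x. x)"
  by (simp add: A_linear_def)

lemma A_linear_rho: "A_linear (\<lambda>x. rho x k)"
  by (simp add: A_linear_def rho_add rho_alpha)

lemma A_linear_mult_left: "A_linear \<phi> \<Longrightarrow> y \<in> carrier B \<Longrightarrow> A_linear (\<lambda>x. \<phi> (x \<otimes> y))"
  by (auto simp: A_linear_def B.l_distr B.m_assoc)

lemma A_linear_mult_right: "A_linear \<phi> \<Longrightarrow> y \<in> carrier B \<Longrightarrow> A_linear (\<lambda>x. \<phi> (y \<otimes> x))"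
  by (auto simp: A_linear_def B.r_distr B.m_lcomm[of y "\<alpha> _"])

text \<open>\<open>ev \<phi> u\<close> is the image of \<open>\<Sum>\<^sub>i u\<^sub>i \<otimes> e\<^sub>i\<close> under \<open>x \<otimes> y \<mapsto> x \<phi>(y)\<close>.\<close>

definition ev :: "('b \<Rightarrow> 'b) \<Rightarrow> (nat \<Rightarrow> 'b) \<Rightarrow> 'b" where
  "ev \<phi> u = (\<Oplus>i\<in>{..<n}. u i \<otimes> \<phi> (e i))"

text \<open>Coefficient vectors vanish from index \<open>n\<close> on, so two tensors are equal
  exactly when they are equal as functions.\<close>

abbreviation T0 :: "('b, nat \<Rightarrow> 'b) module" where "T0 \<equiv> free_module B {..<n}"

lemma T0_closed: "u \<in> carrier T0 \<Longrightarrow> u i \<in> carrier B"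
  by (rule B.free_module_carrierD)

lemma T0_zero: "u \<in> carrier T0 \<Longrightarrow> \<not> i < n \<Longrightarrow> u i = \<zero>"
  by (simp add: carrier_free_module)

lemma T0_I:
  assumes "\<And>i. u i \<in> carrier B" "\<And>i. \<not> i < n \<Longrightarrow> u i = \<zero>"
  shows "u \<in> carrier T0"
proof -
  have "{i. u i \<noteq> \<zero>} \<subseteq> {..<n}" using assms(2) by auto
  then have "finite {i. u i \<noteq> \<zero>}" by (rule finite_subset) simp
  then show ?thesis using assms by (auto simp: carrier_free_module)
qed

lemma ev_closed [simp]:
  assumes \<phi>: "A_linear \<phi>" and u: "u \<in> carrier T0"
  shows "ev \<phi> u \<in> carrier B"
  using T0_closed[OF u] by (auto simp: ev_def A_linearD(1)[OF \<phi>] intro!: B.finsum_closed)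

text \<open>Allows evaluations to be nested: evaluating in the second variable keeps linearity in
  the first, so the result can be evaluated again.\<close>

lemma A_linear_ev:
  assumes \<Phi>: "\<And>y. y \<in> carrier B \<Longrightarrow> A_linear (\<lambda>x. \<Phi> x y)" and u: "u \<in> carrier T0"
  shows "A_linear (\<lambda>x. ev (\<Phi> x) u)"
proof -
  have c: "\<Phi> x (e i) \<in> carrier B" if "i < n" "x \<in> carrier B" for i x
    using A_linearD(1)[OF \<Phi>[of "e i"]] that by simp
  have "ev (\<Phi> (x \<oplus> y)) u = ev (\<Phi> x) u \<oplus> ev (\<Phi> y) u"
    if xy: "x \<in> carrier B" "y \<in> carrier B" for x y
    unfolding ev_def
    by (subst B.finsum_addf[symmetric])
       (use T0_closed[OF u] xy c in \<open>auto intro!: B.add.finprod_cong' simp: A_linearD(2)[OF \<Phi>] B.r_distr simp del: B.add.finprod_multf\<close>)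
  moreover have "ev (\<Phi> (\<alpha> a \<otimes> x)) u = \<alpha> a \<otimes> ev (\<Phi> x) u"
    if "a \<in> carrier A" "x \<in> carrier B" for a x
    unfolding ev_def
    by (subst B.finsum_rdistr)
       (use T0_closed[OF u] that c in \<open>auto intro!: B.add.finprod_cong' simp: A_linearD(3)[OF \<Phi>] B.m_lcomm\<close>)
  ultimately show ?thesis
    using T0_closed[OF u] c by (auto simp: A_linear_def ev_def intro!: B.finsum_closed)
qed

lemma ev_cong:
  assumes "\<And>x. x \<in> carrier B \<Longrightarrow> \<phi> x = \<psi> x" "A_linear \<phi>" "u \<in> carrier T0"
  shows "ev \<psi> u = ev \<phi> u"
  unfolding ev_def by (rule B.add.finprod_cong') (use assms assms assms(3)[THEN T0_closed] A_linearD(1)[OF assms(2)] in auto)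

lemma ev_add:
  assumes "A_linear \<phi>" "u \<in> carrier T0" "v \<in> carrier T0"
  shows "ev \<phi> (\<lambda>i. u i \<oplus> v i) = ev \<phi> u \<oplus> ev \<phi> v"
  unfolding ev_def
  by (subst B.finsum_addf[symmetric])
     (use assms assms(2)[THEN T0_closed] assms(3)[THEN T0_closed] in \<open>auto intro!: B.add.finprod_cong' simp: A_linearD(1)[OF assms(1)] B.l_distr simp del: B.add.finprod_multf\<close>)

lemma ev_smult:
  assumes "A_linear \<phi>" "u \<in> carrier T0" "b \<in> carrier B"
  shows "ev \<phi> (\<lambda>i. b \<otimes> u i) = b \<otimes> ev \<phi> u"
  unfolding ev_def
  by (subst B.finsum_rdistr)
     (use assms assms(2)[THEN T0_closed] in \<open>auto intro!: B.add.finprod_cong' simp: A_linearD(1)[OF assms(1)] B.m_assoc\<close>)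

lemma rho_T0 [simp]: "x \<in> carrier B \<Longrightarrow> rho x \<in> carrier T0"
  by (rule T0_I) (auto simp: rho_def)

lemma ev_rho: "A_linear \<phi> \<Longrightarrow> x \<in> carrier B \<Longrightarrow> ev \<phi> (rho x) = \<phi> x"
  unfolding ev_def by (rule A_linear_expand)

text \<open>A coefficient of a tensor is itself an evaluation, at a coordinate form of B. Identities
  between tensors thereby become identities between evaluations.\<close>

lemma ev_coordinate:
  assumes "u \<in> carrier T0"
  shows "ev (\<lambda>x. rho x k) u = u k"
proof (cases "k < n")
  case True
  have "ev (\<lambda>x. rho x k) u = (\<Oplus>i\<in>{..<n}. if k = i then u i else \<zero>)"
    unfolding ev_def by (rule B.add.finprod_cong') (use assms[THEN T0_closed] in \<open>auto simp: rho_e\<close>)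
  also have "\<dots> = u k"
    by (rule B.add.finprod_singleton) (use True T0_closed[OF assms] in auto)
  finally show ?thesis .
next
  case False
  then have "ev (\<lambda>x. rho x k) u = \<zero>"
    unfolding ev_def by (intro B.add.finprod_one_eqI) (use assms[THEN T0_closed] in \<open>auto simp: rho_def\<close>)
  with False show ?thesis using T0_zero[OF assms] by simp
qed

text \<open>Coordinate \<open>k\<close> of the sum of all \<open>u i v j\<close> \<otimes>
  \<open>e i e j\<close>. Written with nested evaluations instead of structure constants, so that
  associativity can be inherited from B.\<close>

definition tmult :: "(nat \<Rightarrow> 'b) \<Rightarrow> (nat \<Rightarrow> 'b) \<Rightarrow> nat \<Rightarrow> 'b" where
  "tmult u v = (\<lambda>k. ev (\<lambda>x. ev (\<lambda>y. rho (x \<otimes> y) k) v) u)"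

lemma A_linear_ev_mult:
  assumes "A_linear \<phi>" "v \<in> carrier T0"
  shows "A_linear (\<lambda>x. ev (\<lambda>y. \<phi> (x \<otimes> y)) v)"
  by (rule A_linear_ev[OF A_linear_mult_left[OF assms(1)] assms(2)])

lemmas A_linear_tmult = A_linear_ev_mult[OF A_linear_rho]

lemma tmult_T0 [simp]:
  assumes "u \<in> carrier T0" "v \<in> carrier T0"
  shows "tmult u v \<in> carrier T0"
proof (rule T0_I)
  show "tmult u v i \<in> carrier B" for i
    unfolding tmult_def using A_linear_ev_mult[OF A_linear_rho assms(2)] assms(1) by (rule ev_closed)
  fix k assume "\<not> k < n"
  then have *: "rho x k = \<zero>" for x by (simp add: rho_def)
  have [simp]: "(\<Oplus>i\<in>{..<n}. u i \<otimes> \<zero>) = \<zero>" if "u \<in> carrier T0" for u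
    by (rule B.add.finprod_one_eqI) (use T0_closed[OF that] in auto)
  show "tmult u v k = \<zero>" unfolding tmult_def * ev_def by (simp add: assms)
qed

lemma ev_ev_mult:
  assumes \<phi>: "A_linear \<phi>" and u: "u \<in> carrier T0" and v: "v \<in> carrier T0"
  shows "ev (\<lambda>x. ev (\<lambda>y. \<phi> (x \<otimes> y)) v) u =
    (\<Oplus>i\<in>{..<n}. \<Oplus>j\<in>{..<n}. u i \<otimes> (v j \<otimes> \<phi> (e i \<otimes> e j)))"
  unfolding ev_def
proof (rule B.add.finprod_cong'[OF refl])
  fix i assume "i \<in> {..<n}"
  then show "u i \<otimes> (\<Oplus>j\<in>{..<n}. v j \<otimes> \<phi> (e i \<otimes> e j)) = (\<Oplus>j\<in>{..<n}. u i \<otimes> (v j \<otimes> \<phi> (e i \<otimes> e j)))"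
    using T0_closed[OF u] T0_closed[OF v] by (intro B.finsum_rdistr) (auto simp: A_linearD(1)[OF \<phi>])
qed (use T0_closed[OF u] T0_closed[OF v] in \<open>auto simp: A_linearD(1)[OF \<phi>] intro!: B.finsum_closed\<close>)

lemma tmult_sum:
  "u \<in> carrier T0 \<Longrightarrow> v \<in> carrier T0 \<Longrightarrow>
    tmult u v k = (\<Oplus>i\<in>{..<n}. \<Oplus>j\<in>{..<n}. u i \<otimes> (v j \<otimes> rho (e i \<otimes> e j) k))"
  unfolding tmult_def by (rule ev_ev_mult[OF A_linear_rho])

text \<open>Both sides expand over pairs of basis elements. On the left the sum over
  \<open>k\<close> is moved innermost, where \<open>A_linear_expand\<close> reassembles
  \<open>\<phi> (e i \<otimes> e j)\<close> from the coordinates of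
  \<open>e i \<otimes> e j\<close>.\<close>

lemma ev_tmult:
  assumes \<phi>: "A_linear \<phi>" and u: "u \<in> carrier T0" and v: "v \<in> carrier T0"
  shows "ev \<phi> (tmult u v) = ev (\<lambda>x. ev (\<lambda>y. \<phi> (x \<otimes> y)) v) u"
proof -
  let ?I = "{..<n}"
  define c where "c k = \<phi> (e k)" for k
  have c: "c k \<in> carrier B" if "k < n" for k using A_linearD(1)[OF \<phi>] that by (simp add: c_def)
  define f where "f i j k = u i \<otimes> (v j \<otimes> rho (e i \<otimes> e j) k)" for i j k
  have f: "f i j k \<in> carrier B" if "i < n" "j < n" for i j k using T0_closed[OF u] T0_closed[OF v] that by (simp add: f_def)
  have fs: "(\<Oplus>j\<in>?I. f i j k) \<in> carrier B" if "i < n" for i k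
    using f that by (auto intro!: B.finsum_closed)
  have fcs: "(\<Oplus>j\<in>?I. f i j k \<otimes> c k) \<in> carrier B" if "i < n" "k < n" for i k
    using f c that by (auto intro!: B.finsum_closed)
  have fcs': "(\<Oplus>k\<in>?I. f i j k \<otimes> c k) \<in> carrier B" if "i < n" "j < n" for i j
    using f c that by (auto intro!: B.finsum_closed)
  have "ev \<phi> (tmult u v) = (\<Oplus>k\<in>?I. (\<Oplus>i\<in>?I. \<Oplus>j\<in>?I. f i j k) \<otimes> c k)"
    unfolding ev_def c_def f_def by (simp add: tmult_sum[OF u v])
  also have "\<dots> = (\<Oplus>k\<in>?I. \<Oplus>i\<in>?I. \<Oplus>j\<in>?I. f i j k \<otimes> c k)"
  proof (rule B.add.finprod_cong'[OF refl])
    fix k assume "k \<in> ?I"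
    then have k: "k < n" by simp
    have "(\<Oplus>i\<in>?I. \<Oplus>j\<in>?I. f i j k) \<otimes> c k = (\<Oplus>i\<in>?I. (\<Oplus>j\<in>?I. f i j k) \<otimes> c k)"
      by (rule B.finsum_ldistr) (use fs c[OF k] in auto)
    also have "\<dots> = (\<Oplus>i\<in>?I. \<Oplus>j\<in>?I. f i j k \<otimes> c k)"
      by (rule B.add.finprod_cong'[OF refl _ B.finsum_ldistr]) (use f fcs c[OF k] k in auto)
    finally show "(\<Oplus>i\<in>?I. \<Oplus>j\<in>?I. f i j k) \<otimes> c k = (\<Oplus>i\<in>?I. \<Oplus>j\<in>?I. f i j k \<otimes> c k)" .
  qed (use fcs in \<open>auto intro!: B.finsum_closed\<close>)
  also have "\<dots> = (\<Oplus>i\<in>?I. \<Oplus>k\<in>?I. \<Oplus>j\<in>?I. f i j k \<otimes> c k)"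
    by (rule B.finsum_swap) (use fcs in auto)
  also have "\<dots> = (\<Oplus>i\<in>?I. \<Oplus>j\<in>?I. \<Oplus>k\<in>?I. f i j k \<otimes> c k)"
    by (rule B.add.finprod_cong'[OF refl _ B.finsum_swap])
       (use f c fcs' in \<open>auto intro!: B.finsum_closed\<close>)
  also have "\<dots> = (\<Oplus>i\<in>?I. \<Oplus>j\<in>?I. u i \<otimes> (v j \<otimes> \<phi> (e i \<otimes> e j)))"
  proof (rule B.add.finprod_cong'[OF refl _ B.add.finprod_cong'[OF refl]])
    fix i j assume "i \<in> ?I" "j \<in> ?I"
    then have ij: "i < n" "j < n" by auto
    have "(\<Oplus>k\<in>?I. f i j k \<otimes> c k) = (\<Oplus>k\<in>?I. (u i \<otimes> v j) \<otimes> (rho (e i \<otimes> e j) k \<otimes> c k))"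
      by (rule B.add.finprod_cong') (use T0_closed[OF u] T0_closed[OF v] c ij in \<open>auto simp: f_def B.m_assoc\<close>)
    also have "\<dots> = (u i \<otimes> v j) \<otimes> (\<Oplus>k\<in>?I. rho (e i \<otimes> e j) k \<otimes> c k)"
      by (rule B.finsum_rdistr[symmetric]) (use T0_closed[OF u] T0_closed[OF v] c ij in auto)
    also have "\<dots> = u i \<otimes> (v j \<otimes> \<phi> (e i \<otimes> e j))"
      using A_linear_expand[OF \<phi>, of "e i \<otimes> e j"] ij T0_closed[OF u] T0_closed[OF v] A_linearD(1)[OF \<phi>] by (simp add: c_def B.m_assoc)
    finally show "(\<Oplus>k\<in>?I. f i j k \<otimes> c k) = u i \<otimes> (v j \<otimes> \<phi> (e i \<otimes> e j))" .
  qed (use T0_closed[OF u] T0_closed[OF v] A_linearD(1)[OF \<phi>] in \<open>auto intro!: B.finsum_closed\<close>)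
  also have "\<dots> = ev (\<lambda>x. ev (\<lambda>y. \<phi> (x \<otimes> y)) v) u"
    by (rule ev_ev_mult[OF \<phi> u v, symmetric])
  finally show ?thesis .
qed

text \<open>\<open>T\<close> is \<open>B \<otimes>\<^sub>A B\<close>, with \<open>u\<close> standing for \<open>\<Sum>\<^sub>i u\<^sub>i \<otimes> e\<^sub>i\<close>.\<close>

definition T :: "('b, nat \<Rightarrow> 'b) module" where
  "T = T0\<lparr>monoid.mult := tmult, one := rho \<one>\<rparr>"

lemma T_simps [simp]:
  "carrier T = carrier T0" "u \<otimes>\<^bsub>T\<^esub> v = tmult u v" "\<one>\<^bsub>T\<^esub> = rho \<one>"
  "\<zero>\<^bsub>T\<^esub> = (\<lambda>i. \<zero>)" "u \<oplus>\<^bsub>T\<^esub> v = (\<lambda>i. u i \<oplus> v i)" "b \<odot>\<^bsub>T\<^esub> u = (\<lambda>i. b \<otimes> u i)"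
  by (simp_all add: T_def)

lemma T_module: "module B T"
  unfolding T_def by (rule module_ring_update) (rule B.free_module_module)

lemma tmult_comm:
  assumes "u \<in> carrier T0" "v \<in> carrier T0"
  shows "tmult u v = tmult v u"
proof
  fix k
  have "tmult u v k = (\<Oplus>j\<in>{..<n}. \<Oplus>i\<in>{..<n}. u i \<otimes> (v j \<otimes> rho (e i \<otimes> e j) k))"
    unfolding tmult_sum[OF assms] by (rule B.finsum_swap) (use assms(1)[THEN T0_closed] assms(2)[THEN T0_closed] in auto)
  also have "\<dots> = tmult v u k"
    unfolding tmult_sum[OF assms(2,1)]
  proof (rule B.add.finprod_cong'[OF refl _ B.add.finprod_cong'[OF refl]])
    fix i j assume "i \<in> {..<n}" "j \<in> {..<n}"
    then show "u j \<otimes> (v i \<otimes> rho (e j \<otimes> e i) k) = v i \<otimes> (u j \<otimes> rho (e i \<otimes> e j) k)"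
      using assms[THEN T0_closed] B.m_comm[of "e i" "e j"] B.m_lcomm[of "u j" "v i"] by simp
  qed (use assms(1)[THEN T0_closed] assms(2)[THEN T0_closed] in \<open>auto intro!: B.finsum_closed\<close>)
  finally show "tmult u v k = tmult v u k" .
qed

text \<open>By \<open>ev_tmult\<close> both sides unfold to the triple evaluation of coordinate
  \<open>k\<close> of a product \<open>x y z\<close>, where associativity of B applies.\<close>

lemma tmult_assoc:
  assumes "u \<in> carrier T0" "v \<in> carrier T0" "w \<in> carrier T0"
  shows "tmult (tmult u v) w = tmult u (tmult v w)"
proof
  fix k
  note lin = A_linear_tmult
  have "tmult (tmult u v) w k = ev (\<lambda>x. ev (\<lambda>y. ev (\<lambda>z. rho (x \<otimes> y \<otimes> z) k) w) v) u"
    unfolding tmult_def[of "tmult u v"] by (rule ev_tmult[OF lin[OF assms(3)] assms(1,2)])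
  also have "\<dots> = ev (\<lambda>x. ev (\<lambda>y. rho (x \<otimes> y) k) (tmult v w)) u"
  proof (rule ev_cong)
    fix x assume x: "x \<in> carrier B"
    have "ev (\<lambda>y. rho (x \<otimes> y) k) (tmult v w) = ev (\<lambda>y. ev (\<lambda>z. rho (x \<otimes> (y \<otimes> z)) k) w) v"
      by (rule ev_tmult[OF A_linear_mult_right[OF A_linear_rho x] assms(2,3)])
    also have "\<dots> = ev (\<lambda>y. ev (\<lambda>z. rho (x \<otimes> y \<otimes> z) k) w) v"
    proof (rule ev_cong)
      show "A_linear (\<lambda>y. ev (\<lambda>z. rho (x \<otimes> y \<otimes> z) k) w)"
        using A_linear_mult_right[OF lin[OF assms(3)] x] .
    qed (use x assms T0_closed[OF assms(3)] in \<open>auto simp: B.m_assoc ev_def intro!: B.add.finprod_cong'\<close>)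
    finally show "ev (\<lambda>y. rho (x \<otimes> y) k) (tmult v w) = ev (\<lambda>y. ev (\<lambda>z. rho (x \<otimes> y \<otimes> z) k) w) v" .
  qed (rule lin assms tmult_T0 | assumption)+
  finally show "tmult (tmult u v) w k = tmult u (tmult v w) k" by (simp add: tmult_def[of u])
qed

lemma tmult_rho:
  assumes "x \<in> carrier B" "u \<in> carrier T0"
  shows "tmult (rho x) u = (\<lambda>k. ev (\<lambda>y. rho (x \<otimes> y) k) u)"
  unfolding tmult_def by (rule ext, rule ev_rho[OF A_linear_tmult[OF assms(2)] assms(1)])

lemma tmult_one:
  assumes "u \<in> carrier T0" shows "tmult (rho \<one>) u = u"
proof
  fix k
  have "tmult (rho \<one>) u k = ev (\<lambda>y. rho (\<one> \<otimes> y) k) u"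
    using assms by (simp add: tmult_rho)
  also have "\<dots> = ev (\<lambda>y. rho y k) u"
    by (rule ev_cong) (use assms A_linear_rho in auto)
  finally show "tmult (rho \<one>) u k = u k" using assms by (simp add: ev_coordinate)
qed

lemma T_algebra: "algebra B T"
proof -
  interpret T: module B T by (rule T_module)
  have "comm_monoid T"
    by (rule comm_monoidI) (simp_all add: tmult_assoc tmult_one, rule tmult_comm)
  moreover have "tmult (\<lambda>i. u i \<oplus> v i) w = (\<lambda>k. tmult u w k \<oplus> tmult v w k)"
    if "u \<in> carrier T0" "v \<in> carrier T0" "w \<in> carrier T0" for u v w
    unfolding tmult_def using that by (simp add: ev_add[OF A_linear_tmult])
  ultimately have "cring T"
    by (intro cringI T.M.abelian_group_axioms) auto
  moreover have "tmult (\<lambda>i. b \<otimes> u i) w = (\<lambda>k. b \<otimes> tmult u w k)"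
    if "u \<in> carrier T0" "b \<in> carrier B" "w \<in> carrier T0" for b u w
    unfolding tmult_def using that by (simp add: ev_smult[OF A_linear_tmult])
  ultimately show ?thesis
    by (intro algebra.intro algebra_axioms.intro T_module) auto
qed

end

section \<open>The kernel of multiplication\<close>

text \<open>Cramer's rule with a right-hand side: putting the row \<open>s M\<close> in place of row
  \<open>i\<close> gives \<open>s i\<close> times the determinant. That row is also a combination of
  the rows of \<open>c\<close>, along which the determinant splits; so \<open>a j\<close> is the
  determinant with \<open>c j\<close> as row \<open>i\<close>.\<close>

lemma (in cring) lin_relation_det:
  assumes M: "mat_over R n n M" and s: "s \<in> {..<n} \<rightarrow> carrier R" and t: "t \<in> {..<m} \<rightarrow> carrier R"
    and c: "mat_over R m n c"
    and rel: "\<And>l. l < n \<Longrightarrow> (\<Oplus>i\<in>{..<n}. s i \<otimes> M i l) = (\<Oplus>j\<in>{..<m}. t j \<otimes> c j l)"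
    and i: "i < n"
  shows "\<exists>a\<in>{..<m} \<rightarrow> carrier R. s i \<otimes> mat_det R n M = (\<Oplus>j\<in>{..<m}. t j \<otimes> a j)"
proof (rule bexI)
  have cr: "c j \<in> {..<n} \<rightarrow> carrier R" if "j < m" for j using c that by (auto simp: mat_over_def)
  have "s i \<otimes> mat_det R n M = mat_det R n (M(i := \<lambda>l. \<Oplus>j\<in>{..<m}. t j \<otimes> c j l))"
    by (rule cramer[symmetric]) (use M i s rel in auto)
  also have "\<dots> = (\<Oplus>j\<in>{..<m}. t j \<otimes> mat_det R n (M(i := c j)))"
    by (rule mat_det_row_sum) (use M i t cr in auto)
  finally show "s i \<otimes> mat_det R n M = (\<Oplus>j\<in>{..<m}. t j \<otimes> mat_det R n (M(i := c j)))" .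
  show "(\<lambda>j. mat_det R n (M(i := c j))) \<in> {..<m} \<rightarrow> carrier R"
    using M cr by (auto simp: mat_over_row_update)
qed

text \<open>The case \<open>m = 0\<close> of \<open>lin_relation_det\<close>, where the right-hand
  sides are empty sums.\<close>

lemma (in cring) lin_relation_det_zero:
  assumes "mat_over R n n M" "s \<in> {..<n} \<rightarrow> carrier R" "i < n"
    and "\<And>l. l < n \<Longrightarrow> (\<Oplus>i\<in>{..<n}. s i \<otimes> M i l) = \<zero>"
  shows "s i \<otimes> mat_det R n M = \<zero>"
  using lin_relation_det[OF assms(1,2), of "\<lambda>_. \<zero>" 0 "\<lambda>_ _. \<zero>" i] assms by (auto simp: mat_over_def)

context free_algebra
begin

section \<open>The two copies of B in the tensor square and the multiplication map\<close>

sublocale T: cring T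
  by (rule algebra.M_cring) (rule T_algebra)

sublocale TM: module B T
  by (rule T_module)

lemma T_smult_mult:
  "b \<in> carrier B \<Longrightarrow> u \<in> carrier T \<Longrightarrow> v \<in> carrier T \<Longrightarrow> (b \<odot>\<^bsub>T\<^esub> u) \<otimes>\<^bsub>T\<^esub> v = b \<odot>\<^bsub>T\<^esub> (u \<otimes>\<^bsub>T\<^esub> v)"
  by (rule algebra.smult_assoc2[OF T_algebra])

text \<open>This is x \<otimes> 1, the left copy of \<open>x\<close>, whereas \<open>rho x\<close>
  is the right copy 1 \<otimes> x. The left copy also carries the B-module structure of
  \<open>T\<close> (\<open>smult_iota\<close>).\<close>

definition iota :: "'b \<Rightarrow> nat \<Rightarrow> 'b" where "iota x = x \<odot>\<^bsub>T\<^esub> \<one>\<^bsub>T\<^esub>"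

definition mu :: "(nat \<Rightarrow> 'b) \<Rightarrow> 'b" where "mu = ev (\<lambda>x. x)"

text \<open>The element 1 \<otimes> x - x \<otimes> 1, whose class modulo J^2 corresponds to the
  differential of \<open>x\<close>.\<close>

definition delta :: "'b \<Rightarrow> nat \<Rightarrow> 'b" where "delta x = rho x \<ominus>\<^bsub>T\<^esub> iota x"

lemma rho_hom: "ring_hom_cring B T rho"
proof (intro ring_hom_cring.intro ring_hom_cring_axioms.intro ring_hom_memI)
  fix x y assume xy: "x \<in> carrier B" "y \<in> carrier B"
  show "rho (x \<otimes> y) = rho x \<otimes>\<^bsub>T\<^esub> rho y"
    using xy by (simp add: tmult_rho fun_eq_iff ev_rho[OF A_linear_mult_right[OF A_linear_rho]])
qed (auto simp: rho_add B.cring_axioms T.cring_axioms)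

lemma mu_hom: "ring_hom_cring T B mu"
proof (intro ring_hom_cring.intro ring_hom_cring_axioms.intro ring_hom_memI)
  fix u v assume uv: "u \<in> carrier T" "v \<in> carrier T"
  then have u: "u \<in> carrier T0" and v: "v \<in> carrier T0" by auto
  note cl = T0_closed[OF u] T0_closed[OF v]
  have m: "mu w \<in> carrier B" if "w \<in> carrier T0" for w
    unfolding mu_def by (rule ev_closed[OF A_linear_id that])
  show "mu (u \<otimes>\<^bsub>T\<^esub> v) = mu u \<otimes> mu v"
  proof -
    have "mu (u \<otimes>\<^bsub>T\<^esub> v) = ev (\<lambda>x. ev (\<lambda>y. x \<otimes> y) v) u"
      unfolding mu_def T_simps by (rule ev_tmult[OF A_linear_id u v])
    also have "\<dots> = (\<Oplus>i\<in>{..<n}. u i \<otimes> (\<Oplus>j\<in>{..<n}. v j \<otimes> (e i \<otimes> e j)))"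
      by (simp add: ev_def)
    also have "\<dots> = (\<Oplus>i\<in>{..<n}. (u i \<otimes> e i) \<otimes> mu v)"
    proof (rule B.add.finprod_cong'[OF refl])
      fix i assume i: "i \<in> {..<n}"
      have "(\<Oplus>j\<in>{..<n}. v j \<otimes> (e i \<otimes> e j)) = (\<Oplus>j\<in>{..<n}. e i \<otimes> (v j \<otimes> e j))"
        by (rule B.add.finprod_cong') (use i cl in \<open>auto intro: B.m_lcomm\<close>)
      also have "\<dots> = e i \<otimes> mu v"
        unfolding mu_def ev_def by (rule B.finsum_rdistr[symmetric]) (use i cl in auto)
      finally show "u i \<otimes> (\<Oplus>j\<in>{..<n}. v j \<otimes> (e i \<otimes> e j)) = (u i \<otimes> e i) \<otimes> mu v"
        using i cl m[OF v] by (simp add: B.m_assoc)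
    qed (use cl m[OF v] in auto)
    also have "\<dots> = mu u \<otimes> mu v"
    proof -
      have "mu u = (\<Oplus>i\<in>{..<n}. u i \<otimes> e i)" by (simp add: mu_def ev_def)
      then show ?thesis by (simp only:, intro B.finsum_ldistr[symmetric]) (use cl m[OF v] in auto)
    qed
    finally show ?thesis .
  qed
  show "mu (u \<oplus>\<^bsub>T\<^esub> v) = mu u \<oplus> mu v"
    using u v by (simp add: mu_def ev_add A_linear_id)
  show "mu u \<in> carrier B" by (rule m[OF u])
qed (auto simp: mu_def ev_rho A_linear_id B.cring_axioms T.cring_axioms)

declare T_simps [simp del]

text \<open>Excludes \<open>\<one>\<^bsub>T\<^esub> = rho \<one>\<close>, which would loop against \<open>rho.hom_one\<close>.\<close>

lemmas T_ops = T_simps(1,2,4-6)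

sublocale rho: ring_hom_cring B T rho
  by (rule rho_hom)

sublocale mu: ring_hom_cring T B mu
  by (rule mu_hom)

lemma mu_smult: "b \<in> carrier B \<Longrightarrow> u \<in> carrier T \<Longrightarrow> mu (b \<odot>\<^bsub>T\<^esub> u) = b \<otimes> mu u"
  by (simp add: mu_def ev_smult A_linear_id T_ops)

lemma mu_rho: "x \<in> carrier B \<Longrightarrow> mu (rho x) = x"
  unfolding mu_def by (rule ev_rho[OF A_linear_id])

lemma rho_smult:
  assumes "a \<in> carrier A" "x \<in> carrier B"
  shows "rho (a \<odot> x) = \<alpha> a \<odot>\<^bsub>T\<^esub> rho x"
  using assms by (simp add: smult_eq rho_alpha fun_eq_iff T_ops del: rho.hom_mult)

lemma T_expand:
  assumes "u \<in> carrier T"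
  shows "(\<Oplus>\<^bsub>T\<^esub>i\<in>{..<n}. u i \<odot>\<^bsub>T\<^esub> rho (e i)) = u"
proof
  fix k
  have u: "u i \<in> carrier B" for i using T0_closed assms by (simp add: T_ops)
  have "(\<lambda>i. u i \<odot>\<^bsub>T0\<^esub> rho (e i)) \<in> {..<n} \<rightarrow> carrier T0"
    using u by (intro funcsetI module.smult_closed[OF B.free_module_module] rho_T0) auto
  from B.free_module_finsum_apply[OF this]
  have "(\<Oplus>\<^bsub>T\<^esub>i\<in>{..<n}. u i \<odot>\<^bsub>T\<^esub> rho (e i)) k = (\<Oplus>i\<in>{..<n}. u i \<otimes> rho (e i) k)"
    unfolding T_def finsum_ring_update by simp
  also have "\<dots> = u k"
    using ev_coordinate[of u k] assms by (simp add: ev_def T_ops)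
  finally show "(\<Oplus>\<^bsub>T\<^esub>i\<in>{..<n}. u i \<odot>\<^bsub>T\<^esub> rho (e i)) k = u k" .
qed

lemma T_coordinate: "u \<in> carrier T \<Longrightarrow> u i \<in> carrier B"
  using T0_closed by (simp add: T_ops)

lemma iota_hom: "ring_hom_cring B T iota"
proof (intro ring_hom_cring.intro ring_hom_cring_axioms.intro ring_hom_memI)
  fix x y assume xy: "x \<in> carrier B" "y \<in> carrier B"
  then show "iota (x \<otimes> y) = iota x \<otimes>\<^bsub>T\<^esub> iota y"
    by (simp add: iota_def T_smult_mult TM.smult_assoc1)
qed (auto simp: iota_def TM.smult_l_distr B.cring_axioms T.cring_axioms)

sublocale iota: ring_hom_cring B T iota
  by (rule iota_hom)

lemma smult_iota: "b \<in> carrier B \<Longrightarrow> u \<in> carrier T \<Longrightarrow> b \<odot>\<^bsub>T\<^esub> u = iota b \<otimes>\<^bsub>T\<^esub> u"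
  by (simp add: iota_def T_smult_mult)

lemma mu_iota: "x \<in> carrier B \<Longrightarrow> mu (iota x) = x"
  by (simp add: iota_def mu_smult)

text \<open>Scalars of A pass across the tensor sign.\<close>

lemma rho_alpha_iota: "a \<in> carrier A \<Longrightarrow> rho (\<alpha> a) = iota (\<alpha> a)"
  using rho_smult[of a \<one>] by (simp add: iota_def \<alpha>_def)

lemma delta_closed [simp]: "x \<in> carrier B \<Longrightarrow> delta x \<in> carrier T"
  by (simp add: delta_def)

lemma mu_delta: "x \<in> carrier B \<Longrightarrow> mu (delta x) = \<zero>"
  by (simp add: delta_def a_minus_def mu_rho mu_iota B.r_neg)

lemma delta_add: "x \<in> carrier B \<Longrightarrow> y \<in> carrier B \<Longrightarrow> delta (x \<oplus> y) = delta x \<oplus>\<^bsub>T\<^esub> delta y"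
  by (simp add: delta_def a_minus_def T.minus_add T.a_ac)

lemma delta_smult:
  "a \<in> carrier A \<Longrightarrow> x \<in> carrier B \<Longrightarrow> delta (a \<odot> x) = (a \<odot> \<one>) \<odot>\<^bsub>T\<^esub> delta x"
  by (simp add: delta_def smult_eq smult_iota rho_alpha_iota a_minus_def T.r_distr T.r_minus)

text \<open>The defect from the Leibniz rule is the product of \<open>delta x\<close> and
  \<open>delta y\<close>, which lies in J^2; so \<open>delta\<close> is a derivation modulo
  J^2.\<close>

lemma delta_mult:
  assumes "x \<in> carrier B" "y \<in> carrier B"
  shows "delta (x \<otimes> y) = x \<odot>\<^bsub>T\<^esub> delta y \<oplus>\<^bsub>T\<^esub> y \<odot>\<^bsub>T\<^esub> delta x \<oplus>\<^bsub>T\<^esub> delta x \<otimes>\<^bsub>T\<^esub> delta y"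
proof -
  define r s i j where "r = rho x" "s = rho y" "i = iota x" "j = iota y"
  have c: "r \<in> carrier T" "s \<in> carrier T" "i \<in> carrier T" "j \<in> carrier T"
    using assms by (auto simp: r_s_i_j_def)
  have "r \<otimes>\<^bsub>T\<^esub> s \<ominus>\<^bsub>T\<^esub> i \<otimes>\<^bsub>T\<^esub> j = i \<otimes>\<^bsub>T\<^esub> (s \<ominus>\<^bsub>T\<^esub> j) \<oplus>\<^bsub>T\<^esub> j \<otimes>\<^bsub>T\<^esub> (r \<ominus>\<^bsub>T\<^esub> i) \<oplus>\<^bsub>T\<^esub> (r \<ominus>\<^bsub>T\<^esub> i) \<otimes>\<^bsub>T\<^esub> (s \<ominus>\<^bsub>T\<^esub> j)"
    using c by algebra
  then show ?thesis using assms by (simp add: delta_def smult_iota r_s_i_j_def)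
qed

section \<open>The kernel J and its square\<close>

definition J :: "(nat \<Rightarrow> 'b) set" where "J = {z \<in> carrier T. mu z = \<zero>}"

text \<open>The ideal J^2, described by sums of exactly \<open>n\<close> terms whose second factors
  are the generators \<open>delta (e l)\<close> of J (\<open>J_expand\<close>). The fixed length
  supplies at once the coefficient matrix for Nakayama.\<close>

definition J2 :: "(nat \<Rightarrow> 'b) set" where
  "J2 = {\<Oplus>\<^bsub>T\<^esub>l\<in>{..<n}. k l \<otimes>\<^bsub>T\<^esub> delta (e l) | k. k \<in> {..<n} \<rightarrow> J}"

lemma J_closed: "z \<in> J \<Longrightarrow> z \<in> carrier T"
  by (simp add: J_def)

lemma J_submodule: "submodule J B T"
  by (rule TM.submoduleI) (auto simp: J_def mu_smult)

lemma J_mult: "z \<in> J \<Longrightarrow> u \<in> carrier T \<Longrightarrow> z \<otimes>\<^bsub>T\<^esub> u \<in> J"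
  by (simp add: J_def)

lemma delta_J: "x \<in> carrier B \<Longrightarrow> delta x \<in> J"
  by (simp add: J_def mu_delta)

text \<open>In the expansion of \<open>z\<close>, replace 1 \<otimes> \<open>e l\<close> by
  \<open>delta (e l)\<close> plus \<open>e l\<close> \<otimes> 1. The second terms add up to
  \<open>mu z\<close> \<otimes> 1, which vanishes on J. So the \<open>delta (e l)\<close> generate
  J, even with coefficients from the left copy of B.\<close>

lemma J_expand:
  assumes z: "z \<in> J"
  shows "(\<Oplus>\<^bsub>T\<^esub>l\<in>{..<n}. iota (z l) \<otimes>\<^bsub>T\<^esub> delta (e l)) = z"
proof -
  have zT: "z \<in> carrier T" and mz: "mu z = \<zero>" using z by (auto simp: J_def)
  note zc = T_coordinate[OF zT]
  have d: "iota (z l) \<otimes>\<^bsub>T\<^esub> delta (e l) \<in> carrier T" if "l < n" for l using that zc by simp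
  have "z = (\<Oplus>\<^bsub>T\<^esub>l\<in>{..<n}. z l \<odot>\<^bsub>T\<^esub> rho (e l))" by (rule T_expand[OF zT, symmetric])
  also have "\<dots> = (\<Oplus>\<^bsub>T\<^esub>l\<in>{..<n}. iota (z l) \<otimes>\<^bsub>T\<^esub> delta (e l) \<oplus>\<^bsub>T\<^esub> iota (z l \<otimes> e l))"
  proof (rule T.add.finprod_cong'[OF refl])
    fix l assume "l \<in> {..<n}"
    then have c: "iota (z l) \<in> carrier T" "rho (e l) \<in> carrier T" "iota (e l) \<in> carrier T" "z l \<in> carrier B" "e l \<in> carrier B"
      using zc by auto
    have "iota (z l) \<otimes>\<^bsub>T\<^esub> rho (e l) = iota (z l) \<otimes>\<^bsub>T\<^esub> (rho (e l) \<ominus>\<^bsub>T\<^esub> iota (e l)) \<oplus>\<^bsub>T\<^esub> iota (z l) \<otimes>\<^bsub>T\<^esub> iota (e l)"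
      using c(1-3) by algebra
    then show "z l \<odot>\<^bsub>T\<^esub> rho (e l) = iota (z l) \<otimes>\<^bsub>T\<^esub> delta (e l) \<oplus>\<^bsub>T\<^esub> iota (z l \<otimes> e l)"
      using c by (simp add: smult_iota delta_def)
  qed (use zc in auto)
  also have "\<dots> = (\<Oplus>\<^bsub>T\<^esub>l\<in>{..<n}. iota (z l) \<otimes>\<^bsub>T\<^esub> delta (e l)) \<oplus>\<^bsub>T\<^esub> (\<Oplus>\<^bsub>T\<^esub>l\<in>{..<n}. iota (z l \<otimes> e l))"
    by (rule T.finsum_addf) (use zc in auto)
  also have "(\<Oplus>\<^bsub>T\<^esub>l\<in>{..<n}. iota (z l \<otimes> e l)) = iota (\<Oplus>l\<in>{..<n}. z l \<otimes> e l)"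
    by (subst iota.hom_finsum) (use zc in \<open>auto simp: o_def\<close>)
  also have "(\<Oplus>l\<in>{..<n}. z l \<otimes> e l) = \<zero>"
    using mz by (simp add: mu_def ev_def)
  finally have "(\<Oplus>\<^bsub>T\<^esub>l\<in>{..<n}. iota (z l) \<otimes>\<^bsub>T\<^esub> delta (e l)) \<oplus>\<^bsub>T\<^esub> iota \<zero> = z" by (rule sym)
  moreover have "(\<Oplus>\<^bsub>T\<^esub>l\<in>{..<n}. iota (z l) \<otimes>\<^bsub>T\<^esub> delta (e l)) \<in> carrier T"
    using d by (intro T.finsum_closed) auto
  ultimately show ?thesis by (simp only: iota.hom_zero T.r_zero)
qed

lemma J2_mult:
  assumes x: "x \<in> J" and y: "y \<in> J"
  shows "x \<otimes>\<^bsub>T\<^esub> y \<in> J2"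
proof -
  note c = J_closed[OF x] T_coordinate[OF J_closed[OF y]]
  have "x \<otimes>\<^bsub>T\<^esub> y = x \<otimes>\<^bsub>T\<^esub> (\<Oplus>\<^bsub>T\<^esub>l\<in>{..<n}. iota (y l) \<otimes>\<^bsub>T\<^esub> delta (e l))"
    by (simp add: J_expand[OF y])
  also have "\<dots> = (\<Oplus>\<^bsub>T\<^esub>l\<in>{..<n}. x \<otimes>\<^bsub>T\<^esub> (iota (y l) \<otimes>\<^bsub>T\<^esub> delta (e l)))"
    by (rule T.finsum_rdistr) (use c in auto)
  also have "\<dots> = (\<Oplus>\<^bsub>T\<^esub>l\<in>{..<n}. (x \<otimes>\<^bsub>T\<^esub> iota (y l)) \<otimes>\<^bsub>T\<^esub> delta (e l))"
    by (rule T.add.finprod_cong') (use c in \<open>auto simp: T.m_assoc\<close>)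
  finally show ?thesis
    unfolding J2_def
    by (intro CollectI exI[of _ "\<lambda>l. x \<otimes>\<^bsub>T\<^esub> iota (y l)"] conjI) (use J_mult[OF x] c in auto)
qed

lemma J2_submodule: "submodule J2 B T"
proof (rule TM.submoduleI)
  have d: "k \<in> {..<n} \<rightarrow> J \<Longrightarrow> (\<lambda>l. k l \<otimes>\<^bsub>T\<^esub> delta (e l)) \<in> {..<n} \<rightarrow> carrier T" for k
    using J_closed by (auto simp: Pi_iff)
  show sub: "J2 \<subseteq> carrier T" unfolding J2_def using d by (auto intro!: T.finsum_closed)
  have zJ: "\<zero>\<^bsub>T\<^esub> \<in> J" by (simp add: J_def)
  have "(\<Oplus>\<^bsub>T\<^esub>l\<in>{..<n}. \<zero>\<^bsub>T\<^esub> \<otimes>\<^bsub>T\<^esub> delta (e l)) = \<zero>\<^bsub>T\<^esub>"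
    by (rule T.add.finprod_one_eqI) auto
  then show "\<zero>\<^bsub>T\<^esub> \<in> J2" unfolding J2_def using zJ by (auto intro!: exI[of _ "\<lambda>_. \<zero>\<^bsub>T\<^esub>"])
  show sm: "b \<odot>\<^bsub>T\<^esub> x \<in> J2" if bx: "b \<in> carrier B" "x \<in> J2" for b x
  proof -
    obtain k where k: "k \<in> {..<n} \<rightarrow> J" and x: "x = (\<Oplus>\<^bsub>T\<^esub>l\<in>{..<n}. k l \<otimes>\<^bsub>T\<^esub> delta (e l))"
      using bx by (auto simp: J2_def)
    have kc: "\<And>l. l < n \<Longrightarrow> k l \<in> carrier T" using k J_closed by (auto simp: Pi_iff)
    have "b \<odot>\<^bsub>T\<^esub> x = (\<Oplus>\<^bsub>T\<^esub>l\<in>{..<n}. b \<odot>\<^bsub>T\<^esub> (k l \<otimes>\<^bsub>T\<^esub> delta (e l)))"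
      unfolding x by (rule TM.finsum_smult_ldistr) (use bx d[OF k] in auto)
    also have "\<dots> = (\<Oplus>\<^bsub>T\<^esub>l\<in>{..<n}. (b \<odot>\<^bsub>T\<^esub> k l) \<otimes>\<^bsub>T\<^esub> delta (e l))"
      by (rule T.add.finprod_cong') (use kc bx in \<open>auto simp: T_smult_mult\<close>)
    finally show ?thesis
      unfolding J2_def
      by (intro CollectI exI[of _ "\<lambda>l. b \<odot>\<^bsub>T\<^esub> k l"] conjI)
         (use TM.submoduleE(4)[OF J_submodule bx(1)] k in \<open>auto simp: Pi_iff\<close>)
  qed
  show "\<ominus>\<^bsub>T\<^esub> x \<in> J2" if "x \<in> J2" for x
    using sm[of "\<ominus> \<one>" x] that sub by (simp add: TM.smult_l_minus subset_iff)
  show "x \<oplus>\<^bsub>T\<^esub> y \<in> J2" if xy: "x \<in> J2" "y \<in> J2" for x y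
  proof -
    obtain k where k: "k \<in> {..<n} \<rightarrow> J" and x: "x = (\<Oplus>\<^bsub>T\<^esub>l\<in>{..<n}. k l \<otimes>\<^bsub>T\<^esub> delta (e l))"
      using xy by (auto simp: J2_def)
    obtain k' where k': "k' \<in> {..<n} \<rightarrow> J" and y: "y = (\<Oplus>\<^bsub>T\<^esub>l\<in>{..<n}. k' l \<otimes>\<^bsub>T\<^esub> delta (e l))"
      using xy by (auto simp: J2_def)
    have kc: "\<And>l. l < n \<Longrightarrow> k l \<in> carrier T" "\<And>l. l < n \<Longrightarrow> k' l \<in> carrier T" using k k' J_closed by (auto simp: Pi_iff)
    have "x \<oplus>\<^bsub>T\<^esub> y = (\<Oplus>\<^bsub>T\<^esub>l\<in>{..<n}. k l \<otimes>\<^bsub>T\<^esub> delta (e l) \<oplus>\<^bsub>T\<^esub> k' l \<otimes>\<^bsub>T\<^esub> delta (e l))"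
      unfolding x y by (rule T.finsum_addf[symmetric]) (use d k k' in auto)
    also have "\<dots> = (\<Oplus>\<^bsub>T\<^esub>l\<in>{..<n}. (k l \<oplus>\<^bsub>T\<^esub> k' l) \<otimes>\<^bsub>T\<^esub> delta (e l))"
      by (rule T.add.finprod_cong') (use kc in \<open>auto simp: T.l_distr\<close>)
    finally show ?thesis
      unfolding J2_def
      by (intro CollectI exI[of _ "\<lambda>l. k l \<oplus>\<^bsub>T\<^esub> k' l"] conjI)
         (use TM.submoduleE(5)[OF J_submodule] k k' in \<open>auto simp: Pi_iff\<close>)
  qed
qed

end

section \<open>A finite presentation of the differentials\<close>

context free_algebra
begin

section \<open>The module of differentials and its universal derivation\<close>

abbreviation F :: "('b, 'b \<Rightarrow> 'b) module" where "F \<equiv> free_module B (carrier B)"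

definition N :: "('b \<Rightarrow> 'b) set" where "N = submodule_gen B F (kaehler_relations A B)"

abbreviation \<Omega> :: "('b, ('b \<Rightarrow> 'b) set) module" where "\<Omega> \<equiv> quot_module F N"

lemma kaehler_eq: "kaehler A B = \<Omega>"
  by (simp add: kaehler_def N_def Let_def)

sublocale FM: module B F
  by (rule B.free_module_module)

lemma free_gen_F [simp]: "x \<in> carrier B \<Longrightarrow> free_gen B x \<in> carrier F"
  by (rule B.free_gen_closed)

lemma kaehler_relations_closed: "kaehler_relations A B \<subseteq> carrier F"
  unfolding kaehler_relations_def Let_def
  by (auto simp del: free_module_simps intro!: FM.M.minus_closed FM.M.a_closed FM.smult_closed)

lemma N_submodule: "submodule N B F"
  unfolding N_def by (rule FM.submodule_gen_submodule[OF kaehler_relations_closed])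

sublocale OM: module B \<Omega>
  by (rule quotient_module.quot_module_module)
     (intro quotient_module.intro quotient_module_axioms.intro FM.module_axioms N_submodule)

sublocale K: quotient_module B F N
  by (intro quotient_module.intro quotient_module_axioms.intro FM.module_axioms N_submodule)

declare K.quot_simps [simp del] free_module_simps [simp del]

definition D :: "'b \<Rightarrow> ('b \<Rightarrow> 'b) set" where "D x = N +>\<^bsub>F\<^esub> free_gen B x"

lemma D_closed [simp]: "x \<in> carrier B \<Longrightarrow> D x \<in> carrier \<Omega>"
  by (simp add: D_def)

lemma relation_in_N: "r \<in> kaehler_relations A B \<Longrightarrow> r \<in> N"
  unfolding N_def using submodule_gen_superset by (rule subsetD)

lemma D_add:
  assumes "x \<in> carrier B" "y \<in> carrier B"
  shows "D (x \<oplus> y) = D x \<oplus>\<^bsub>\<Omega>\<^esub> D y"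
proof -
  have "free_gen B (x \<oplus> y) \<ominus>\<^bsub>F\<^esub> (free_gen B x \<oplus>\<^bsub>F\<^esub> free_gen B y) \<in> N"
    by (rule relation_in_N) (use assms in \<open>auto simp: kaehler_relations_def Let_def\<close>)
  then have "N +>\<^bsub>F\<^esub> free_gen B (x \<oplus> y) = N +>\<^bsub>F\<^esub> (free_gen B x \<oplus>\<^bsub>F\<^esub> free_gen B y)"
    by (subst K.proj_eq_iff) (use assms in auto)
  then show ?thesis using assms by (simp add: D_def)
qed

lemma D_smult:
  assumes "a \<in> carrier A" "x \<in> carrier B"
  shows "D (a \<odot> x) = \<alpha> a \<odot>\<^bsub>\<Omega>\<^esub> D x"
proof -
  have "free_gen B (a \<odot> x) \<ominus>\<^bsub>F\<^esub> ((a \<odot> \<one>) \<odot>\<^bsub>F\<^esub> free_gen B x) \<in> N"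
    by (rule relation_in_N) (use assms in \<open>auto simp: kaehler_relations_def Let_def\<close>)
  then have "N +>\<^bsub>F\<^esub> free_gen B (a \<odot> x) = N +>\<^bsub>F\<^esub> (\<alpha> a \<odot>\<^bsub>F\<^esub> free_gen B x)"
    by (subst K.proj_eq_iff) (use assms in \<open>auto simp: \<alpha>_def\<close>)
  then show ?thesis using assms by (simp add: D_def)
qed

lemma D_mult:
  assumes "x \<in> carrier B" "y \<in> carrier B"
  shows "D (x \<otimes> y) = x \<odot>\<^bsub>\<Omega>\<^esub> D y \<oplus>\<^bsub>\<Omega>\<^esub> y \<odot>\<^bsub>\<Omega>\<^esub> D x"
proof -
  have "free_gen B (x \<otimes> y) \<ominus>\<^bsub>F\<^esub> (x \<odot>\<^bsub>F\<^esub> free_gen B y \<oplus>\<^bsub>F\<^esub> y \<odot>\<^bsub>F\<^esub> free_gen B x) \<in> N"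
    by (rule relation_in_N) (use assms in \<open>auto simp: kaehler_relations_def Let_def\<close>)
  then have "N +>\<^bsub>F\<^esub> free_gen B (x \<otimes> y) = N +>\<^bsub>F\<^esub> (x \<odot>\<^bsub>F\<^esub> free_gen B y \<oplus>\<^bsub>F\<^esub> y \<odot>\<^bsub>F\<^esub> free_gen B x)"
    by (subst K.proj_eq_iff) (use assms in auto)
  then show ?thesis using assms by (simp add: D_def)
qed

lemma D_zero: "D \<zero> = \<zero>\<^bsub>\<Omega>\<^esub>"
  using D_smult[of "\<zero>\<^bsub>A\<^esub>" \<zero>] by simp

lemma D_expand:
  assumes x: "x \<in> carrier B"
  shows "lin_comb \<Omega> n (rho x) (\<lambda>k. D (e k)) = D x"
proof -
  have "D x = D (\<Oplus>k\<in>{..<n}. co x k \<odot> e k)"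
    using co_props(2)[OF x] by (simp add: lin_comb_def)
  also have "\<dots> = (\<Oplus>\<^bsub>\<Omega>\<^esub>k\<in>{..<n}. D (co x k \<odot> e k))"
    by (rule finsum_additive[where h = D and G = B])
       (use x in \<open>auto simp: D_add D_zero B.abelian_monoid_axioms OM.M.abelian_monoid_axioms\<close>)
  also have "\<dots> = lin_comb \<Omega> n (rho x) (\<lambda>k. D (e k))"
    unfolding lin_comb_def
    by (rule OM.M.add.finprod_cong') (use x in \<open>auto simp: D_smult rho_def\<close>)
  finally show ?thesis ..
qed

lemma linear_ext:
  assumes "module B M" "h \<in> carrier B \<rightarrow> carrier M"
  shows "linear_hom B F M (lin_ext B M h)"
  using assms by (intro linear_hom.intro linear_hom_axioms.intro FM.module_axioms module.lin_ext_linear)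

text \<open>Reduces statements about A-linear expressions to basis elements, by building up the
  expansion of \<open>x\<close> term by term.\<close>

lemma basis_induct [consumes 1, case_names basis zero add smult]:
  assumes x: "x \<in> carrier B"
    and "\<And>i. i < n \<Longrightarrow> Q (e i)" "Q \<zero>"
    and "\<And>x y. x \<in> carrier B \<Longrightarrow> y \<in> carrier B \<Longrightarrow> Q x \<Longrightarrow> Q y \<Longrightarrow> Q (x \<oplus> y)"
    and "\<And>a x. a \<in> carrier A \<Longrightarrow> x \<in> carrier B \<Longrightarrow> Q x \<Longrightarrow> Q (\<alpha> a \<otimes> x)"
  shows "Q x"
proof -
  have "Q (\<Oplus>i\<in>I. rho x i \<otimes> e i)" if "finite I" "I \<subseteq> {..<n}" for I
    using that
  proof (induction I)
    case (insert i I)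
    then have "(\<Oplus>i\<in>insert i I. rho x i \<otimes> e i) = rho x i \<otimes> e i \<oplus> (\<Oplus>i\<in>I. rho x i \<otimes> e i)"
      using x by (intro B.finsum_insert) auto
    moreover have "Q (rho x i \<otimes> e i)"
      using insert.prems x assms(2,5) by (auto simp: rho_def)
    moreover have "rho x i \<otimes> e i \<in> carrier B" "(\<Oplus>i\<in>I. rho x i \<otimes> e i) \<in> carrier B"
      using insert.prems x by (auto intro!: B.finsum_closed)
    ultimately show ?case
      using insert assms(4) by auto
  qed (simp add: assms(3))
  from this[of "{..<n}"] show ?thesis using x by (simp add: rho_expand)
qed

text \<open>Row vector of the relation \<open>d(xy) = x dy + y dx\<close> in the generators \<open>d e\<^sub>0, \<dots>, d e\<^bsub>n-1\<^esub>\<close>, using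
  that \<open>rho x\<close> is the row vector of \<open>d x\<close>.\<close>

definition leibniz :: "'b \<Rightarrow> 'b \<Rightarrow> nat \<Rightarrow> 'b" where
  "leibniz x y = rho (x \<otimes> y) \<ominus>\<^bsub>T\<^esub> (x \<odot>\<^bsub>T\<^esub> rho y \<oplus>\<^bsub>T\<^esub> y \<odot>\<^bsub>T\<^esub> rho x)"

lemma leibniz_closed [simp]:
  "x \<in> carrier B \<Longrightarrow> y \<in> carrier B \<Longrightarrow> leibniz x y \<in> carrier T"
  by (simp add: leibniz_def)

text \<open>With scalars turned into elements of \<open>T\<close>, the linearity properties of
  \<open>leibniz\<close> become identities in a commutative ring.\<close>

lemma leibniz_iota:
  assumes "x \<in> carrier B" "y \<in> carrier B"
  shows "leibniz x y = rho x \<otimes>\<^bsub>T\<^esub> rho y \<ominus>\<^bsub>T\<^esub> (iota x \<otimes>\<^bsub>T\<^esub> rho y \<oplus>\<^bsub>T\<^esub> iota y \<otimes>\<^bsub>T\<^esub> rho x)"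
  using assms by (simp add: leibniz_def smult_iota)

lemma leibniz_comm: "x \<in> carrier B \<Longrightarrow> y \<in> carrier B \<Longrightarrow> leibniz x y = leibniz y x"
  by (simp add: leibniz_def B.m_comm T.a_comm del: rho.hom_mult)

lemma leibniz_add:
  assumes "x \<in> carrier B" "x' \<in> carrier B" "y \<in> carrier B"
  shows "leibniz (x \<oplus> x') y = leibniz x y \<oplus>\<^bsub>T\<^esub> leibniz x' y"
proof -
  define r r' s i i' j where "r = rho x" "r' = rho x'" "s = rho y" "i = iota x" "i' = iota x'" "j = iota y"
  note defs = this
  have c: "r \<in> carrier T" "r' \<in> carrier T" "s \<in> carrier T" "i \<in> carrier T" "i' \<in> carrier T" "j \<in> carrier T"
    using assms by (auto simp: defs)
  have "(r \<oplus>\<^bsub>T\<^esub> r') \<otimes>\<^bsub>T\<^esub> s \<ominus>\<^bsub>T\<^esub> ((i \<oplus>\<^bsub>T\<^esub> i') \<otimes>\<^bsub>T\<^esub> s \<oplus>\<^bsub>T\<^esub> j \<otimes>\<^bsub>T\<^esub> (r \<oplus>\<^bsub>T\<^esub> r')) =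
      (r \<otimes>\<^bsub>T\<^esub> s \<ominus>\<^bsub>T\<^esub> (i \<otimes>\<^bsub>T\<^esub> s \<oplus>\<^bsub>T\<^esub> j \<otimes>\<^bsub>T\<^esub> r)) \<oplus>\<^bsub>T\<^esub> (r' \<otimes>\<^bsub>T\<^esub> s \<ominus>\<^bsub>T\<^esub> (i' \<otimes>\<^bsub>T\<^esub> s \<oplus>\<^bsub>T\<^esub> j \<otimes>\<^bsub>T\<^esub> r'))"
    using c by algebra
  then show ?thesis using assms by (simp add: leibniz_iota defs)
qed

lemma leibniz_smult:
  assumes "a \<in> carrier A" "x \<in> carrier B" "y \<in> carrier B"
  shows "leibniz (\<alpha> a \<otimes> x) y = \<alpha> a \<odot>\<^bsub>T\<^esub> leibniz x y"
proof -
  define k r s i j where "k = iota (\<alpha> a)" "r = rho x" "s = rho y" "i = iota x" "j = iota y"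
  note defs = this
  have c: "k \<in> carrier T" "r \<in> carrier T" "s \<in> carrier T" "i \<in> carrier T" "j \<in> carrier T"
    using assms by (auto simp: defs)
  have "(k \<otimes>\<^bsub>T\<^esub> r) \<otimes>\<^bsub>T\<^esub> s \<ominus>\<^bsub>T\<^esub> ((k \<otimes>\<^bsub>T\<^esub> i) \<otimes>\<^bsub>T\<^esub> s \<oplus>\<^bsub>T\<^esub> j \<otimes>\<^bsub>T\<^esub> (k \<otimes>\<^bsub>T\<^esub> r)) =
      k \<otimes>\<^bsub>T\<^esub> (r \<otimes>\<^bsub>T\<^esub> s \<ominus>\<^bsub>T\<^esub> (i \<otimes>\<^bsub>T\<^esub> s \<oplus>\<^bsub>T\<^esub> j \<otimes>\<^bsub>T\<^esub> r))"
    using c by algebra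
  then show ?thesis using assms by (simp add: leibniz_iota smult_iota rho_alpha_iota defs)
qed

text \<open>\<open>leibniz\<close> is symmetric and A-linear in each argument, so its values at
  pairs of basis elements span all others. This cuts the Leibniz relations of \<Omega> down to
  finitely many.\<close>

lemma leibniz_in_submodule:
  assumes V: "submodule V B T" and "\<And>i j. i < n \<Longrightarrow> j < n \<Longrightarrow> leibniz (e i) (e j) \<in> V"
    and x: "x \<in> carrier B" and y: "y \<in> carrier B"
  shows "leibniz x y \<in> V"
proof -
  note V' = TM.submodule_zero[OF V] TM.submoduleE(4,5)[OF V]
  have z: "leibniz \<zero> y = \<zero>\<^bsub>T\<^esub>" if "y \<in> carrier B" for y
    using leibniz_smult[of "\<zero>\<^bsub>A\<^esub>" \<zero> y] that by simp
  have *: "leibniz x (e j) \<in> V" if "j < n" for j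
    using x
    by (induction rule: basis_induct) (use assms(2) that V' in \<open>auto simp: z leibniz_add leibniz_smult\<close>)
  \<comment> \<open>The second argument is treated in the first slot, where linearity is available;
    symmetry swaps it back.\<close>
  have "leibniz y x \<in> V"
    using y
    by (induction rule: basis_induct)
       (use * x V' in \<open>auto simp: z leibniz_add leibniz_smult leibniz_comm[of "e _" x]\<close>)
  then show ?thesis using leibniz_comm[OF x y] by simp
qed

section \<open>The presentation matrix and the relations that it generates\<close>

lemma lin_comb_T_apply:
  assumes "u \<in> {..<k} \<rightarrow> carrier B" "P \<in> {..<k} \<rightarrow> carrier T"
  shows "lin_comb T k u P j = (\<Oplus>i\<in>{..<k}. u i \<otimes> P i j)"
proof -
  have eq: "u i \<odot>\<^bsub>T\<^esub> P i = u i \<odot>\<^bsub>T0\<^esub> P i" for i by (simp add: T_ops free_module_simps)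
  have "(\<lambda>i. u i \<odot>\<^bsub>T0\<^esub> P i) \<in> {..<k} \<rightarrow> carrier T0"
    using assms TM.smult_closed by (auto simp: T_ops eq[symmetric] simp flip: T_ops(1))
  from B.free_module_finsum_apply[OF this, of j]
  show ?thesis
    unfolding lin_comb_def eq unfolding T_def finsum_ring_update by (simp add: free_module_simps)
qed

text \<open>The row of the pair \<open>(p, q)\<close> has number \<open>p * n + q\<close>. There are
  no rows for the A-linearity of the differential, since this is already spent in representing
  \<open>d x\<close> by \<open>rho x\<close>.\<close>

definition kaehler_matrix :: "nat \<Rightarrow> nat \<Rightarrow> 'b" where
  "kaehler_matrix i = leibniz (e (i div n)) (e (i mod n))"

lemma div_mod_less: "i < n * n \<Longrightarrow> i div n < n \<and> i mod n < n"
  by (metis less_mult_imp_div_less mod_less_divisor mult_is_0 not_less_zero neq0_conv)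

lemma kaehler_matrix_closed: "kaehler_matrix \<in> {..<n*n} \<rightarrow> carrier T"
  using div_mod_less by (auto simp: kaehler_matrix_def)

text \<open>The surjection B^n \<rightarrow> \<Omega> of the presentation, with \<open>T\<close> in
  the role of B^n; its kernel is to be generated by the rows of
  \<open>kaehler_matrix\<close>.\<close>

definition lcD :: "(nat \<Rightarrow> 'b) \<Rightarrow> ('b \<Rightarrow> 'b) set" where
  "lcD c = lin_comb \<Omega> n c (\<lambda>k. D (e k))"

lemma lcD_linear: "linear_hom B T \<Omega> lcD"
proof (intro linear_hom.intro linear_hom_axioms.intro TM.module_axioms OM.module_axioms)
  have c: "u \<in> {..<n} \<rightarrow> carrier B" if "u \<in> carrier T" for u using T_coordinate[OF that] by auto
  have D: "(\<lambda>k. D (e k)) \<in> {..<n} \<rightarrow> carrier \<Omega>" by auto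
  show "linear_map B T \<Omega> lcD"
    using OM.lin_comb_add[OF c c D] OM.lin_comb_smult[OF _ c D] OM.lin_comb_closed[OF c D]
    by (auto simp: linear_map_def lcD_def T_ops(4,5))
qed

lemma lcD_leibniz:
  assumes "x \<in> carrier B" "y \<in> carrier B"
  shows "lcD (leibniz x y) = \<zero>\<^bsub>\<Omega>\<^esub>"
proof -
  interpret L: linear_hom B T \<Omega> lcD by (rule lcD_linear)
  have [simp]: "lcD (rho z) = D z" if "z \<in> carrier B" for z
    unfolding lcD_def by (rule D_expand[OF that])
  show ?thesis
    using assms by (simp add: leibniz_def D_mult a_minus_def OM.M.r_neg del: rho.hom_mult)
qed

text \<open>\<open>N\<close> is the smallest submodule containing the three families of relations
  and the preimage of \<open>V\<close> is a submodule, so testing the generators suffices. Applied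
  to \<open>rho\<close> with the row span as \<open>V\<close>, and to \<open>delta\<close> with
  \<open>J2\<close>.\<close>

lemma N_vimage:
  assumes M: "module B M" and h: "h \<in> carrier B \<rightarrow> carrier M" and V: "submodule V B M"
    and add: "\<And>x y. x \<in> carrier B \<Longrightarrow> y \<in> carrier B \<Longrightarrow> h (x \<oplus> y) \<ominus>\<^bsub>M\<^esub> (h x \<oplus>\<^bsub>M\<^esub> h y) \<in> V"
    and smult: "\<And>a x. a \<in> carrier A \<Longrightarrow> x \<in> carrier B \<Longrightarrow> h (a \<odot> x) \<ominus>\<^bsub>M\<^esub> (a \<odot> \<one>) \<odot>\<^bsub>M\<^esub> h x \<in> V"
    and mult: "\<And>x y. x \<in> carrier B \<Longrightarrow> y \<in> carrier B \<Longrightarrow>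
      h (x \<otimes> y) \<ominus>\<^bsub>M\<^esub> (x \<odot>\<^bsub>M\<^esub> h y \<oplus>\<^bsub>M\<^esub> y \<odot>\<^bsub>M\<^esub> h x) \<in> V"
    and f: "f \<in> N"
  shows "lin_ext B M h f \<in> V"
proof -
  interpret L: linear_hom B F M "lin_ext B M h" by (rule linear_ext[OF M h])
  have g: "lin_ext B M h (free_gen B x) = h x" if "x \<in> carrier B" for x
    by (rule L.N.lin_ext_gen[OF h that])
  have "kaehler_relations A B \<subseteq> {f \<in> carrier F. lin_ext B M h f \<in> V}"
    using kaehler_relations_closed
    unfolding kaehler_relations_def Let_def
    by (auto simp: g add smult mult)
  then have "N \<subseteq> {f \<in> carrier F. lin_ext B M h f \<in> V}"
    unfolding N_def by (intro FM.submodule_gen_minimal L.submodule_vimage V)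
  then show ?thesis using f by auto
qed

text \<open>The rows are relations by \<open>lcD_leibniz\<close>. Conversely, the linear extension
  of \<open>rho\<close> to \<open>F\<close> sends \<open>N\<close> into the row span, and it sends
  the combination of the symbols \<open>d (e k)\<close> with coefficients \<open>c\<close> to
  \<open>c\<close> itself. So a combination that vanishes in \<Omega> has its coefficients in the
  row span.\<close>

lemma kaehler_presentation:
  "presentation B \<Omega> n (\<lambda>k. D (e k)) (n * n) kaehler_matrix"
  unfolding presentation_def
proof (intro conjI allI impI ballI)
  let ?g = "\<lambda>k. D (e k)" and ?P = kaehler_matrix
  show "module B \<Omega>" by (rule OM.module_axioms)
  show g: "?g \<in> {..<n} \<rightarrow> carrier \<Omega>" by auto
  show "?P i j \<in> carrier B" if "i < n * n" "j < n" for i j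
    using kaehler_matrix_closed that by (intro T_coordinate) auto
  show "\<exists>c\<in>{..<n} \<rightarrow> carrier B. x = lin_comb \<Omega> n c ?g" if x: "x \<in> carrier \<Omega>" for x
  proof -
    let ?G = "{lin_comb \<Omega> n c ?g | c. c \<in> {..<n} \<rightarrow> carrier B}"
    have G: "submodule ?G B \<Omega>" by (rule OM.lin_combs_submodule[OF g])
    obtain f where f: "f \<in> carrier F" "x = N +>\<^bsub>F\<^esub> f" using K.proj_surj[OF x] by auto
    have supp: "finite {s. f s \<noteq> \<zero>}" "{s. f s \<noteq> \<zero>} \<subseteq> carrier B" and fc: "f s \<in> carrier B" for s
      using f(1) B.free_module_carrierD[OF f(1)] by (auto simp: carrier_free_module)
    have cl: "(\<lambda>s. f s \<odot>\<^bsub>F\<^esub> free_gen B s) \<in> {s. f s \<noteq> \<zero>} \<rightarrow> carrier F"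
      using supp fc by (intro funcsetI FM.smult_closed free_gen_F) auto
    \<comment> \<open>A representative is a finite combination of symbols \<open>d s\<close>, and
      the class of each symbol is a combination of the \<open>D (e k)\<close> by
      \<open>D_expand\<close>.\<close>
    have "x = N +>\<^bsub>F\<^esub> lin_ext B F (free_gen B) f"
      using B.free_module_decompose[OF f(1)] f(2) by simp
    also have "\<dots> = (\<Oplus>\<^bsub>\<Omega>\<^esub>s\<in>{s. f s \<noteq> \<zero>}. N +>\<^bsub>F\<^esub> (f s \<odot>\<^bsub>F\<^esub> free_gen B s))"
      unfolding lin_ext_def by (rule K.proj.finsum[OF cl])
    also have "\<dots> \<in> ?G"
    proof (rule OM.submodule_finsum[OF G])
      fix s assume "s \<in> {s. f s \<noteq> \<zero>}"
      then have s: "s \<in> carrier B" using supp by auto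
      have "D s \<in> ?G" using D_expand[OF s] s by (auto intro!: exI[of _ "rho s"])
      then have "f s \<odot>\<^bsub>\<Omega>\<^esub> D s \<in> ?G" by (rule OM.submoduleE(4)[OF G fc])
      then show "N +>\<^bsub>F\<^esub> (f s \<odot>\<^bsub>F\<^esub> free_gen B s) \<in> ?G" using s fc by (simp add: D_def)
    qed
    finally show ?thesis by blast
  qed
  fix c assume c: "c \<in> {..<n} \<rightarrow> carrier B"
  \<comment> \<open>A coefficient function in a presentation is arbitrary from index
    \<open>n\<close> on, while members of \<open>T\<close> vanish there.\<close>
  define c' where "c' j = (if j < n then c j else \<zero>)" for j
  have c': "c' \<in> carrier T"
    unfolding T_ops by (rule T0_I) (use c in \<open>auto simp: c'_def\<close>)
  let ?V = "{lin_comb T (n * n) u ?P | u. u \<in> {..<n*n} \<rightarrow> carrier B}"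
  note P = kaehler_matrix_closed
  have V: "submodule ?V B T" by (rule TM.lin_combs_submodule[OF P])
  have eq: "c' = lin_comb T (n * n) u ?P \<longleftrightarrow> (\<forall>j<n. c j = (\<Oplus>i\<in>{..<n*n}. u i \<otimes> ?P i j))"
    if u: "u \<in> {..<n*n} \<rightarrow> carrier B" for u
  proof -
    have lc: "lin_comb T (n * n) u ?P \<in> carrier T0" using TM.lin_comb_closed[OF u P] by (simp add: T_ops)
    show ?thesis
      using T0_zero[OF lc] lin_comb_T_apply[OF u P] by (auto simp: fun_eq_iff c'_def)
  qed
  interpret L: linear_hom B T \<Omega> lcD by (rule lcD_linear)
  have lc: "lcD c' = lin_comb \<Omega> n c ?g"
    unfolding lcD_def by (rule OM.lin_comb_cong) (use c in \<open>auto simp: c'_def\<close>)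
  have "lin_comb \<Omega> n c ?g = \<zero>\<^bsub>\<Omega>\<^esub> \<longleftrightarrow> c' \<in> ?V"
  proof
    assume "c' \<in> ?V"
    then obtain u where u: "u \<in> {..<n*n} \<rightarrow> carrier B" "c' = lin_comb T (n * n) u ?P" by auto
    have "lcD (?P i) = \<zero>\<^bsub>\<Omega>\<^esub>" if "i < n * n" for i
      using div_mod_less[OF that] by (simp add: kaehler_matrix_def lcD_leibniz)
    then have "lin_comb \<Omega> (n * n) u (\<lambda>i. lcD (?P i)) = \<zero>\<^bsub>\<Omega>\<^esub>"
      unfolding lin_comb_def using u(1) by (intro OM.M.add.finprod_one_eqI) (auto simp: Pi_iff)
    then show "lin_comb \<Omega> n c ?g = \<zero>\<^bsub>\<Omega>\<^esub>"
      unfolding lc[symmetric] u(2) L.lin_comb[OF u(1) P] .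
  next
    assume z: "lin_comb \<Omega> n c ?g = \<zero>\<^bsub>\<Omega>\<^esub>"
    define f where "f = lin_comb F n c (\<lambda>k. free_gen B (e k))"
    have gf: "(\<lambda>k. free_gen B (e k)) \<in> {..<n} \<rightarrow> carrier F" by auto
    have f: "f \<in> carrier F" unfolding f_def by (rule FM.lin_comb_closed[OF c gf])
    have "N +>\<^bsub>F\<^esub> f = \<zero>\<^bsub>\<Omega>\<^esub>"
      unfolding f_def K.proj.lin_comb[OF c gf] using z by (simp add: D_def)
    then have fN: "f \<in> N" using K.proj_zero_iff[OF f] by simp
    have rT: "rho \<in> carrier B \<rightarrow> carrier T" by auto
    interpret R: linear_hom B F T "lin_ext B T rho" by (rule linear_ext[OF TM.module_axioms rT])
    have z: "\<zero>\<^bsub>T\<^esub> \<in> ?V" by (rule TM.submodule_zero[OF V])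
    have basis: "leibniz (e p) (e q) \<in> ?V" if pq: "p < n" "q < n" for p q
    proof -
      have "p * n + q < Suc p * n" using pq by simp
      also have "\<dots> \<le> n * n" using pq by (intro mult_right_mono) auto
      finally have i: "p * n + q < n * n" .
      have "leibniz (e p) (e q) = ?P (p * n + q)" using pq by (simp add: kaehler_matrix_def)
      also have "\<dots> = lin_comb T (n * n) (\<lambda>j. if j = p * n + q then \<one> else \<zero>) ?P"
        by (rule TM.lin_comb_generator[OF P i, symmetric])
      finally show ?thesis by (auto intro!: exI[of _ "\<lambda>j. if j = p * n + q then \<one> else \<zero>"])
    qed
    have "lin_ext B T rho f \<in> ?V"
    proof (rule N_vimage[OF TM.module_axioms rT V _ _ _ fN])
      fix x y assume xy: "x \<in> carrier B" "y \<in> carrier B"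
      show "rho (x \<oplus> y) \<ominus>\<^bsub>T\<^esub> (rho x \<oplus>\<^bsub>T\<^esub> rho y) \<in> ?V"
        using z xy by (simp only: rho.hom_add) (simp only: a_minus_def T.r_neg rho.hom_closed T.a_closed)
      show "rho (x \<otimes> y) \<ominus>\<^bsub>T\<^esub> (x \<odot>\<^bsub>T\<^esub> rho y \<oplus>\<^bsub>T\<^esub> y \<odot>\<^bsub>T\<^esub> rho x) \<in> ?V"
        using leibniz_in_submodule[OF V basis xy] unfolding leibniz_def .
    next
      fix a x assume ax: "a \<in> carrier A" "x \<in> carrier B"
      have "rho (a \<odot> x) \<ominus>\<^bsub>T\<^esub> (a \<odot> \<one>) \<odot>\<^bsub>T\<^esub> rho x = \<zero>\<^bsub>T\<^esub>"
        unfolding rho_smult[OF ax] \<alpha>_def[symmetric] a_minus_def using ax by (intro T.r_neg) auto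
      then show "rho (a \<odot> x) \<ominus>\<^bsub>T\<^esub> (a \<odot> \<one>) \<odot>\<^bsub>T\<^esub> rho x \<in> ?V" using z by (simp only:)
    qed
    also have "lin_ext B T rho f = lin_comb T n c (\<lambda>k. lin_ext B T rho (free_gen B (e k)))"
      unfolding f_def by (rule R.lin_comb[OF c gf])
    also have "\<dots> = lin_comb T n c' (\<lambda>k. rho (e k))"
      by (rule TM.lin_comb_cong) (use c in \<open>auto simp: c'_def TM.lin_ext_gen[OF rT]\<close>)
    also have "\<dots> = c'"
      unfolding lin_comb_def by (rule T_expand[OF c'])
    finally show "c' \<in> ?V" .
  qed
  also have "\<dots> \<longleftrightarrow> (\<exists>u\<in>{..<n*n} \<rightarrow> carrier B. \<forall>j<n. c j = (\<Oplus>i\<in>{..<n*n}. u i \<otimes> ?P i j))"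
    using eq by blast
  finally show "lin_comb \<Omega> n c ?g = \<zero>\<^bsub>\<Omega>\<^esub> \<longleftrightarrow>
    (\<exists>u\<in>{..<n*n} \<rightarrow> carrier B. \<forall>j<n. c j = (\<Oplus>i\<in>{..<n*n}. u i \<otimes> ?P i j))" .
qed

end

section \<open>The Noether different\<close>

context free_algebra
begin

declare rho.hom_mult [simp del]

text \<open>The image of \<open>annJ\<close> under \<open>mu\<close> is the Noether different of \<open>B\<close> over \<open>A\<close>.\<close>

definition annJ :: "(nat \<Rightarrow> 'b) set" where
  "annJ = {w \<in> carrier T. \<forall>x\<in>carrier B. delta x \<otimes>\<^bsub>T\<^esub> w = \<zero>\<^bsub>T\<^esub>}"

lemma annJ_closed: "w \<in> annJ \<Longrightarrow> w \<in> carrier T"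
  by (simp add: annJ_def)

text \<open>Annihilating \<open>delta x\<close> means that 1 \<otimes> x and x \<otimes> 1 act alike
  on \<open>w\<close>; here coordinate \<open>k\<close> of the two products is compared.\<close>

lemma annJ_coordinate:
  assumes w: "w \<in> annJ" and x: "x \<in> carrier B"
  shows "(\<Oplus>i\<in>{..<n}. rho (x \<otimes> e i) k \<otimes> w i) = x \<otimes> w k"
proof -
  have wT: "w \<in> carrier T" using w by (rule annJ_closed)
  then have w0: "w \<in> carrier T0" by (simp add: T_ops)
  have c: "rho x \<in> carrier T" "iota x \<in> carrier T" using x by auto
  have "(rho x \<ominus>\<^bsub>T\<^esub> iota x) \<otimes>\<^bsub>T\<^esub> w = \<zero>\<^bsub>T\<^esub>"
    using w x by (simp add: annJ_def delta_def)
  then have "rho x \<otimes>\<^bsub>T\<^esub> w \<ominus>\<^bsub>T\<^esub> iota x \<otimes>\<^bsub>T\<^esub> w = \<zero>\<^bsub>T\<^esub>"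
    using c wT by (simp add: a_minus_def T.l_distr T.l_minus)
  then have eq: "rho x \<otimes>\<^bsub>T\<^esub> w = x \<odot>\<^bsub>T\<^esub> w"
    using c wT x by (simp add: smult_iota T.r_right_minus_eq)
  have "(\<Oplus>i\<in>{..<n}. rho (x \<otimes> e i) k \<otimes> w i) = ev (\<lambda>y. rho (x \<otimes> y) k) w"
    unfolding ev_def
    by (rule B.add.finprod_cong') (use x T0_closed[OF w0] in \<open>auto simp: B.m_comm\<close>)
  also have "\<dots> = (rho x \<otimes>\<^bsub>T\<^esub> w) k"
    using tmult_rho[OF x w0] by (simp add: T_ops)
  also have "\<dots> = x \<otimes> w k" unfolding eq by (simp add: T_ops)
  finally show ?thesis .
qed

section \<open>The trace formula and the discriminant\<close>

lemma alg_trace_eq: "alg_trace A B n e x = (\<Oplus>\<^bsub>A\<^esub>j\<in>{..<n}. co (x \<otimes> e j) j)"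
  by (simp add: alg_trace_def mat_trace_def mult_matrix_def)

lemma alg_trace_closed [simp]: "x \<in> carrier B \<Longrightarrow> alg_trace A B n e x \<in> carrier A"
  unfolding alg_trace_eq by (auto intro!: A.finsum_closed)

lemma alpha_alg_trace:
  assumes "x \<in> carrier B"
  shows "\<alpha> (alg_trace A B n e x) = (\<Oplus>j\<in>{..<n}. rho (x \<otimes> e j) j)"
  unfolding alg_trace_eq
  by (subst \<alpha>.hom_finsum) (use assms in \<open>auto simp: rho_def intro!: B.add.finprod_cong'\<close>)

text \<open>The trace of \<open>e i x\<close> is the sum over \<open>j\<close> of coordinate
  \<open>j\<close> of \<open>e i x e j\<close>. After exchanging the sums,
  \<open>annJ_coordinate\<close> for \<open>x e j\<close> at \<open>k = j\<close> turns the inner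
  sum into \<open>x e j w j\<close>, and these add up to \<open>mu w\<close> times
  \<open>x\<close>.\<close>

lemma annJ_trace:
  assumes w: "w \<in> annJ" and x: "x \<in> carrier B"
  shows "(\<Oplus>i\<in>{..<n}. alg_trace A B n e (e i \<otimes> x) \<odot> w i) = mu w \<otimes> x"
proof -
  have wc: "w i \<in> carrier B" for i using T_coordinate[OF annJ_closed[OF w]] .
  have rc: "rho (e i \<otimes> x \<otimes> e j) k \<in> carrier B" if "i < n" "j < n" for i j k using that x by simp
  have "(\<Oplus>i\<in>{..<n}. alg_trace A B n e (e i \<otimes> x) \<odot> w i) =
      (\<Oplus>i\<in>{..<n}. \<Oplus>j\<in>{..<n}. rho (e i \<otimes> x \<otimes> e j) j \<otimes> w i)"
  proof (rule B.add.finprod_cong'[OF refl])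
    fix i assume i: "i \<in> {..<n}"
    then have "alg_trace A B n e (e i \<otimes> x) \<odot> w i = (\<Oplus>j\<in>{..<n}. rho (e i \<otimes> x \<otimes> e j) j) \<otimes> w i"
      using x wc by (simp add: smult_eq alpha_alg_trace)
    also have "\<dots> = (\<Oplus>j\<in>{..<n}. rho (e i \<otimes> x \<otimes> e j) j \<otimes> w i)"
      by (rule B.finsum_ldistr) (use i x wc in auto)
    finally show "alg_trace A B n e (e i \<otimes> x) \<odot> w i = (\<Oplus>j\<in>{..<n}. rho (e i \<otimes> x \<otimes> e j) j \<otimes> w i)" .
  qed (use rc wc in \<open>auto intro!: B.finsum_closed\<close>)
  also have "\<dots> = (\<Oplus>j\<in>{..<n}. \<Oplus>i\<in>{..<n}. rho (e i \<otimes> x \<otimes> e j) j \<otimes> w i)"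
    by (rule B.finsum_swap) (use rc wc in auto)
  also have "\<dots> = (\<Oplus>j\<in>{..<n}. (w j \<otimes> e j) \<otimes> x)"
  proof (rule B.add.finprod_cong'[OF refl])
    fix j assume j: "j \<in> {..<n}"
    have "(\<Oplus>i\<in>{..<n}. rho (e i \<otimes> x \<otimes> e j) j \<otimes> w i) = (\<Oplus>i\<in>{..<n}. rho ((x \<otimes> e j) \<otimes> e i) j \<otimes> w i)"
    proof (rule B.add.finprod_cong'[OF refl])
      fix i assume i: "i \<in> {..<n}"
      have "e i \<otimes> x \<otimes> e j = (x \<otimes> e j) \<otimes> e i"
        using i j x by (simp add: B.m_ac)
      then show "rho (e i \<otimes> x \<otimes> e j) j \<otimes> w i = rho ((x \<otimes> e j) \<otimes> e i) j \<otimes> w i" by (simp only:)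
    qed (use j x wc in auto)
    also have "\<dots> = (x \<otimes> e j) \<otimes> w j"
      by (rule annJ_coordinate[OF w]) (use j x in auto)
    also have "\<dots> = (w j \<otimes> e j) \<otimes> x"
      using j x wc by (simp add: B.m_ac)
    finally show "(\<Oplus>i\<in>{..<n}. rho (e i \<otimes> x \<otimes> e j) j \<otimes> w i) = (w j \<otimes> e j) \<otimes> x" .
  qed (use x wc in auto)
  also have "\<dots> = (\<Oplus>j\<in>{..<n}. w j \<otimes> e j) \<otimes> x"
    by (rule B.finsum_ldistr[symmetric]) (use x wc in auto)
  finally show ?thesis by (simp add: mu_def ev_def)
qed

text \<open>Column \<open>j\<close> of the matrix of multiplication by \<open>mu w\<close> comes
  from \<open>annJ_trace\<close> at \<open>x = e j\<close>, by taking coordinates of both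
  sides.\<close>

lemma disc_divides_norm:
  assumes w: "w \<in> annJ"
  shows "disc A B n e divides\<^bsub>A\<^esub> alg_norm A B n e (mu w)"
proof -
  have wc: "w i \<in> carrier B" for i using T_coordinate[OF annJ_closed[OF w]] .
  show ?thesis
    unfolding disc_def alg_norm_def
  proof (rule A.mat_det_divides_mult[where U = "\<lambda>k i. co (w i) k"])
    show "mat_over A n n (\<lambda>i j. alg_trace A B n e (e i \<otimes> e j))"
      "mat_over A n n (\<lambda>k i. co (w i) k)"
      using wc by (auto intro!: mat_overI)
    fix k j assume kj: "k < n" "j < n"
    let ?t = "\<lambda>i. alg_trace A B n e (e i \<otimes> e j)"
    have "mult_matrix A B n e (mu w) k j = co (\<Oplus>i\<in>{..<n}. ?t i \<odot> w i) k"
      unfolding mult_matrix_def using annJ_trace[OF w, of "e j"] kj by simp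
    also have "\<dots> = (\<Oplus>\<^bsub>A\<^esub>i\<in>{..<n}. co (?t i \<odot> w i) k)"
      by (rule co_finsum) (use kj wc in auto)
    also have "\<dots> = (\<Oplus>\<^bsub>A\<^esub>i\<in>{..<n}. co (w i) k \<otimes>\<^bsub>A\<^esub> ?t i)"
      by (rule A.add.finprod_cong') (use kj wc in \<open>auto simp: co_smult A.m_comm\<close>)
    finally show "mult_matrix A B n e (mu w) k j = (\<Oplus>\<^bsub>A\<^esub>i\<in>{..<n}. co (w i) k \<otimes>\<^bsub>A\<^esub> ?t i)" .
  qed
qed

section \<open>From differentials to J modulo its square\<close>

definition Delta :: "('b \<Rightarrow> 'b) \<Rightarrow> nat \<Rightarrow> 'b" where
  "Delta = lin_ext B T delta"

lemma delta_Pi: "delta \<in> carrier B \<rightarrow> carrier T"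
  by auto

lemma Delta_linear: "linear_hom B F T Delta"
  unfolding Delta_def by (rule linear_ext[OF TM.module_axioms delta_Pi])

lemma Delta_gen: "x \<in> carrier B \<Longrightarrow> Delta (free_gen B x) = delta x"
  unfolding Delta_def by (rule TM.lin_ext_gen[OF delta_Pi])

lemma Delta_J:
  assumes "f \<in> carrier F" shows "Delta f \<in> J"
  unfolding Delta_def lin_ext_def
proof (rule TM.submodule_finsum[OF J_submodule])
  fix s assume "s \<in> {s. f s \<noteq> \<zero>}"
  then have "s \<in> carrier B" using assms by (auto simp: carrier_free_module)
  then show "f s \<odot>\<^bsub>T\<^esub> delta s \<in> J"
    using TM.submoduleE(4)[OF J_submodule] delta_J B.free_module_carrierD[OF assms] by blast
qed

text \<open>So \<open>Delta\<close> induces the canonical map \<open>\<Omega> \<rightarrow> J / J\<^sup>2\<close>.\<close>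

lemma Delta_N:
  assumes "f \<in> N" shows "Delta f \<in> J2"
  unfolding Delta_def
proof (rule N_vimage[OF TM.module_axioms delta_Pi J2_submodule _ _ _ assms])
  have z: "\<zero>\<^bsub>T\<^esub> \<in> J2" by (rule TM.submodule_zero[OF J2_submodule])
  fix x y assume xy: "x \<in> carrier B" "y \<in> carrier B"
  show "delta (x \<oplus> y) \<ominus>\<^bsub>T\<^esub> (delta x \<oplus>\<^bsub>T\<^esub> delta y) \<in> J2"
    using xy z by (simp add: delta_add a_minus_def T.r_neg)
  have c: "x \<odot>\<^bsub>T\<^esub> delta y \<oplus>\<^bsub>T\<^esub> y \<odot>\<^bsub>T\<^esub> delta x \<in> carrier T" "delta x \<otimes>\<^bsub>T\<^esub> delta y \<in> carrier T"
    using xy by auto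
  have "(x \<odot>\<^bsub>T\<^esub> delta y \<oplus>\<^bsub>T\<^esub> y \<odot>\<^bsub>T\<^esub> delta x \<oplus>\<^bsub>T\<^esub> delta x \<otimes>\<^bsub>T\<^esub> delta y) \<ominus>\<^bsub>T\<^esub>
      (x \<odot>\<^bsub>T\<^esub> delta y \<oplus>\<^bsub>T\<^esub> y \<odot>\<^bsub>T\<^esub> delta x) = delta x \<otimes>\<^bsub>T\<^esub> delta y"
    using c by algebra
  then show "delta (x \<otimes> y) \<ominus>\<^bsub>T\<^esub> (x \<odot>\<^bsub>T\<^esub> delta y \<oplus>\<^bsub>T\<^esub> y \<odot>\<^bsub>T\<^esub> delta x) \<in> J2"
    using J2_mult[OF delta_J delta_J] xy by (simp add: delta_mult)
next
  have z: "\<zero>\<^bsub>T\<^esub> \<in> J2" by (rule TM.submodule_zero[OF J2_submodule])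
  fix a x assume "a \<in> carrier A" "x \<in> carrier B"
  then show "delta (a \<odot> x) \<ominus>\<^bsub>T\<^esub> (a \<odot> \<one>) \<odot>\<^bsub>T\<^esub> delta x \<in> J2"
    using z by (simp add: delta_smult a_minus_def T.r_neg)
qed

text \<open>Every \<open>delta x\<close> lies in J, which the \<open>delta (e l)\<close> generate by
  \<open>J_expand\<close>; so these finitely many decide.\<close>

lemma annJ_I:
  assumes w: "w \<in> carrier T" and "\<And>l. l < n \<Longrightarrow> delta (e l) \<otimes>\<^bsub>T\<^esub> w = \<zero>\<^bsub>T\<^esub>"
  shows "w \<in> annJ"
  unfolding annJ_def
proof (intro CollectI conjI ballI w)
  fix x assume x: "x \<in> carrier B"
  let ?z = "delta x"
  have zc: "iota (?z l) \<in> carrier T" for l using T_coordinate[OF delta_closed[OF x]] by simp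
  have "?z \<otimes>\<^bsub>T\<^esub> w = (\<Oplus>\<^bsub>T\<^esub>l\<in>{..<n}. iota (?z l) \<otimes>\<^bsub>T\<^esub> delta (e l)) \<otimes>\<^bsub>T\<^esub> w"
    using J_expand[OF delta_J[OF x]] by simp
  also have "\<dots> = (\<Oplus>\<^bsub>T\<^esub>l\<in>{..<n}. (iota (?z l) \<otimes>\<^bsub>T\<^esub> delta (e l)) \<otimes>\<^bsub>T\<^esub> w)"
    by (rule T.finsum_ldistr) (use zc w in auto)
  also have "\<dots> = \<zero>\<^bsub>T\<^esub>"
    by (rule T.add.finprod_one_eqI) (use zc w assms(2) in \<open>auto simp: T.m_assoc\<close>)
  finally show "?z \<otimes>\<^bsub>T\<^esub> w = \<zero>\<^bsub>T\<^esub>" .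
qed

text \<open>Nakayama for \<open>J = (t) + J\<^sup>2\<close>: \<open>d\<close> is the determinant of a matrix that is the identity modulo \<open>J\<close>.\<close>

lemma J_nakayama:
  assumes t: "t \<in> {..<m} \<rightarrow> J"
    and gen: "\<And>l. l < n \<Longrightarrow> \<exists>c\<in>{..<m} \<rightarrow> carrier B. delta (e l) \<ominus>\<^bsub>T\<^esub> lin_comb T m c t \<in> J2"
  obtains d where "d \<in> carrier T" "mu d = \<one>"
    "\<And>l. l < n \<Longrightarrow> \<exists>a\<in>{..<m} \<rightarrow> carrier T. delta (e l) \<otimes>\<^bsub>T\<^esub> d = (\<Oplus>\<^bsub>T\<^esub>j\<in>{..<m}. t j \<otimes>\<^bsub>T\<^esub> a j)"
proof -
  have tT: "t \<in> {..<m} \<rightarrow> carrier T" using t J_closed by auto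
  have "\<forall>l. \<exists>c. l < n \<longrightarrow> c \<in> {..<m} \<rightarrow> carrier B \<and> delta (e l) \<ominus>\<^bsub>T\<^esub> lin_comb T m c t \<in> J2"
    using gen by blast
  from choice[OF this] obtain c where c: "\<And>l. l < n \<Longrightarrow> c l \<in> {..<m} \<rightarrow> carrier B"
    and cJ: "\<And>l. l < n \<Longrightarrow> delta (e l) \<ominus>\<^bsub>T\<^esub> lin_comb T m (c l) t \<in> J2"
    by blast
  have "\<forall>l. \<exists>k. l < n \<longrightarrow> k \<in> {..<n} \<rightarrow> J \<and>
      delta (e l) \<ominus>\<^bsub>T\<^esub> lin_comb T m (c l) t = (\<Oplus>\<^bsub>T\<^esub>i\<in>{..<n}. k i \<otimes>\<^bsub>T\<^esub> delta (e i))"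
    using cJ unfolding J2_def by blast
  from choice[OF this] obtain k where k: "\<And>l. l < n \<Longrightarrow> k l \<in> {..<n} \<rightarrow> J"
    and kJ: "\<And>l. l < n \<Longrightarrow> delta (e l) \<ominus>\<^bsub>T\<^esub> lin_comb T m (c l) t =
      (\<Oplus>\<^bsub>T\<^esub>i\<in>{..<n}. k l i \<otimes>\<^bsub>T\<^esub> delta (e i))"
    by blast
  have kc: "k l i \<in> carrier T" if "l < n" "i < n" for l i using k[OF that(1)] that(2) J_closed by auto
  have mk: "mu (k l i) = \<zero>" if "l < n" "i < n" for l i
    using k[OF that(1)] that(2) by (auto simp: J_def)
  \<comment> \<open>Moving the J^2 part of each \<open>delta (e l)\<close> to the left makes the row
    vector of the \<open>delta (e i)\<close> times this matrix a combination of the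
    \<open>t j\<close>. The entry at \<open>(i, l)\<close> uses \<open>k l i\<close> because the
    vector multiplies from the left.\<close>
  define M where "M i l = (if i = l then \<one>\<^bsub>T\<^esub> else \<zero>\<^bsub>T\<^esub>) \<ominus>\<^bsub>T\<^esub> k l i" for i l
  have M: "mat_over T n n M" using kc by (auto intro!: mat_overI simp: M_def)
  have ic: "mat_over T m n (\<lambda>j l. iota (c l j))" using c by (auto intro!: mat_overI)
  have rel: "(\<Oplus>\<^bsub>T\<^esub>i\<in>{..<n}. delta (e i) \<otimes>\<^bsub>T\<^esub> M i l) = (\<Oplus>\<^bsub>T\<^esub>j\<in>{..<m}. t j \<otimes>\<^bsub>T\<^esub> iota (c l j))"
    if l: "l < n" for l
  proof -
    let ?S = "\<Oplus>\<^bsub>T\<^esub>i\<in>{..<n}. k l i \<otimes>\<^bsub>T\<^esub> delta (e i)"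
    have S: "?S \<in> carrier T" using kc l by (auto intro!: T.finsum_closed)
    have L: "lin_comb T m (c l) t \<in> carrier T" by (rule TM.lin_comb_closed[OF c[OF l] tT])
    have "(\<Oplus>\<^bsub>T\<^esub>i\<in>{..<n}. delta (e i) \<otimes>\<^bsub>T\<^esub> M i l) =
        (\<Oplus>\<^bsub>T\<^esub>i\<in>{..<n}. (if i = l then delta (e i) else \<zero>\<^bsub>T\<^esub>) \<oplus>\<^bsub>T\<^esub> (\<ominus>\<^bsub>T\<^esub> \<one>\<^bsub>T\<^esub>) \<otimes>\<^bsub>T\<^esub> (k l i \<otimes>\<^bsub>T\<^esub> delta (e i)))"
      by (rule T.add.finprod_cong')
         (use kc l in \<open>auto simp: M_def a_minus_def T.r_distr T.l_minus T.r_minus T.m_comm\<close>)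
    also have "\<dots> = (\<Oplus>\<^bsub>T\<^esub>i\<in>{..<n}. if i = l then delta (e i) else \<zero>\<^bsub>T\<^esub>) \<oplus>\<^bsub>T\<^esub>
        (\<Oplus>\<^bsub>T\<^esub>i\<in>{..<n}. (\<ominus>\<^bsub>T\<^esub> \<one>\<^bsub>T\<^esub>) \<otimes>\<^bsub>T\<^esub> (k l i \<otimes>\<^bsub>T\<^esub> delta (e i)))"
      by (rule T.finsum_addf) (use kc l in auto)
    also have "(\<Oplus>\<^bsub>T\<^esub>i\<in>{..<n}. if i = l then delta (e i) else \<zero>\<^bsub>T\<^esub>) = delta (e l)"
      by (rule T.add.finprod_singleton_swap) (use l in auto)
    also have "(\<Oplus>\<^bsub>T\<^esub>i\<in>{..<n}. (\<ominus>\<^bsub>T\<^esub> \<one>\<^bsub>T\<^esub>) \<otimes>\<^bsub>T\<^esub> (k l i \<otimes>\<^bsub>T\<^esub> delta (e i))) = (\<ominus>\<^bsub>T\<^esub> \<one>\<^bsub>T\<^esub>) \<otimes>\<^bsub>T\<^esub> ?S"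
      by (rule T.finsum_rdistr[symmetric]) (use kc l in auto)
    also have "\<dots> = \<ominus>\<^bsub>T\<^esub> (delta (e l) \<ominus>\<^bsub>T\<^esub> lin_comb T m (c l) t)"
      unfolding kJ[OF l] using S by (simp add: T.l_minus)
    also have "delta (e l) \<oplus>\<^bsub>T\<^esub> \<dots> = lin_comb T m (c l) t"
      using L delta_closed[OF e_closed[OF l]] by algebra
    also have "\<dots> = (\<Oplus>\<^bsub>T\<^esub>j\<in>{..<m}. t j \<otimes>\<^bsub>T\<^esub> iota (c l j))"
      unfolding lin_comb_def
      by (rule T.add.finprod_cong') (use c[OF l] tT in \<open>auto simp: smult_iota Pi_iff T.m_comm\<close>)
    finally show ?thesis .
  qed
  have dP: "(\<lambda>i. delta (e i)) \<in> {..<n} \<rightarrow> carrier T" by auto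
  show ?thesis
  proof (rule that)
    show "mat_det T n M \<in> carrier T" using M by simp
    \<comment> \<open>\<open>mu\<close> kills the entries \<open>k l i\<close>, so \<open>M\<close>
      becomes the identity matrix.\<close>
    have "mu (mat_det T n M) = mat_det B n (\<lambda>i j. mu (M i j))" by (rule mu.hom_mat_det[OF M])
    also have "\<dots> = mat_det B n (\<lambda>i j. if i = j then \<one> else \<zero>)"
      by (rule B.mat_det_cong) (use kc mk in \<open>auto intro!: mat_overI simp: M_def a_minus_def\<close>)
    also have "\<dots> = \<one>" by (rule B.mat_det_one)
    finally show "mu (mat_det T n M) = \<one>" .
    show "\<exists>a\<in>{..<m} \<rightarrow> carrier T. delta (e l) \<otimes>\<^bsub>T\<^esub> mat_det T n M = (\<Oplus>\<^bsub>T\<^esub>j\<in>{..<m}. t j \<otimes>\<^bsub>T\<^esub> a j)"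
      if "l < n" for l
      by (rule T.lin_relation_det[OF M dP tT ic rel that])
  qed
qed

text \<open>The witness is \<open>d\<close> times the determinant of the corrected rows selected by
  \<open>r\<close>: the determinant kills every \<open>t j\<close>, the factor \<open>d\<close>
  extends this from the \<open>t j\<close> to all of J, and \<open>mu d = \<one>\<close> leaves the
  image in B unchanged.\<close>

lemma minor_in_noether_different:
  assumes pres: "presentation B \<Omega> m g k P" and r: "r \<in> {..<m} \<rightarrow> {..<k}"
  shows "\<exists>w\<in>annJ. mu w = mat_det B m (\<lambda>i j. P (r i) j)"
proof -
  interpret L: linear_hom B F T Delta by (rule Delta_linear)
  have g: "g \<in> {..<m} \<rightarrow> carrier \<Omega>"
    and Pc: "\<And>i j. i < k \<Longrightarrow> j < m \<Longrightarrow> P i j \<in> carrier B"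
    and gens: "\<And>x. x \<in> carrier \<Omega> \<Longrightarrow> \<exists>c\<in>{..<m} \<rightarrow> carrier B. x = lin_comb \<Omega> m c g"
    and rels: "\<And>c. c \<in> {..<m} \<rightarrow> carrier B \<Longrightarrow> lin_comb \<Omega> m c g = \<zero>\<^bsub>\<Omega>\<^esub> \<longleftrightarrow>
      (\<exists>u\<in>{..<k} \<rightarrow> carrier B. \<forall>j<m. c j = (\<Oplus>i\<in>{..<k}. u i \<otimes> P i j))"
    using pres unfolding presentation_def by auto
  have "g j \<in> carrier \<Omega>" if "j < m" for j using g that by auto
  then have "\<forall>j. \<exists>f. j < m \<longrightarrow> f \<in> carrier F \<and> g j = N +>\<^bsub>F\<^esub> f" using K.proj_surj by blast
  from choice[OF this] obtain f where f: "f \<in> {..<m} \<rightarrow> carrier F" and gf: "\<And>j. j < m \<Longrightarrow> g j = N +>\<^bsub>F\<^esub> f j"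
    by auto
  have proj_lc: "N +>\<^bsub>F\<^esub> lin_comb F m c f = lin_comb \<Omega> m c g" if c: "c \<in> {..<m} \<rightarrow> carrier B" for c
    unfolding K.proj.lin_comb[OF c f] by (rule OM.lin_comb_cong) (use c g gf in auto)
  define t where "t j = Delta (f j)" for j
  have t: "t \<in> {..<m} \<rightarrow> J" using f by (auto simp: t_def intro!: Delta_J)
  have tT: "t \<in> {..<m} \<rightarrow> carrier T" using t J_closed by auto
  have Dlc: "Delta (lin_comb F m c f) = lin_comb T m c t" if "c \<in> {..<m} \<rightarrow> carrier B" for c
    unfolding t_def by (rule L.lin_comb[OF that f])
  have "\<exists>c\<in>{..<m} \<rightarrow> carrier B. delta (e l) \<ominus>\<^bsub>T\<^esub> lin_comb T m c t \<in> J2" if l: "l < n" for l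
  proof -
    obtain c where c: "c \<in> {..<m} \<rightarrow> carrier B" "D (e l) = lin_comb \<Omega> m c g"
      using gens[of "D (e l)"] l by auto
    have lf: "lin_comb F m c f \<in> carrier F" by (rule FM.lin_comb_closed[OF c(1) f])
    have "free_gen B (e l) \<ominus>\<^bsub>F\<^esub> lin_comb F m c f \<in> N"
      using K.proj_eq_iff[OF free_gen_F[OF e_closed[OF l]] lf] c(2) proj_lc[OF c(1)] by (simp add: D_def)
    from Delta_N[OF this] show ?thesis
      using lf l c(1) by (auto simp: Delta_gen Dlc)
  qed
  from J_nakayama[OF t this] obtain d where d: "d \<in> carrier T" "mu d = \<one>"
    and dl: "\<And>l. l < n \<Longrightarrow> \<exists>a\<in>{..<m} \<rightarrow> carrier T. delta (e l) \<otimes>\<^bsub>T\<^esub> d = (\<Oplus>\<^bsub>T\<^esub>j\<in>{..<m}. t j \<otimes>\<^bsub>T\<^esub> a j)"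
    by blast
  have "\<forall>l. \<exists>a. l < n \<longrightarrow> a \<in> {..<m} \<rightarrow> carrier T \<and>
      delta (e l) \<otimes>\<^bsub>T\<^esub> d = (\<Oplus>\<^bsub>T\<^esub>j\<in>{..<m}. t j \<otimes>\<^bsub>T\<^esub> a j)"
    using dl by blast
  from choice[OF this] obtain a where a: "\<And>l. l < n \<Longrightarrow> a l \<in> {..<m} \<rightarrow> carrier T"
    and da: "\<And>l. l < n \<Longrightarrow> delta (e l) \<otimes>\<^bsub>T\<^esub> d = (\<Oplus>\<^bsub>T\<^esub>j\<in>{..<m}. t j \<otimes>\<^bsub>T\<^esub> a l j)"
    by blast
  have row: "\<exists>h\<in>{..<m} \<rightarrow> carrier T. (\<forall>j<m. mu (h j) = P i j) \<and> (\<Oplus>\<^bsub>T\<^esub>j\<in>{..<m}. t j \<otimes>\<^bsub>T\<^esub> h j) = \<zero>\<^bsub>T\<^esub>"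
    if i: "i < k" for i
  proof -
    have Pi: "P i \<in> {..<m} \<rightarrow> carrier B" using Pc i by auto
    \<comment> \<open>Row \<open>i\<close> is itself a relation, being the combination of rows whose
      coefficients form the \<open>i\<close>-th unit vector.\<close>
    have "\<forall>j<m. P i j = (\<Oplus>i'\<in>{..<k}. (if i' = i then \<one> else \<zero>) \<otimes> P i' j)"
    proof (intro allI impI)
      fix j assume j: "j < m"
      have "(\<Oplus>i'\<in>{..<k}. (if i' = i then \<one> else \<zero>) \<otimes> P i' j) = (\<Oplus>i'\<in>{..<k}. if i' = i then P i' j else \<zero>)"
        by (rule B.add.finprod_cong') (use Pc j in auto)
      also have "\<dots> = P i j"
        by (rule B.add.finprod_singleton_swap) (use Pc i j in auto)
      finally show "P i j = (\<Oplus>i'\<in>{..<k}. (if i' = i then \<one> else \<zero>) \<otimes> P i' j)" ..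
    qed
    then have "lin_comb \<Omega> m (P i) g = \<zero>\<^bsub>\<Omega>\<^esub>"
      unfolding rels[OF Pi] by (intro bexI[of _ "\<lambda>i'. if i' = i then \<one> else \<zero>"]) auto
    then have "lin_comb F m (P i) f \<in> N"
      using K.proj_zero_iff[OF FM.lin_comb_closed[OF Pi f]] proj_lc[OF Pi] by simp
    from Delta_N[OF this] obtain q where q: "q \<in> {..<n} \<rightarrow> J"
      and lq: "lin_comb T m (P i) t = (\<Oplus>\<^bsub>T\<^esub>l\<in>{..<n}. q l \<otimes>\<^bsub>T\<^esub> delta (e l))"
      by (auto simp: Dlc[OF Pi] J2_def)
    have qc: "q l \<in> carrier T" if "l < n" for l using q that J_closed by auto
    have ac: "a l j \<in> carrier T" if "l < n" "j < m" for l j using a[OF that(1)] that(2) by auto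
    have tc: "t j \<in> carrier T" if "j < m" for j using tT that by auto
    have ipc: "iota (P i j) \<in> carrier T" if "j < m" for j using Pc i that by auto
    \<comment> \<open>The relation holds up to the J^2 error with terms
      \<open>q l delta (e l)\<close>. Times \<open>d\<close>, and with \<open>delta (e l) d\<close>
      expressed through the \<open>t j\<close>, this error becomes the sum of the
      \<open>t j Q j\<close>; each \<open>Q j\<close> lies in J because the \<open>q l\<close>
      do.\<close>
    define Q where "Q j = (\<Oplus>\<^bsub>T\<^esub>l\<in>{..<n}. q l \<otimes>\<^bsub>T\<^esub> a l j)" for j
    have Qc: "Q j \<in> carrier T" if "j < m" for j
      using qc ac that by (auto simp: Q_def intro!: T.finsum_closed)
    have muQ: "mu (Q j) = \<zero>" if j: "j < m" for j
    proof -
      have "q l \<otimes>\<^bsub>T\<^esub> a l j \<in> J" if "l \<in> {..<n}" for l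
        using q ac j that by (auto intro!: J_mult)
      then have "Q j \<in> J" unfolding Q_def by (rule TM.submodule_finsum[OF J_submodule])
      then show ?thesis by (simp add: J_def)
    qed
    let ?L = "\<Oplus>\<^bsub>T\<^esub>j\<in>{..<m}. t j \<otimes>\<^bsub>T\<^esub> iota (P i j)"
    have Lc: "?L \<in> carrier T" using tc ipc by (auto intro!: T.finsum_closed)
    have "lin_comb T m (P i) t = ?L"
      unfolding lin_comb_def
      by (rule T.add.finprod_cong') (use Pi tc ipc in \<open>auto simp: smult_iota Pi_iff T.m_comm\<close>)
    then have Ld: "?L \<otimes>\<^bsub>T\<^esub> d = (\<Oplus>\<^bsub>T\<^esub>l\<in>{..<n}. q l \<otimes>\<^bsub>T\<^esub> delta (e l)) \<otimes>\<^bsub>T\<^esub> d"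
      using lq by simp
    also have "\<dots> = (\<Oplus>\<^bsub>T\<^esub>l\<in>{..<n}. q l \<otimes>\<^bsub>T\<^esub> delta (e l) \<otimes>\<^bsub>T\<^esub> d)"
      by (rule T.finsum_ldistr) (use qc d in auto)
    also have "\<dots> = (\<Oplus>\<^bsub>T\<^esub>l\<in>{..<n}. \<Oplus>\<^bsub>T\<^esub>j\<in>{..<m}. t j \<otimes>\<^bsub>T\<^esub> (q l \<otimes>\<^bsub>T\<^esub> a l j))"
    proof (rule T.add.finprod_cong'[OF refl])
      fix l assume "l \<in> {..<n}"
      then have l: "l < n" by simp
      have "q l \<otimes>\<^bsub>T\<^esub> delta (e l) \<otimes>\<^bsub>T\<^esub> d = q l \<otimes>\<^bsub>T\<^esub> (\<Oplus>\<^bsub>T\<^esub>j\<in>{..<m}. t j \<otimes>\<^bsub>T\<^esub> a l j)"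
        using l qc d by (simp add: T.m_assoc da)
      also have "\<dots> = (\<Oplus>\<^bsub>T\<^esub>j\<in>{..<m}. q l \<otimes>\<^bsub>T\<^esub> (t j \<otimes>\<^bsub>T\<^esub> a l j))"
        by (rule T.finsum_rdistr) (use l qc tc ac in auto)
      also have "\<dots> = (\<Oplus>\<^bsub>T\<^esub>j\<in>{..<m}. t j \<otimes>\<^bsub>T\<^esub> (q l \<otimes>\<^bsub>T\<^esub> a l j))"
        by (rule T.add.finprod_cong') (use l qc tc ac in \<open>auto intro!: T.m_lcomm\<close>)
      finally show "q l \<otimes>\<^bsub>T\<^esub> delta (e l) \<otimes>\<^bsub>T\<^esub> d = (\<Oplus>\<^bsub>T\<^esub>j\<in>{..<m}. t j \<otimes>\<^bsub>T\<^esub> (q l \<otimes>\<^bsub>T\<^esub> a l j))" .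
    qed (use qc tc ac in \<open>auto intro!: T.finsum_closed\<close>)
    also have "\<dots> = (\<Oplus>\<^bsub>T\<^esub>j\<in>{..<m}. \<Oplus>\<^bsub>T\<^esub>l\<in>{..<n}. t j \<otimes>\<^bsub>T\<^esub> (q l \<otimes>\<^bsub>T\<^esub> a l j))"
      by (rule T.finsum_swap) (use qc tc ac in auto)
    also have "\<dots> = (\<Oplus>\<^bsub>T\<^esub>j\<in>{..<m}. t j \<otimes>\<^bsub>T\<^esub> Q j)"
    proof (rule T.add.finprod_cong'[OF refl])
      fix j assume "j \<in> {..<m}"
      then show "(\<Oplus>\<^bsub>T\<^esub>l\<in>{..<n}. t j \<otimes>\<^bsub>T\<^esub> (q l \<otimes>\<^bsub>T\<^esub> a l j)) = t j \<otimes>\<^bsub>T\<^esub> Q j"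
        unfolding Q_def using qc tc ac by (intro T.finsum_rdistr[symmetric]) auto
    qed (use tc Qc in auto)
    finally have LdQ: "?L \<otimes>\<^bsub>T\<^esub> d = (\<Oplus>\<^bsub>T\<^esub>j\<in>{..<m}. t j \<otimes>\<^bsub>T\<^esub> Q j)" .
    have Qs: "(\<Oplus>\<^bsub>T\<^esub>j\<in>{..<m}. t j \<otimes>\<^bsub>T\<^esub> Q j) \<in> carrier T" using tc Qc by (auto intro!: T.finsum_closed)
    \<comment> \<open>The corrected row is \<open>P i j\<close> times \<open>d\<close>, minus
      \<open>Q j\<close>. It still maps to \<open>P i j\<close>, because
      \<open>mu d = \<one>\<close> and \<open>mu (Q j) = \<zero>\<close>.\<close>
    define h where "h j = iota (P i j) \<otimes>\<^bsub>T\<^esub> d \<oplus>\<^bsub>T\<^esub> (\<ominus>\<^bsub>T\<^esub> \<one>\<^bsub>T\<^esub>) \<otimes>\<^bsub>T\<^esub> Q j" for j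
    have hc: "h \<in> {..<m} \<rightarrow> carrier T" using ipc d Qc by (auto simp: h_def)
    have "mu (h j) = P i j" if j: "j < m" for j
      using ipc[OF j] d Qc[OF j] muQ[OF j] Pc[OF i j] by (simp add: h_def mu_iota)
    moreover have "(\<Oplus>\<^bsub>T\<^esub>j\<in>{..<m}. t j \<otimes>\<^bsub>T\<^esub> h j) = \<zero>\<^bsub>T\<^esub>"
    proof -
      have "(\<Oplus>\<^bsub>T\<^esub>j\<in>{..<m}. t j \<otimes>\<^bsub>T\<^esub> h j) =
          (\<Oplus>\<^bsub>T\<^esub>j\<in>{..<m}. (t j \<otimes>\<^bsub>T\<^esub> iota (P i j)) \<otimes>\<^bsub>T\<^esub> d \<oplus>\<^bsub>T\<^esub> (\<ominus>\<^bsub>T\<^esub> \<one>\<^bsub>T\<^esub>) \<otimes>\<^bsub>T\<^esub> (t j \<otimes>\<^bsub>T\<^esub> Q j))"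
        by (rule T.add.finprod_cong')
           (use tc ipc d Qc in \<open>auto simp: h_def T.r_distr T.m_assoc T.l_minus T.r_minus\<close>)
      also have "\<dots> = (\<Oplus>\<^bsub>T\<^esub>j\<in>{..<m}. (t j \<otimes>\<^bsub>T\<^esub> iota (P i j)) \<otimes>\<^bsub>T\<^esub> d) \<oplus>\<^bsub>T\<^esub>
          (\<Oplus>\<^bsub>T\<^esub>j\<in>{..<m}. (\<ominus>\<^bsub>T\<^esub> \<one>\<^bsub>T\<^esub>) \<otimes>\<^bsub>T\<^esub> (t j \<otimes>\<^bsub>T\<^esub> Q j))"
        by (rule T.finsum_addf) (use tc ipc d Qc in auto)
      also have "(\<Oplus>\<^bsub>T\<^esub>j\<in>{..<m}. (t j \<otimes>\<^bsub>T\<^esub> iota (P i j)) \<otimes>\<^bsub>T\<^esub> d) = ?L \<otimes>\<^bsub>T\<^esub> d"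
        by (rule T.finsum_ldistr[symmetric]) (use tc ipc d in auto)
      also have "(\<Oplus>\<^bsub>T\<^esub>j\<in>{..<m}. (\<ominus>\<^bsub>T\<^esub> \<one>\<^bsub>T\<^esub>) \<otimes>\<^bsub>T\<^esub> (t j \<otimes>\<^bsub>T\<^esub> Q j)) =
          (\<ominus>\<^bsub>T\<^esub> \<one>\<^bsub>T\<^esub>) \<otimes>\<^bsub>T\<^esub> (\<Oplus>\<^bsub>T\<^esub>j\<in>{..<m}. t j \<otimes>\<^bsub>T\<^esub> Q j)"
        by (rule T.finsum_rdistr[symmetric]) (use tc Qc in auto)
      finally show ?thesis
        unfolding LdQ using Qs by (simp add: T.l_minus T.r_neg)
    qed
    ultimately show ?thesis using hc by blast
  qed
  have "\<forall>i. \<exists>h. i < k \<longrightarrow> h \<in> {..<m} \<rightarrow> carrier T \<and> (\<forall>j<m. mu (h j) = P i j) \<and>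
      (\<Oplus>\<^bsub>T\<^esub>j\<in>{..<m}. t j \<otimes>\<^bsub>T\<^esub> h j) = \<zero>\<^bsub>T\<^esub>"
    using row by blast
  from choice[OF this] obtain h where h: "\<And>i. i < k \<Longrightarrow> h i \<in> {..<m} \<rightarrow> carrier T"
    and muh: "\<And>i j. i < k \<Longrightarrow> j < m \<Longrightarrow> mu (h i j) = P i j"
    and hz: "\<And>i. i < k \<Longrightarrow> (\<Oplus>\<^bsub>T\<^esub>j\<in>{..<m}. t j \<otimes>\<^bsub>T\<^esub> h i j) = \<zero>\<^bsub>T\<^esub>"
    by blast
  have rk: "r i < k" if "i < m" for i using r that by auto
  \<comment> \<open>The rows \<open>h (r i)\<close> become columns, as
    \<open>lin_relation_det_zero\<close> multiplies by the row vector \<open>t\<close> from the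
    left.\<close>
  define H where "H j i = h (r i) j" for j i
  have H: "mat_over T m m H" using h rk by (auto intro!: mat_overI simp: H_def Pi_iff)
  have tH: "t j \<otimes>\<^bsub>T\<^esub> mat_det T m H = \<zero>\<^bsub>T\<^esub>" if "j < m" for j
    by (rule T.lin_relation_det_zero[OF H tT that]) (use hz rk in \<open>simp add: H_def\<close>)
  let ?w = "d \<otimes>\<^bsub>T\<^esub> mat_det T m H"
  have "?w \<in> annJ"
  proof (rule annJ_I)
    show "?w \<in> carrier T" using d H by simp
    fix l assume l: "l < n"
    have "delta (e l) \<otimes>\<^bsub>T\<^esub> ?w = (\<Oplus>\<^bsub>T\<^esub>j\<in>{..<m}. t j \<otimes>\<^bsub>T\<^esub> a l j) \<otimes>\<^bsub>T\<^esub> mat_det T m H"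
      using l d H by (simp add: T.m_assoc[symmetric] da)
    also have "\<dots> = (\<Oplus>\<^bsub>T\<^esub>j\<in>{..<m}. (t j \<otimes>\<^bsub>T\<^esub> a l j) \<otimes>\<^bsub>T\<^esub> mat_det T m H)"
      by (rule T.finsum_ldistr) (use tT a[OF l] H in auto)
    also have "\<dots> = (\<Oplus>\<^bsub>T\<^esub>j\<in>{..<m}. a l j \<otimes>\<^bsub>T\<^esub> (t j \<otimes>\<^bsub>T\<^esub> mat_det T m H))"
      by (rule T.add.finprod_cong') (use tT a[OF l] H in \<open>auto simp: Pi_iff T.m_ac\<close>)
    also have "\<dots> = \<zero>\<^bsub>T\<^esub>"
      by (rule T.add.finprod_one_eqI) (use tH a[OF l] in \<open>auto simp: Pi_iff\<close>)
    finally show "delta (e l) \<otimes>\<^bsub>T\<^esub> ?w = \<zero>\<^bsub>T\<^esub>" .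
  qed
  moreover have "mu ?w = mat_det B m (\<lambda>i j. P (r i) j)"
  proof -
    have PT: "mat_over B m m (\<lambda>i j. P (r i) j)" using Pc rk by (auto intro!: mat_overI)
    then have PT': "mat_over B m m (\<lambda>i j. P (r j) i)" by (auto simp: mat_over_def)
    have "mu ?w = mu (mat_det T m H)" using d H by simp
    also have "\<dots> = mat_det B m (\<lambda>i j. mu (H i j))" by (rule mu.hom_mat_det[OF H])
    also have "\<dots> = mat_det B m (\<lambda>i j. P (r j) i)"
      by (rule B.mat_det_cong[OF PT']) (use muh rk in \<open>simp add: H_def\<close>)
    also have "\<dots> = mat_det B m (\<lambda>i j. P (r i) j)"
      by (rule B.mat_det_transpose[OF PT])
    finally show ?thesis .
  qed
  ultimately show ?thesis by blast
qed

text \<open>\<open>mu\<close> is onto because \<open>mu (iota x) = x\<close>, so it maps the ideal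
  \<open>annJ\<close> to an ideal; multipliers from B are lifted by \<open>iota\<close>.\<close>

lemma noether_different_ideal: "ideal (mu ` annJ) B"
proof (rule idealI)
  show "ring B" by (rule B.ring_axioms)
  have add: "v \<oplus>\<^bsub>T\<^esub> w \<in> annJ" if "v \<in> annJ" "w \<in> annJ" for v w
    using that by (auto simp: annJ_def T.r_distr)
  have mult: "u \<otimes>\<^bsub>T\<^esub> w \<in> annJ" if "u \<in> carrier T" "w \<in> annJ" for u w
    using that by (auto simp: annJ_def T.m_lcomm)
  have lmult: "x \<otimes> a \<in> mu ` annJ" if ax: "a \<in> mu ` annJ" "x \<in> carrier B" for a x
  proof -
    obtain w where w: "w \<in> annJ" "a = mu w" using ax by auto
    then have "x \<otimes> a = mu (iota x \<otimes>\<^bsub>T\<^esub> w)" using ax annJ_closed by (simp add: mu_iota)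
    then show ?thesis using mult[OF _ w(1), of "iota x"] ax by auto
  qed
  then show "a \<in> mu ` annJ \<Longrightarrow> x \<in> carrier B \<Longrightarrow> x \<otimes> a \<in> mu ` annJ" for a x .
  have sub: "mu ` annJ \<subseteq> carrier B" using annJ_closed by auto
  show "a \<otimes> x \<in> mu ` annJ" if "a \<in> mu ` annJ" "x \<in> carrier B" for a x
    using lmult[OF that] that sub by (subst B.m_comm) auto
  show "subgroup (mu ` annJ) (add_monoid B)"
  proof (rule B.add.subgroupI)
    show "mu ` annJ \<noteq> {}" by (auto simp: annJ_def intro!: exI[of _ "\<zero>\<^bsub>T\<^esub>"])
    show "\<ominus> a \<in> mu ` annJ" if "a \<in> mu ` annJ" for a
      using lmult[OF that, of "\<ominus> \<one>"] that sub by (auto simp: B.l_minus)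
    show "a \<oplus> b \<in> mu ` annJ" if ab: "a \<in> mu ` annJ" "b \<in> mu ` annJ" for a b
    proof -
      obtain v w where vw: "v \<in> annJ" "w \<in> annJ" "a = mu v" "b = mu w" using ab by auto
      then have "a \<oplus> b = mu (v \<oplus>\<^bsub>T\<^esub> w)" using annJ_closed by simp
      then show ?thesis using add vw by auto
    qed
  qed (use sub in auto)
qed

text \<open>The minors of any presentation lie in the Noether different, and since this is an ideal,
  so does all of \<open>I\<close>. Each \<open>b\<close> in \<open>I\<close> is thus some
  \<open>mu w\<close> with \<open>w\<close> in \<open>annJ\<close>, the case settled by
  \<open>disc_divides_norm\<close>.\<close>

lemma fitting_norm:
  assumes "is_fitting_ideal0 B (kaehler A B) I" "b \<in> I"
  shows "disc A B n e divides\<^bsub>A\<^esub> alg_norm A B n e b"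
proof -
  obtain m g k P where pres: "presentation B \<Omega> m g k P" and I: "I = minors_ideal B m k P"
    using assms(1) by (auto simp: is_fitting_ideal0_def kaehler_eq)
  have "I \<subseteq> mu ` annJ"
    unfolding I minors_ideal_def
  proof (rule B.genideal_minimal[OF noether_different_ideal], clarify)
    fix r assume "r \<in> {..<m} \<rightarrow> {..<k}"
    from minor_in_noether_different[OF pres this]
    show "mat_det B m (\<lambda>i j. P (r i) j) \<in> mu ` annJ" by (metis imageI)
  qed
  then show ?thesis using assms(2) disc_divides_norm by auto
qed

section \<open>Vanishing differentials\<close>

lemma alg_norm_one: "alg_norm A B n e \<one> = \<one>\<^bsub>A\<^esub>"
proof -
  have "alg_norm A B n e \<one> = mat_det A n (\<lambda>i j. if i = j then \<one>\<^bsub>A\<^esub> else \<zero>\<^bsub>A\<^esub>)"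
    unfolding alg_norm_def
    by (rule A.mat_det_cong) (auto intro!: mat_overI simp: mult_matrix_def co_e)
  then show ?thesis by (simp add: A.mat_det_one)
qed

lemma disc_closed: "disc A B n e \<in> carrier A"
  unfolding disc_def by (rule A.mat_det_closed) (auto intro!: mat_overI)

lemma disc_unit:
  assumes "carrier (kaehler A B) = {\<zero>\<^bsub>kaehler A B\<^esub>}"
  shows "disc A B n e \<in> Units A"
proof -
  let ?P = "\<lambda>_ _. \<zero>"
  have "presentation B \<Omega> 0 (\<lambda>_. \<zero>\<^bsub>\<Omega>\<^esub>) 0 ?P"
    using assms OM.module_axioms by (auto simp: presentation_def kaehler_eq lin_comb_def)
  then have fit: "is_fitting_ideal0 B (kaehler A B) (minors_ideal B 0 0 ?P)"
    unfolding is_fitting_ideal0_def kaehler_eq by blast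
  \<comment> \<open>The empty determinant is \<one>: the only permutation of the empty set
    contributes an empty product.\<close>
  have "mat_det B 0 M = \<one>" for M
    using B.mat_det_cong[of 0 "\<lambda>i j. if i = j then \<one> else \<zero>" M] B.mat_det_one[of 0]
    by (simp add: mat_over_def)
  \<comment> \<open>The required row selection is the empty one, for which any \<open>r\<close>
    qualifies vacuously.\<close>
  then have "\<one> \<in> minors_ideal B 0 0 ?P"
    unfolding minors_ideal_def
    by (intro subsetD[OF B.genideal_self]) (auto simp: strict_mono_on_def intro!: exI[of _ "\<lambda>i. i"])
  from fitting_norm[OF fit this] have "disc A B n e divides\<^bsub>A\<^esub> \<one>\<^bsub>A\<^esub>"
    by (simp add: alg_norm_one)
  then show ?thesis using A.divides_one[OF disc_closed] by blast
qed

end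

theorem mainTheorem1:
  fixes A :: "('a, 'c) ring_scheme"
    and B :: "('a, 'b, 'd) module_scheme"
    and n :: nat
    and e :: "nat \<Rightarrow> 'b"
  assumes "algebra A B"
    and "free_basis A B n e"
  shows "finitely_presented B (kaehler A B) \<and>
         (\<forall>I. is_fitting_ideal0 B (kaehler A B) I \<longrightarrow>
            (\<forall>b \<in> carrier B. b \<in> I \<longrightarrow> disc A B n e divides\<^bsub>A\<^esub> alg_norm A B n e b)) \<and>
         (carrier (kaehler A B) = {\<zero>\<^bsub>kaehler A B\<^esub>} \<longrightarrow> disc A B n e \<in> Units A)"
proof -
  interpret free_algebra A B n e
    using assms algebra.R_cring algebra.M_cring
    by (intro free_algebra.intro free_algebra_axioms.intro) auto
  have "finitely_presented B (kaehler A B)"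
    unfolding finitely_presented_def kaehler_eq using kaehler_presentation by blast
  then show ?thesis using fitting_norm disc_unit by blast
qed

end
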